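(* Let $A \in M_n(\mathbb{R})$ be entrywise nonnegative, nonsingular, irreducible, and imprimitive. Let $h > 1$ be the cyclic index of $A$, let $\Pi$ describe the $h$-cyclic structure of $A$, let $p > 1$ be an integer with $\gcd(h,p) = 1$, and let the Jordan canonical form of $A$ be partitioned as $$\begin{bmatrix} J_+ & & \\ & J_- & \\ & & J_{\mathbb{C}} \end{bmatrix},$$ where each of $J_+, J_-, J_{\mathbb{C}}$ is a direct sum of blocks of the form $J(\lambda\nu_h, r)$, sorted according to the rule given in the context. Suppose $J_+$ has $r_1$ distinct blocks of the form $J(\lambda \nu_h, r)$, $J_-$ has $r_2$ distinct blocks of the form $J(\lambda\nu_h, r)$, and $J_{\mathbb{C}}$ has $c$ distinct blocks of the form $J(\lambda\nu_h, r)$. If $p$ is even, and (a) $r_2 = 0$, then $A$ has $2^{r_1-1}p^c$ eventually nonnegative primary $p$th-roots; or (b) $r_2 > 0$, then $A$ has no eventually nonnegative primary $p$th-roots. If $p$ is odd, then $A$ has $p^c$ eventually nonnegative primary $p$th-roots.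
   Context: Eventual nonnegativity: a real matrix $X$ is eventually nonnegative if there is a nonnegative integer $k_0$ such that $X^k$ is entrywise nonnegative for all $k \ge k_0$. Digraphs and cyclicity: the digraph $\Gamma(A)$ of $A \in M_n(\mathbb{C})$ has vertex set $\{1,\dots,n\}$ and an arc $(i,j)$ whenever $a_{ij}\neq 0$. $A$ is irreducible if and only if $\Gamma(A)$ is strongly connected. The index of imprimitivity of a strongly connected digraph is the gcd of the lengths of its closed walks. An irreducible nonnegative matrix is imprimitive if the index of imprimitivity of its digraph is greater than one. For $h \ge 2$, $A$ is $h$-cyclic with ordered partition $\Pi = (\pi_1,\dots,\pi_h)$ of $\{1,\dots,n\}$ into nonempty subsets (and one says that $\Pi$ describes the $h$-cyclic structure of $A$) if for each arc $(i,j)$ of $\Gamma(A)$ there exists $\ell \in \{1,\dots,h\}$ such that $i\in\pi_\ell$ and $j \in \pi_{\ell+1}$, where $\pi_{h+1} := \pi_1$. The cyclic index of $A$ is the largest $h$ for which $A$ is $h$-cyclic; for an irreducible imprimitive nonnegative matrix it equals the index of imprimitivity. Jordan form: $J_r(\lambda)$ is the $r\times r$ Jordan block with eigenvalue $\lambda$. Let $\omega = \exp(2\pi \mathrm{i}/h)$, $\nu_h = (1,\omega,\dots,\omega^{h-1})$, and $$J(\lambda\nu_h, r) := J_r(\lambda)\oplus J_r(\lambda\omega)\oplus\cdots\oplus J_r(\lambda\omega^{h-1}) \in M_{rh}(\mathbb{C}).$$ A Jordan form of a nonsingular $h$-cyclic matrix is a direct sum of blocks of the form $J(\lambda\nu_h,r)$.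 Writing $\sigma(\cdot)$ for the spectrum and $\mathbb{R}^+$, $\mathbb{R}^-$ for the positive and negative reals, the blocks are sorted as follows: (1) $J(\lambda\nu_h,r)$ is a submatrix of $J_+$ if and only if $\sigma(J(\lambda\nu_h,r))\cap\mathbb{R}^+\neq\emptyset$ and $\sigma(J(\lambda\nu_h,r))\cap\mathbb{R}^-=\emptyset$; (2) $J(\lambda\nu_h,r)$ is a submatrix of $J_-$ if and only if $\sigma(J(\lambda\nu_h,r))\cap\mathbb{R}^-\neq\emptyset$; (3) $J(\lambda\nu_h,r)$ is a submatrix of $J_{\mathbb{C}}$ if and only if $\sigma(J(\lambda\nu_h,r))\cap\mathbb{R}=\emptyset$. Roots: a $p$th-root of $A$ is a matrix $X$ with $X^p = A$. The primary $p$th-roots of a nonsingular $A$ are those expressible as polynomials in $A$. Equivalently, if $Z^{-1}AZ = \bigoplus_{i=1}^t J_{n_i}(\lambda_i)$ is a Jordan form, they are the matrices $Z\left(\bigoplus_{i=1}^t f_{j_i}(J_{n_i}(\lambda_i))\right)Z^{-1}$ with $j_i\in\{0,\dots,p-1\}$ and $j_i = j_k$ whenever $\lambda_i=\lambda_k$, where $f_j(re^{\mathrm{i}\theta}) = r^{1/p}e^{\mathrm{i}(\theta+2\pi j)/p}$ is the $(j+1)$st branch of the $p$th-root function.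
   Formalization: Here c counts pairs of distinct complex conjugate blocks in J_C (self-conjugate blocks are not counted), and blocks are distinct only if their spectra differ, whatever their sizes; with the literal count of distinct blocks the formulas fail. *)

theory Defs
  imports
    "HOL-Library.Disjoint_Sets"
    "Jordan_Normal_Form.Jordan_Normal_Form"
    "Jordan_Normal_Form.Spectral_Radius"
    "Graph_Theory.Graph_Theory"
begin

definition entrywise_nonneg :: "real mat \<Rightarrow> bool" where
  "entrywise_nonneg A \<longleftrightarrow> (\<forall>i < dim_row A. \<forall>j < dim_col A. 0 \<le> A $$ (i, j))"

definition eventually_nonneg :: "real mat \<Rightarrow> bool" where
  "eventually_nonneg X \<longleftrightarrow> (\<exists>k\<^sub>0. \<forall>k \<ge> k\<^sub>0. entrywise_nonneg (X ^\<^sub>m k))"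

abbreviation cmat :: "real mat \<Rightarrow> complex mat" where
  "cmat A \<equiv> map_mat complex_of_real A"


text \<open>Rows and columns, hence the vertices of the digraph, are numbered from 0.\<close>

definition mat_digraph :: "'a::zero mat \<Rightarrow> (nat, nat \<times> nat) pre_digraph" where
  "mat_digraph A = with_proj
     \<lparr> pverts = {0..<dim_row A},
       parcs = {(i, j). i < dim_row A \<and> j < dim_col A \<and> A $$ (i, j) \<noteq> 0} \<rparr>"

definition irreducible_mat :: "'a::zero mat \<Rightarrow> bool" where
  "irreducible_mat A \<longleftrightarrow> strongly_connected (mat_digraph A)"

definition imprimitivity_index :: "('a, 'b) pre_digraph \<Rightarrow> nat" where
  "imprimitivity_index G = Gcd {length w | u w. pre_digraph.awalk G u w u \<and> 0 < length w}"

definition imprimitive_mat :: "real mat \<Rightarrow> bool" where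
  "imprimitive_mat A \<longleftrightarrow> entrywise_nonneg A \<and> irreducible_mat A
     \<and> imprimitivity_index (mat_digraph A) > 1"


text \<open>An ordered partition is the list of its parts. Distinctness is required separately, because
  \<^const>\<open>partition_on\<close> sees only the set of parts.\<close>

definition describes_cyclic :: "nat \<Rightarrow> nat set list \<Rightarrow> 'a::zero mat \<Rightarrow> bool" where
  "describes_cyclic h Ps A \<longleftrightarrow>
     h \<ge> 2 \<and> length Ps = h \<and> distinct Ps \<and> partition_on {0..<dim_row A} (set Ps) \<and>
     (\<forall>(i, j) \<in> arcs (mat_digraph A). \<exists>l < h. i \<in> Ps ! l \<and> j \<in> Ps ! (Suc l mod h))"

definition cyclic_mat :: "nat \<Rightarrow> 'a::zero mat \<Rightarrow> bool" where
  "cyclic_mat h A \<longleftrightarrow> (\<exists>Ps. describes_cyclic h Ps A)"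

definition cyclic_index :: "'a::zero mat \<Rightarrow> nat" where
  "cyclic_index A = (GREATEST h. cyclic_mat h A)"


text \<open>A pair \<open>(r, \<lambda>)\<close> stands for the block \<open>J(\<lambda>\<nu>\<^sub>h, r)\<close>. As in \<^const>\<open>jordan_nf\<close>, the size comes first,
  and a list of pairs stands for the direct sum of the blocks.\<close>

definition cyc_jordan_list :: "nat \<Rightarrow> (nat \<times> complex) \<Rightarrow> (nat \<times> complex) list" where
  "cyc_jordan_list h b =
     map (\<lambda>k. (fst b, snd b * exp (2 * of_real pi * \<i> / of_nat h) ^ k)) [0..<h]"

definition cyc_jordan_block :: "nat \<Rightarrow> (nat \<times> complex) \<Rightarrow> complex mat" where
  "cyc_jordan_block h b = jordan_matrix (cyc_jordan_list h b)"

definition cyc_jordan_sum :: "nat \<Rightarrow> (nat \<times> complex) list \<Rightarrow> (nat \<times> complex) list" where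
  "cyc_jordan_sum h bs = concat (map (cyc_jordan_list h) bs)"

definition pos_reals :: "complex set" where
  "pos_reals = complex_of_real ` {0<..}"

definition neg_reals :: "complex set" where
  "neg_reals = complex_of_real ` {..<0}"

definition sorted_blocks ::
  "nat \<Rightarrow> (nat \<times> complex) list \<Rightarrow> (nat \<times> complex) list \<Rightarrow> (nat \<times> complex) list \<Rightarrow> bool" where
  "sorted_blocks h bp bm bc \<longleftrightarrow> (\<forall>b \<in> set (bp @ bm @ bc).
     (b \<in> set bp \<longleftrightarrow> spectrum (cyc_jordan_block h b) \<inter> pos_reals \<noteq> {} \<and>
                    spectrum (cyc_jordan_block h b) \<inter> neg_reals = {}) \<and>
     (b \<in> set bm \<longleftrightarrow> spectrum (cyc_jordan_block h b) \<inter> neg_reals \<noteq> {}) \<and>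
     (b \<in> set bc \<longleftrightarrow> spectrum (cyc_jordan_block h b) \<inter> \<real> = {}))"

text \<open>Blocks are distinct when their spectra are: \<open>J(\<lambda>\<nu>\<^sub>h, r)\<close> and \<open>J(\<lambda>\<omega>\<nu>\<^sub>h, r)\<close> agree up to the
  order of their summands, and a primary root uses the same branch on blocks that have the same
  eigenvalues but different sizes.\<close>

definition block_spectra :: "nat \<Rightarrow> (nat \<times> complex) list \<Rightarrow> complex set set" where
  "block_spectra h bs = (\<lambda>b. spectrum (cyc_jordan_block h b)) ` set bs"

definition num_real_blocks :: "nat \<Rightarrow> (nat \<times> complex) list \<Rightarrow> nat" where
  "num_real_blocks h bs = card (block_spectra h bs)"

text \<open>The nonreal blocks of a real matrix are counted in complex conjugate pairs, as nonreal
  eigenvalues are in the classical count of real primary roots: the branch on \<open>J(\<lambda>\<nu>\<^sub>h, r)\<close> determines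
  that on its conjugate. A block without real eigenvalues can be its own conjugate (\<open>h\<close> even,
  \<open>\<lambda> = \<rho> exp(\<pi>\<i>/h)\<close>). Such a block belongs to no pair: since its branch must respect both
  conjugation and multiplication by \<open>\<omega>\<close>, it leaves no choice.\<close>

definition num_conjugate_pairs :: "nat \<Rightarrow> (nat \<times> complex) list \<Rightarrow> nat" where
  "num_conjugate_pairs h bs = card {{S, cnj ` S} | S. S \<in> block_spectra h bs \<and> cnj ` S \<noteq> S}"


definition mat_poly :: "'a::comm_ring_1 poly \<Rightarrow> 'a mat \<Rightarrow> 'a mat" where
  "mat_poly q A = mat (dim_row A) (dim_row A)
     (\<lambda>(i, j). \<Sum>k \<le> degree q. coeff q k * (A ^\<^sub>m k) $$ (i, j))"

definition primary_root :: "nat \<Rightarrow> complex mat \<Rightarrow> complex mat \<Rightarrow> bool" where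
  "primary_root p A X \<longleftrightarrow>
     X \<in> carrier_mat (dim_row A) (dim_row A) \<and> X ^\<^sub>m p = A \<and> (\<exists>q. X = mat_poly q A)"

definition ev_nonneg_primary_roots :: "nat \<Rightarrow> real mat \<Rightarrow> real mat set" where
  "ev_nonneg_primary_roots p A = {X. primary_root p (cmat A) (cmat X) \<and> eventually_nonneg X}"

end

theory Submission
  imports Defs
begin

text \<open>
  A polynomial \<open>X = q(A)\<close> with \<open>X\<^sup>p = A\<close> is determined by the function \<open>g(\<lambda>) = q(\<lambda>)\<close> on the spectrum of
  \<open>A\<close>, and \<open>g\<close> may be any function that picks a \<open>p\<close>-th root of each eigenvalue. The nilpotent parts of
  \<open>A\<close> leave no freedom, since \<open>p g(\<lambda>)\<^bsup>p-1\<^esup> \<noteq> 0\<close> (\<open>primary_root_exists\<close>, \<open>mat_poly_root_unique\<close>). So the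
  task is to recognise the functions \<open>g\<close> that belong to eventually nonnegative matrices, and to count them.

  Put \<open>w = exp(2\<pi>\<i>/h)\<close>, let \<open>D\<close> be the diagonal matrix with entry \<open>w\<^sup>l\<close> on the \<open>l\<close>-th part of the cyclic
  partition, and let \<open>x\<close> be the Perron vector of \<open>A\<close>, with eigenvalue \<open>\<rho>\<close>. Then \<open>D\<^bsup>-1\<^esup> A D = w A\<close>, so the
  spectrum is closed under multiplication by \<open>h\<close>-th roots of unity, and it is closed under conjugation
  because \<open>A\<close> is real. Let \<open>s\<close> be inverse to \<open>p\<close> modulo \<open>h\<close>. The matrix \<open>X\<close> is real and eventually
  nonnegative if and only if \<open>g\<close> commutes with conjugation, \<open>g(u\<lambda>) = u\<^sup>s g(\<lambda>)\<close> for every \<open>h\<close>-th root of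
  unity \<open>u\<close>, and \<open>g(\<rho>) > 0\<close> (\<open>bij_ev_nonneg_primary_roots\<close>).

  These conditions are necessary. A nonnegative power \<open>X\<^sup>k\<close> has the positive eigenvector \<open>x\<close>, so \<open>\<mu> = g(\<rho>)\<close>
  is positive. It also has the eigenvector \<open>D x\<close>, whose eigenvalue \<open>g(w\<rho>)\<^sup>k\<close> has the same modulus \<open>\<mu>\<^sup>k\<close>.
  Equality in the triangle inequality (\<open>phase_alignment\<close>) then forces \<open>D\<^sub>j = e\<^sup>k D\<^sub>i\<close> wherever the entry
  \<open>(i, j)\<close> of \<open>X\<^sup>k\<close> is nonzero, with \<open>e = g(w\<rho>)/\<mu>\<close>. Two consecutive exponents \<open>k\<close> show \<open>e\<^sup>h = 1\<close>, and
  \<open>e\<^sup>p = w\<close> then leaves only \<open>e = w\<^sup>s\<close>.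

  They are sufficient. Uniqueness of primary roots turns the symmetries of \<open>g\<close> into symmetries of \<open>X\<close>: it is
  real and \<open>D\<^bsup>-1\<^esup> X D = w\<^sup>s X\<close>. The eigenvalues of \<open>A\<close> of modulus \<open>\<rho>\<close> are the numbers \<open>u\<rho>\<close> with
  \<open>u\<^sup>h = 1\<close>, with eigenvectors \<open>D\<^sup>j x\<close> only; here \<open>h\<close> has to be the cyclic index, which equals the greatest
  common divisor of the closed walk lengths (\<open>cyclic_index_phase\<close>). Removing these eigenvectors from
  \<open>X/\<mu>\<close> leaves a matrix of spectral radius less than \<open>1\<close>. Hence an entry of \<open>(X/\<mu>)\<^sup>k\<close> is exactly zero where
  the symmetry demands it, and elsewhere stays close to a fixed positive number (\<open>eventually_nonneg_root\<close>).

  For the count, rotations and conjugation act on the spectrum, and \<open>g\<close> is determined by one value on each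
  orbit of this action, with independent choices on different orbits. A pair of conjugate blocks leaves all
  \<open>p\<close> branches. A self-conjugate block leaves one branch if \<open>p\<close> is odd. If \<open>p\<close> is even then \<open>h\<close> is odd, so
  a self-conjugate block contains a real eigenvalue: a negative one has no real root, a positive one has
  two, and the block of \<open>\<rho>\<close> only one because \<open>g(\<rho>) > 0\<close>.
\<close>

section \<open>Polynomials in a matrix and primary roots\<close>

lemma mat_poly_carrier [simp]: "A \<in> carrier_mat n n \<Longrightarrow> mat_poly q A \<in> carrier_mat n n"
  by (auto simp: mat_poly_def)

lemma mat_poly_dim [simp]: "dim_row (mat_poly q A) = dim_row A" "dim_col (mat_poly q A) = dim_row A"
  by (auto simp: mat_poly_def)

lemma pow_mat_Suc_left:
  fixes A :: "'a::semiring_1 mat"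
  assumes A: "A \<in> carrier_mat n n"
  shows "A ^\<^sub>m Suc k = A * A ^\<^sub>m k"
proof (induction k)
  case (Suc k)
  have "A ^\<^sub>m Suc (Suc k) = A * A ^\<^sub>m k * A" using Suc by simp
  also have "\<dots> = A * (A ^\<^sub>m k * A)" using A by (intro assoc_mult_mat) auto
  finally show ?case by simp
qed (use A in auto)

text \<open>Entrywise access with any bound on the degree: sums for polynomials of different degrees can then
  be compared over one index range.\<close>

lemma mat_poly_index:
  assumes "A \<in> carrier_mat n n" "i < n" "j < n" "degree q \<le> N"
  shows "mat_poly q A $$ (i, j) = (\<Sum>k\<le>N. coeff q k * (A ^\<^sub>m k) $$ (i, j))"
proof -
  have "(\<Sum>k\<le>degree q. coeff q k * (A ^\<^sub>m k) $$ (i, j)) = (\<Sum>k\<le>N. coeff q k * (A ^\<^sub>m k) $$ (i, j))"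
    by (rule sum.mono_neutral_left) (use assms in \<open>auto simp: coeff_eq_0\<close>)
  then show ?thesis using assms by (auto simp: mat_poly_def)
qed

lemma mat_poly_add:
  assumes A: "A \<in> carrier_mat n n"
  shows "mat_poly (p + q) A = mat_poly p A + mat_poly q A"
proof (rule eq_matI)
  fix i j assume "i < dim_row (mat_poly p A + mat_poly q A)" "j < dim_col (mat_poly p A + mat_poly q A)"
  then have ij: "i < n" "j < n" using A by (auto simp: mat_poly_def)
  let ?N = "max (degree p) (degree q)"
  show "mat_poly (p + q) A $$ (i, j) = (mat_poly p A + mat_poly q A) $$ (i, j)"
    using ij A mat_poly_index[OF A ij, of "p + q" ?N] mat_poly_index[OF A ij, of p ?N]
      mat_poly_index[OF A ij, of q ?N]
    by (simp add: degree_add_le_max mat_poly_carrier[OF A, THEN carrier_matD(1)]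
        mat_poly_carrier[OF A, THEN carrier_matD(2)] ring_distribs sum.distrib)
qed (use A in \<open>auto simp: mat_poly_def\<close>)

lemma mat_poly_smult:
  assumes A: "A \<in> carrier_mat n n"
  shows "mat_poly (Polynomial.smult c q) A = c \<cdot>\<^sub>m mat_poly q A"
proof (rule eq_matI)
  fix i j assume "i < dim_row (c \<cdot>\<^sub>m mat_poly q A)" "j < dim_col (c \<cdot>\<^sub>m mat_poly q A)"
  then have ij: "i < n" "j < n" using A by (auto simp: mat_poly_def)
  show "mat_poly (Polynomial.smult c q) A $$ (i, j) = (c \<cdot>\<^sub>m mat_poly q A) $$ (i, j)"
    using ij A mat_poly_index[OF A ij, of "Polynomial.smult c q" "degree q"] mat_poly_index[OF A ij, of q "degree q"]
    by (simp add: mat_poly_carrier[OF A, THEN carrier_matD(1)] degree_smult_le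
        mat_poly_carrier[OF A, THEN carrier_matD(2)] sum_distrib_left mult.assoc)
qed (use A in \<open>auto simp: mat_poly_def\<close>)

lemma mat_poly_0: "A \<in> carrier_mat n n \<Longrightarrow> mat_poly 0 A = 0\<^sub>m n n"
  by (auto simp: mat_poly_def)

lemma mat_poly_pCons:
  assumes A: "A \<in> carrier_mat n n"
  shows "mat_poly (pCons a q) A = a \<cdot>\<^sub>m 1\<^sub>m n + A * mat_poly q A"
proof (rule eq_matI)
  fix i j assume "i < dim_row (a \<cdot>\<^sub>m 1\<^sub>m n + A * mat_poly q A)" "j < dim_col (a \<cdot>\<^sub>m 1\<^sub>m n + A * mat_poly q A)"
  then have ij: "i < n" "j < n" using A by (auto simp: mat_poly_def)
  have pow: "(A ^\<^sub>m Suc k) $$ (i, j) = (\<Sum>l<n. A $$ (i, l) * (A ^\<^sub>m k) $$ (l, j))" for k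
    using ij A pow_carrier_mat[OF A, of k]
    by (auto simp: pow_mat_Suc_left[OF A] scalar_prod_def atLeast0LessThan simp del: pow_mat.simps
        intro!: sum.cong arg_cong2[where f="(*)"])
  have "mat_poly (pCons a q) A $$ (i, j) = (\<Sum>k\<le>Suc (degree q). coeff (pCons a q) k * (A ^\<^sub>m k) $$ (i, j))"
    by (rule mat_poly_index[OF A ij]) (simp add: degree_pCons_le)
  also have "\<dots> = a * 1\<^sub>m n $$ (i, j) + (\<Sum>k\<le>degree q. coeff q k * (A ^\<^sub>m Suc k) $$ (i, j))"
    using A by (subst sum.atMost_Suc_shift) simp
  also have "(\<Sum>k\<le>degree q. coeff q k * (A ^\<^sub>m Suc k) $$ (i, j))
      = (\<Sum>l<n. \<Sum>k\<le>degree q. A $$ (i, l) * (coeff q k * (A ^\<^sub>m k) $$ (l, j)))"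
    unfolding pow by (subst sum.swap) (simp add: sum_distrib_left mult_ac)
  also have "\<dots> = (\<Sum>l<n. A $$ (i, l) * mat_poly q A $$ (l, j))"
    using mat_poly_index[OF A _ ij(2), of _ q "degree q"]
    by (intro sum.cong) (auto simp: sum_distrib_left)
  also have "\<dots> = (A * mat_poly q A) $$ (i, j)"
    using A ij mat_poly_carrier[OF A, of q] by (auto simp: scalar_prod_def atLeast0LessThan intro!: sum.cong)
  finally show "mat_poly (pCons a q) A $$ (i, j) = (a \<cdot>\<^sub>m 1\<^sub>m n + A * mat_poly q A) $$ (i, j)"
    using ij A mat_poly_carrier[OF A, of q] by auto
qed (use A in \<open>auto simp: mat_poly_def\<close>)

lemma mat_poly_const: "A \<in> carrier_mat n n \<Longrightarrow> mat_poly [:a:] A = a \<cdot>\<^sub>m 1\<^sub>m n"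
  by (simp add: mat_poly_pCons mat_poly_0)

lemma mat_poly_1: "A \<in> carrier_mat n n \<Longrightarrow> mat_poly 1 A = 1\<^sub>m n"
  using mat_poly_const[of A n 1] by (auto simp: one_pCons)

lemma mat_poly_linear:
  assumes A: "A \<in> carrier_mat n n"
  shows "mat_poly [:a, b:] A = a \<cdot>\<^sub>m 1\<^sub>m n + b \<cdot>\<^sub>m A"
  using mat_poly_pCons[OF A, of a "[:b:]"] A
  by (simp only: mat_poly_const mult_smult_distrib[OF A one_carrier_mat] right_mult_one_mat)
 
text \<open>Evaluation at a matrix is multiplicative. With additivity this makes identities and divisibility
  between polynomials available for matrices.\<close>

lemma mat_poly_mult:
  assumes A: "A \<in> carrier_mat n n"
  shows "mat_poly (p * q) A = mat_poly p A * mat_poly q A"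
proof (induction p)
  case 0
  then show ?case using A left_mult_zero_mat[of "mat_poly q A" n n n] by (simp add: mat_poly_0)
next
  case (pCons a p)
  let ?P = "mat_poly p A" and ?Q = "mat_poly q A"
  have [simp]: "?P \<in> carrier_mat n n" "?Q \<in> carrier_mat n n" using A by auto
  have "mat_poly (pCons a p * q) A = a \<cdot>\<^sub>m ?Q + (0 \<cdot>\<^sub>m 1\<^sub>m n + A * (?P * ?Q))"
    by (simp only: mult_pCons_left mat_poly_add[OF A] mat_poly_smult[OF A] mat_poly_pCons[OF A] pCons.IH)
  also have "0 \<cdot>\<^sub>m 1\<^sub>m n + A * (?P * ?Q) = A * ?P * ?Q"
    using A by (subst assoc_mult_mat[of A n n ?P n ?Q n]) (auto intro!: eq_matI)
  also have "a \<cdot>\<^sub>m ?Q + A * ?P * ?Q = (a \<cdot>\<^sub>m 1\<^sub>m n + A * ?P) * ?Q"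
    using A by (simp add: add_mult_distrib_mat[of _ n n _ _ n] mult_smult_assoc_mat[of _ n n _ n])
  finally show ?case by (simp add: mat_poly_pCons[OF A])
qed

lemma mat_poly_power:
  assumes A: "A \<in> carrier_mat n n"
  shows "mat_poly (q ^ k) A = mat_poly q A ^\<^sub>m k"
proof (induction k)
  case 0
  then show ?case using A by (simp add: mat_poly_1)
next
  case (Suc k)
  then show ?case by (simp add: mat_poly_mult[OF A] power_Suc2 del: power_Suc)
qed

lemma mat_poly_eigenvector:
  fixes A :: "'a::field mat"
  assumes A: "A \<in> carrier_mat n n" and v: "v \<in> carrier_vec n" "A *\<^sub>v v = l \<cdot>\<^sub>v v"
  shows "mat_poly q A *\<^sub>v v = poly q l \<cdot>\<^sub>v v"
proof (induction q)
  case 0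
  have "0\<^sub>m n n *\<^sub>v v = 0 \<cdot>\<^sub>v v" using v(1) by (intro eq_vecI) auto
  then show ?case using A by (simp add: mat_poly_0)
next
  case (pCons a q)
  let ?Q = "mat_poly q A"
  have [simp]: "?Q \<in> carrier_mat n n" using A by auto
  have "mat_poly (pCons a q) A *\<^sub>v v = a \<cdot>\<^sub>v v + A *\<^sub>v (?Q *\<^sub>v v)"
  proof -
    have "(a \<cdot>\<^sub>m 1\<^sub>m n) *\<^sub>v v = a \<cdot>\<^sub>v v"
      using v(1) by (intro eq_vecI) (auto simp: smult_scalar_prod_distrib[of _ n])
    then show ?thesis using A v(1)
      by (simp add: mat_poly_pCons[OF A] add_mult_distrib_mat_vec[of _ n n] assoc_mult_mat_vec[of A n n ?Q n])
  qed
  also have "\<dots> = a \<cdot>\<^sub>v v + poly q l \<cdot>\<^sub>v (l \<cdot>\<^sub>v v)"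
    using A v by (simp add: pCons.IH mult_mat_vec[of A n n])
  finally show ?case using v(1) by (simp add: smult_smult_assoc add_smult_distrib_vec mult.commute)
qed

lemma mat_poly_similar:
  assumes "similar_mat_wit A B P Q" "A \<in> carrier_mat n n"
  shows "mat_poly q A = P * mat_poly q B * Q"
proof -
  note wit = similar_mat_witD2[OF assms(2,1)]
  show ?thesis
  proof (induction q)
    case 0
    then show ?case using wit by (simp add: mat_poly_0)
  next
    case (pCons a q)
    let ?C = "mat_poly q B"
    have C: "?C \<in> carrier_mat n n" using wit by auto
    have R: "?C * Q \<in> carrier_mat n n" using C wit by auto
    have "A * mat_poly q A = (P * B * Q) * (P * ?C * Q)" using pCons.IH wit by simp
    also have "\<dots> = (P * B) * (Q * (P * (?C * Q)))"
      using wit C R by (simp add: assoc_mult_mat[of _ n n _ n _ n])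
    also have "Q * (P * (?C * Q)) = Q * P * (?C * Q)"
      using wit R by (intro assoc_mult_mat[symmetric]) auto
    also have "\<dots> = ?C * Q" using wit R by simp
    also have "P * B * (?C * Q) = P * (B * ?C) * Q"
      using wit C R by (simp add: assoc_mult_mat[of _ n n _ n _ n])
    finally have "a \<cdot>\<^sub>m 1\<^sub>m n + A * mat_poly q A = a \<cdot>\<^sub>m (P * 1\<^sub>m n * Q) + P * (B * ?C) * Q"
      using wit by simp
    also have "a \<cdot>\<^sub>m (P * 1\<^sub>m n * Q) = P * (a \<cdot>\<^sub>m 1\<^sub>m n) * Q"
      by (simp only: mult_smult_distrib[OF wit(6) one_carrier_mat] mult_smult_assoc_mat[OF mult_carrier_mat[OF wit(6) one_carrier_mat] wit(7)])
    also have "\<dots> + P * (B * ?C) * Q = P * (a \<cdot>\<^sub>m 1\<^sub>m n + B * ?C) * Q"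
      using wit C by (simp add: mult_add_distrib_mat[of _ n n _ n] add_mult_distrib_mat[of _ n n _ _ n])
    finally show ?case using wit by (simp add: mat_poly_pCons[of _ n])
  qed
qed

text \<open>The product of the first \<open>k\<close> factors \<open>B - b\<^sub>i\<^sub>i\<close> kills the
  first \<open>k\<close> unit vectors, because the next factor maps the span of the first \<open>k +
  1\<close> unit vectors into the span of the first \<open>k\<close>.\<close>

lemma upper_triangular_annihilated:
  fixes B :: "'a::comm_ring_1 mat"
  assumes B: "B \<in> carrier_mat n n" and ut: "upper_triangular B"
  shows "mat_poly (\<Prod>a\<leftarrow>diag_mat B. [:- a, 1:]) B = 0\<^sub>m n n"
proof -
  have "mat_poly (\<Prod>a\<leftarrow>take k (diag_mat B). [:- a, 1:]) B $$ (i, j) = 0"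
    if "k \<le> n" "i < n" "j < k" for i j k
    using that
  proof (induction k arbitrary: j)
    case (Suc k)
    let ?F = "mat_poly (\<Prod>a\<leftarrow>take k (diag_mat B). [:- a, 1:]) B"
    let ?G = "- (B $$ (k, k)) \<cdot>\<^sub>m 1\<^sub>m n + 1 \<cdot>\<^sub>m B"
    have F: "?F \<in> carrier_mat n n" using B by simp
    have "take (Suc k) (diag_mat B) = take k (diag_mat B) @ [B $$ (k, k)]"
      using Suc.prems B by (simp add: take_Suc_conv_app_nth diag_mat_def)
    then have "(\<Prod>a\<leftarrow>take (Suc k) (diag_mat B). [:- a, 1:])
        = (\<Prod>a\<leftarrow>take k (diag_mat B). [:- a, 1:]) * [:- (B $$ (k, k)), 1:]"
      by (simp del: mult_pCons_left mult_pCons_right)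
    then have "mat_poly (\<Prod>a\<leftarrow>take (Suc k) (diag_mat B). [:- a, 1:]) B = ?F * ?G"
      by (simp only: mat_poly_mult[OF B] mat_poly_linear[OF B])
    also have "(?F * ?G) $$ (i, j) = (\<Sum>c<n. ?F $$ (i, c) * ?G $$ (c, j))"
      using F B Suc.prems by (auto simp: scalar_prod_def atLeast0LessThan intro!: sum.cong)
    also have "\<dots> = 0"
    proof (rule sum.neutral, safe)
      fix c assume "c < n"
      show "?F $$ (i, c) * ?G $$ (c, j) = 0"
      proof (cases "c < k")
        case True
        then show ?thesis using Suc.IH Suc.prems by simp
      next
        case False
        have "?G $$ (c, j) = 0"
        proof (cases "c = j")
          case True
          then have "c = k" "j = k" using False Suc.prems by auto
          then show ?thesis using Suc.prems B by auto
        next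
          case 2: False
          then have "j < c" using False Suc.prems by auto
          then show ?thesis using ut \<open>c < n\<close> B unfolding upper_triangular_def by auto
        qed
        then show ?thesis by simp
      qed
    qed
    finally show ?case .
  qed simp
  from this[of n] B show ?thesis
    by (intro eq_matI) (auto simp: diag_mat_def mat_poly_def)
qed

text \<open>Over the complex numbers a unitary change of basis makes the matrix triangular, so the
  Cayley-Hamilton theorem reduces to the triangular case.\<close>

lemma cayley_hamilton_complex:
  fixes A :: "complex mat"
  assumes A: "A \<in> carrier_mat n n"
  shows "mat_poly (char_poly A) A = 0\<^sub>m n n"
proof -
  obtain as where "char_poly A = (\<Prod>a\<leftarrow>as. [:- a, 1:])" using char_poly_factorized[OF A] by auto
  then obtain B where B: "B \<in> carrier_mat n n" "upper_triangular B" "similar_mat A B"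
    using schur_decomposition_exists[OF A] by auto
  then obtain P Q where w: "similar_mat_wit A B P Q" by (auto simp: similar_mat_def)
  note wit = similar_mat_witD2[OF A w]
  have "char_poly A = (\<Prod>a\<leftarrow>diag_mat B. [:- a, 1:])"
    using char_poly_similar[OF B(3)] char_poly_upper_triangular[OF B(1,2)] by simp
  then have "mat_poly (char_poly A) A = P * 0\<^sub>m n n * Q"
    using mat_poly_similar[OF w A] upper_triangular_annihilated[OF B(1,2)] by simp
  then show ?thesis using wit by simp
qed

text \<open>The squarefree polynomial with root set \<open>S\<close>. For \<open>S\<close> the spectrum, it
  plays the role of the radical of the characteristic polynomial.\<close>

definition root_poly :: "'a::comm_ring_1 set \<Rightarrow> 'a poly" where
  "root_poly S = (\<Prod>l\<in>S. [:- l, 1:])"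

lemma root_poly_dvd_iff:
  fixes S :: "'a::field set"
  assumes "finite S"
  shows "root_poly S dvd f \<longleftrightarrow> (\<forall>l\<in>S. poly f l = 0)"
  using assms
proof (induction S arbitrary: f)
  case (insert a S)
  show ?case
  proof
    assume "root_poly (insert a S) dvd f"
    then show "\<forall>l\<in>insert a S. poly f l = 0"
      using insert.hyps by (auto simp: root_poly_def poly_prod elim!: dvdE)
  next
    assume r: "\<forall>l\<in>insert a S. poly f l = 0"
    then obtain g where g: "f = [:- a, 1:] * g" by (auto simp: poly_eq_0_iff_dvd elim!: dvdE)
    have "\<forall>l\<in>S. poly g l = 0" using r insert.hyps(2) unfolding g by auto
    then have "root_poly S dvd g" using insert.IH by simp
    then show "root_poly (insert a S) dvd f"
      using insert.hyps g by (simp add: root_poly_def mult_dvd_mono del: mult_pCons_left)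
  qed
qed (simp add: root_poly_def)

lemma interpolation_exists:
  fixes g :: "'a::field \<Rightarrow> 'a"
  assumes "finite S"
  shows "\<exists>q. \<forall>l\<in>S. poly q l = g l"
  using assms
proof induction
  case (insert a S)
  then obtain q where q: "\<forall>l\<in>S. poly q l = g l" by auto
  have nz: "poly (root_poly S) a \<noteq> 0" using insert.hyps by (auto simp: root_poly_def poly_prod)
  have z: "poly (root_poly S) l = 0" if "l \<in> S" for l
    using root_poly_dvd_iff[OF insert.hyps(1), of "root_poly S"] that by simp
  define q' where "q' = q + Polynomial.smult ((g a - poly q a) / poly (root_poly S) a) (root_poly S)"
  have "\<forall>l\<in>insert a S. poly q' l = g l" using q nz z by (auto simp: q'_def)
  then show ?case by blast
qed auto

lemma char_poly_dvd_root_poly_power: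
  fixes A :: "complex mat"
  assumes A: "A \<in> carrier_mat n n"
  shows "char_poly A dvd root_poly (spectrum A) ^ n"
proof -
  obtain as where as: "char_poly A = (\<Prod>a\<leftarrow>as. [:- a, 1:])" "length as = n"
    using char_poly_factorized[OF A] by auto
  have fin: "finite (spectrum A)" using card_finite_spectrum[OF A] by simp
  have "set as \<subseteq> spectrum A"
    using linear_poly_root by (force simp: spectrum_root_char_poly[OF A] as)
  then have "(\<Prod>a\<leftarrow>as. [:- a, 1:]) dvd root_poly (spectrum A) ^ length as"
  proof (induction as)
    case (Cons a as)
    have "root_poly {a} dvd root_poly (spectrum A)"
      using Cons.prems root_poly_dvd_iff[OF fin, of "root_poly (spectrum A)"]
      by (subst root_poly_dvd_iff) auto
    then have "[:- a, 1:] dvd root_poly (spectrum A)" by (simp add: root_poly_def)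
    then show ?case using Cons by (simp add: mult_dvd_mono del: mult_pCons_left)
  qed simp
  then show ?thesis using as by simp
qed

lemma mat_poly_eq_0_of_dvd:
  fixes A :: "complex mat"
  assumes A: "A \<in> carrier_mat n n" and "root_poly (spectrum A) ^ n dvd f"
  shows "mat_poly f A = 0\<^sub>m n n"
proof -
  have "char_poly A dvd f" using char_poly_dvd_root_poly_power[OF A] assms(2) by (rule dvd_trans)
  then obtain g where "f = char_poly A * g" by (auto elim: dvdE)
  then show ?thesis
    using cayley_hamilton_complex[OF A] A left_mult_zero_mat[of "mat_poly g A" n n n]
    by (simp add: mat_poly_mult)
qed

text \<open>The difference \<open>q\<^sup>p - r\<^sup>p\<close> is \<open>(q - r) S\<close>, and
  \<open>S\<close> takes the value \<open>p r(\<lambda>)\<^bsup>p-1\<^esup> \<noteq> 0\<close> at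
  every eigenvalue. So \<open>S\<close> is invertible modulo every power of the radical polynomial,
  and \<open>q - r\<close> vanishes at \<open>A\<close> along with \<open>q\<^sup>p -
  r\<^sup>p\<close>.\<close>

lemma mat_poly_root_unique:
  fixes A :: "complex mat"
  assumes A: "A \<in> carrier_mat n n" and p: "p > 0"
    and eq: "\<And>l. l \<in> spectrum A \<Longrightarrow> poly q l = poly r l"
    and nz: "\<And>l. l \<in> spectrum A \<Longrightarrow> poly r l \<noteq> 0"
    and pow: "mat_poly q A ^\<^sub>m p = mat_poly r A ^\<^sub>m p"
  shows "mat_poly q A = mat_poly r A"
proof -
  have fin: "finite (spectrum A)" using card_finite_spectrum[OF A] by simp
  define S where "S = (\<Sum>i<p. r ^ (p - Suc i) * q ^ i)"
  have diff: "q ^ p - r ^ p = (q - r) * S" unfolding S_def by (rule power_diff_sumr2)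
  have S: "poly S l \<noteq> 0" if "l \<in> spectrum A" for l
  proof -
    have "poly S l = of_nat p * poly r l ^ (p - 1)"
      using eq[OF that] by (simp add: S_def poly_sum flip: power_add)
    then show ?thesis using nz[OF that] p by simp
  qed
  obtain u where u: "\<forall>l\<in>spectrum A. poly u l = 1 / poly S l"
    using interpolation_exists[OF fin, of "\<lambda>l. 1 / poly S l"] by blast
  have "root_poly (spectrum A) dvd 1 - u * S" using S u by (subst root_poly_dvd_iff[OF fin]) auto
  then have "root_poly (spectrum A) ^ n dvd (1 - u * S) ^ n" by (rule dvd_power_same)
  \<comment> \<open>\<open>1 - u S\<close> is nilpotent modulo the power of the radical, so \<open>S\<close> has the inverse \<open>w\<close> there.\<close>
  moreover have "\<exists>w. (1 - u * S) ^ n = 1 - w * S"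
  proof (induction n)
    case (Suc n)
    then obtain w where "(1 - u * S) ^ n = 1 - w * S" by auto
    then have "(1 - u * S) ^ Suc n = (1 - u * S) * (1 - w * S)" by simp
    also have "\<dots> = 1 - (u + w - u * w * S) * S" by (simp add: algebra_simps)
    finally have "(1 - u * S) ^ Suc n = 1 - (u + w - u * w * S) * S" .
    then show ?case by blast
  qed (auto intro: exI[of _ 0])
  ultimately obtain w where "root_poly (spectrum A) ^ n dvd 1 - w * S" by metis
  then have 0: "mat_poly ((q - r) * (1 - w * S)) A = 0\<^sub>m n n"
    by (intro mat_poly_eq_0_of_dvd[OF A] dvd_mult)
  have pm: "mat_poly (f - g) A = mat_poly f A + (-1) \<cdot>\<^sub>m mat_poly g A" for f g
    using mat_poly_add[OF A, of f "Polynomial.smult (-1) g"] mat_poly_smult[OF A, of "-1" g] by simp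
  have z: "X + (-1) \<cdot>\<^sub>m X = 0\<^sub>m n n" if "X \<in> carrier_mat n n" for X :: "complex mat"
    using that by (intro eq_matI) auto
  have "mat_poly ((q - r) * S) A = 0\<^sub>m n n"
    unfolding diff[symmetric] pm mat_poly_power[OF A] pow using A by (intro z pow_carrier_mat mat_poly_carrier)
  then have "mat_poly (w * ((q - r) * S)) A = 0\<^sub>m n n" using A by (simp add: mat_poly_mult)
  then have "mat_poly ((q - r) * (1 - w * S) + w * ((q - r) * S)) A = 0\<^sub>m n n"
    using 0 mat_poly_add[OF A] by simp
  then have "mat_poly (q - r) A = 0\<^sub>m n n" by (simp add: algebra_simps)
  then have "mat_poly ((q - r) + r) A = mat_poly r A"
    unfolding mat_poly_add[OF A] using A by simp
  then show ?thesis by simp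
qed

lemma binomial_first_order:
  fixes x y :: "'a::comm_ring_1"
  shows "\<exists>w. (x + y) ^ p = x ^ p + of_nat p * x ^ (p - 1) * y + y ^ 2 * w"
proof (induction p)
  case (Suc p)
  then obtain w where w: "(x + y) ^ p = x ^ p + of_nat p * x ^ (p - 1) * y + y ^ 2 * w" by auto
  have x: "of_nat p * (x * x ^ (p - 1)) = of_nat p * x ^ p"
    by (cases p) auto
  have "(x + y) ^ Suc p = (x + y) * (x ^ p + of_nat p * x ^ (p - 1) * y + y ^ 2 * w)"
    by (simp add: w)
  also have "\<dots> = x ^ Suc p + (of_nat p * (x * x ^ (p - 1)) + x ^ p) * y
      + y ^ 2 * (of_nat p * x ^ (p - 1) + (x + y) * w)"
    by (simp add: algebra_simps power2_eq_square)
  also have "\<dots> = x ^ Suc p + of_nat (Suc p) * x ^ (Suc p - 1) * y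
      + y ^ 2 * (of_nat p * x ^ (p - 1) + (x + y) * w)"
    unfolding x by (simp add: algebra_simps)
  finally show ?case by blast
qed (auto intro: exI[of _ 0])

text \<open>Newton iteration for the equation \<open>q\<^sup>p = t\<close> in the polynomial ring. An
  interpolation polynomial solves it modulo the radical, and since the derivative \<open>p
  q\<^bsup>p-1\<^esup>\<close> has no zero on \<open>S\<close>, each solution lifts to the next
  power.\<close>

lemma hensel_root_poly:
  fixes g :: "'a::field_char_0 \<Rightarrow> 'a"
  assumes fin: "finite S" and p: "p > 0"
    and g: "\<And>l. l \<in> S \<Longrightarrow> g l ^ p = l" and nz: "0 \<notin> S"
  shows "\<exists>q. (\<forall>l\<in>S. poly q l = g l) \<and> root_poly S ^ Suc k dvd q ^ p - [:0, 1:]"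
proof (induction k)
  case 0
  obtain q where q: "\<forall>l\<in>S. poly q l = g l" using interpolation_exists[OF fin] by blast
  then have "root_poly S dvd q ^ p - [:0, 1:]" by (subst root_poly_dvd_iff[OF fin]) (auto simp: g)
  with q show ?case by auto
next
  case (Suc k)
  then obtain q where q: "\<forall>l\<in>S. poly q l = g l" and dv: "root_poly S ^ Suc k dvd q ^ p - [:0, 1:]"
    by auto
  define e where "e = q ^ p - [:0, 1:]"
  have gnz: "g l \<noteq> 0" if "l \<in> S" for l using g[OF that] that nz p by (auto simp: zero_power)
  obtain u where u: "\<forall>l\<in>S. poly u l = 1 / (of_nat p * g l ^ (p - 1))"
    using interpolation_exists[OF fin, of "\<lambda>l. 1 / (of_nat p * g l ^ (p - 1))"] by blast
  obtain w where w: "(q + - (e * u)) ^ p = q ^ p + of_nat p * q ^ (p - 1) * - (e * u) + (- (e * u))\<^sup>2 * w"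
    using binomial_first_order by blast
  have M1: "root_poly S dvd 1 - of_nat p * q ^ (p - 1) * u"
    using p gnz by (subst root_poly_dvd_iff[OF fin]) (auto simp: q u)
  have M2: "root_poly S dvd e * (u\<^sup>2 * w)"
    using q by (subst root_poly_dvd_iff[OF fin]) (auto simp: e_def g)
  have "(q - e * u) ^ p - [:0, 1:] = e * ((1 - of_nat p * q ^ (p - 1) * u) + e * (u\<^sup>2 * w))"
  proof -
    have "(q - e * u) ^ p - [:0, 1:]
        = e + of_nat p * q ^ (p - 1) * - (e * u) + (- (e * u))\<^sup>2 * w"
      using w by (simp add: e_def)
    then show ?thesis by (simp add: algebra_simps power2_eq_square)
  qed
  moreover have "root_poly S ^ Suc k * root_poly S
      dvd e * ((1 - of_nat p * q ^ (p - 1) * u) + e * (u\<^sup>2 * w))"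
    using dv M1 M2 unfolding e_def[symmetric] by (intro mult_dvd_mono dvd_add)
  ultimately have "root_poly S ^ Suc (Suc k) dvd (q - e * u) ^ p - [:0, 1:]"
    by (simp add: mult.commute)
  moreover have "\<forall>l\<in>S. poly (q - e * u) l = g l" using q by (auto simp: e_def g)
  ultimately show ?case by blast
qed

text \<open>Every choice of \<open>p\<close>-th roots on the spectrum comes from a primary root, because the
  \<open>n\<close>-th power of the radical vanishes at \<open>A\<close>.\<close>

lemma primary_root_exists:
  fixes A :: "complex mat"
  assumes A: "A \<in> carrier_mat n n" and p: "p > 0" and nz: "0 \<notin> spectrum A"
    and g: "\<And>l. l \<in> spectrum A \<Longrightarrow> g l ^ p = l"
  shows "\<exists>q. (\<forall>l\<in>spectrum A. poly q l = g l) \<and> mat_poly q A ^\<^sub>m p = A"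
proof -
  have fin: "finite (spectrum A)" using card_finite_spectrum[OF A] by simp
  obtain q where q: "\<forall>l\<in>spectrum A. poly q l = g l"
    "root_poly (spectrum A) ^ Suc n dvd q ^ p - [:0, 1:]"
    using hensel_root_poly[OF fin p g nz] by blast
  then have "root_poly (spectrum A) ^ n dvd q ^ p - [:0, 1:]"
    by (meson dvd_trans le_imp_power_dvd le_SucI order_refl)
  then have "mat_poly ((q ^ p - [:0, 1:]) + [:0, 1:]) A = 0\<^sub>m n n + mat_poly [:0, 1:] A"
    using mat_poly_eq_0_of_dvd[OF A] mat_poly_add[OF A] by metis
  then have "mat_poly q A ^\<^sub>m p = 0\<^sub>m n n + (0 \<cdot>\<^sub>m 1\<^sub>m n + 1 \<cdot>\<^sub>m A)"
    using mat_poly_linear[OF A, of 0 1] by (simp add: mat_poly_power[OF A])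
  also have "\<dots> = A" using A by (intro eq_matI) auto
  finally show ?thesis using q by blast
qed

section \<open>The Perron vector of an irreducible matrix\<close>

text \<open>The product of a matrix and a vector, with the vector a function on indices. Moduli and phases of
  an eigenvector can then be taken pointwise, without a carrier condition.\<close>

definition mat_app :: "'a::semiring_0 mat \<Rightarrow> (nat \<Rightarrow> 'a) \<Rightarrow> nat \<Rightarrow> 'a" where
  "mat_app A x i = (\<Sum>j<dim_col A. A $$ (i, j) * x j)"

lemma mat_app_cong:
  assumes "\<And>j. j < dim_col A \<Longrightarrow> x j = y j"
  shows "mat_app A x i = mat_app A y i"
  using assms by (simp add: mat_app_def)

lemma mat_app_mult:
  assumes "A \<in> carrier_mat n n" "B \<in> carrier_mat n n" "i < n"
  shows "mat_app (A * B) x i = mat_app A (mat_app B x) i"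
proof -
  have "(A * B) $$ (i, j) = (\<Sum>k<n. A $$ (i, k) * B $$ (k, j))" if "j < n" for j
    using assms that by (auto simp: scalar_prod_def atLeast0LessThan intro!: sum.cong)
  then have "mat_app (A * B) x i = (\<Sum>j<n. \<Sum>k<n. A $$ (i, k) * (B $$ (k, j) * x j))"
    using assms by (simp add: mat_app_def sum_distrib_right mult.assoc)
  also have "\<dots> = mat_app A (mat_app B x) i"
    using assms by (subst sum.swap) (simp add: mat_app_def sum_distrib_left)
  finally show ?thesis .
qed

lemma mat_app_one: "i < n \<Longrightarrow> mat_app (1\<^sub>m n) x i = (x i :: 'a::semiring_1)"
proof -
  assume i: "i < n"
  have "mat_app (1\<^sub>m n) x i = (\<Sum>j<n. if i = j then x j else 0)"
    unfolding mat_app_def using i by (intro sum.cong) auto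
  then show ?thesis using i by simp
qed

lemma mat_app_pow_eigen:
  fixes A :: "'a::comm_semiring_1 mat"
  assumes A: "A \<in> carrier_mat n n" and x: "\<And>i. i < n \<Longrightarrow> mat_app A x i = l * x i" and "i < n"
  shows "mat_app (A ^\<^sub>m k) x i = l ^ k * x i"
  using \<open>i < n\<close>
proof (induction k arbitrary: i)
  case 0
  then show ?case using A by (simp add: mat_app_one)
next
  case (Suc k)
  have "mat_app (A ^\<^sub>m Suc k) x i = mat_app (A ^\<^sub>m k) (mat_app A x) i"
    using A Suc.prems by (simp add: mat_app_mult[of _ n])
  also have "\<dots> = mat_app (A ^\<^sub>m k) (\<lambda>j. l * x j) i"
    using A x by (intro mat_app_cong) (auto split: if_splits)
  also have "\<dots> = l * mat_app (A ^\<^sub>m k) x i"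
    by (simp add: mat_app_def sum_distrib_left mult_ac)
  finally show ?case using Suc by (simp add: mult_ac)
qed

lemma eigenvalue_iff_mat_app:
  assumes B: "B \<in> carrier_mat n n"
  shows "eigenvalue B l \<longleftrightarrow> (\<exists>v. (\<exists>i<n. v i \<noteq> 0) \<and> (\<forall>i<n. mat_app B v i = l * v i))"
proof
  assume "eigenvalue B l"
  then obtain v where v: "v \<in> carrier_vec n" "v \<noteq> 0\<^sub>v n" "B *\<^sub>v v = l \<cdot>\<^sub>v v"
    using B by (auto simp: eigenvalue_def eigenvector_def)
  have "\<exists>i<n. v $ i \<noteq> 0" using v(1,2) by (auto simp: vec_eq_iff)
  moreover have "mat_app B (\<lambda>i. v $ i) i = l * v $ i" if "i < n" for i
    using arg_cong[OF v(3), of "\<lambda>w. w $ i"] that B v(1)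
    by (simp add: mat_app_def scalar_prod_def atLeast0LessThan)
  ultimately show "\<exists>v. (\<exists>i<n. v i \<noteq> 0) \<and> (\<forall>i<n. mat_app B v i = l * v i)"
    by (intro exI[of _ "\<lambda>i. v $ i"]) auto
next
  assume "\<exists>v. (\<exists>i<n. v i \<noteq> 0) \<and> (\<forall>i<n. mat_app B v i = l * v i)"
  then obtain v where v: "\<exists>i<n. v i \<noteq> 0" "\<forall>i<n. mat_app B v i = l * v i" by blast
  have "B *\<^sub>v vec n v = l \<cdot>\<^sub>v vec n v"
    using B v(2) by (intro eq_vecI) (auto simp: mat_app_def scalar_prod_def atLeast0LessThan)
  moreover have "vec n v \<noteq> 0\<^sub>v n" using v(1) by (auto simp: vec_eq_iff)
  ultimately show "eigenvalue B l"
    using B by (auto simp: eigenvalue_def eigenvector_def intro!: exI[of _ "vec n v"])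
qed

lemma smult_pow_mat:
  fixes A :: "'a::comm_semiring_1 mat"
  assumes A: "A \<in> carrier_mat n n"
  shows "(c \<cdot>\<^sub>m A) ^\<^sub>m k = c ^ k \<cdot>\<^sub>m (A ^\<^sub>m k)"
proof (induction k)
  case 0
  then show ?case using A by (intro eq_matI) auto
next
  case (Suc k)
  have "(c \<cdot>\<^sub>m A) ^\<^sub>m Suc k = (c ^ k \<cdot>\<^sub>m (A ^\<^sub>m k)) * (c \<cdot>\<^sub>m A)" using Suc by simp
  also have "\<dots> = c \<cdot>\<^sub>m (c ^ k \<cdot>\<^sub>m (A ^\<^sub>m k) * A)"
    by (rule mult_smult_distrib) (use A in auto)
  also have "c ^ k \<cdot>\<^sub>m (A ^\<^sub>m k) * A = c ^ k \<cdot>\<^sub>m (A ^\<^sub>m k * A)"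
    by (rule mult_smult_assoc_mat) (use A in auto)
  finally show ?case using A by (auto intro!: eq_matI simp: mult_ac)
qed

text \<open>Scaling by \<open>1 / r\<close> brings the spectral radius below 1, where powers of a matrix stay
  bounded.\<close>

lemma powers_bounded_above_spectral_radius:
  fixes B :: "complex mat"
  assumes B: "B \<in> carrier_mat n n" and r: "0 < r"
    and ev: "\<And>l. eigenvalue B l \<Longrightarrow> norm l < r"
  shows "\<exists>c. \<forall>k i j. i < n \<longrightarrow> j < n \<longrightarrow> norm ((B ^\<^sub>m k) $$ (i, j)) \<le> c * r ^ k"
proof (cases "n = 0")
  case False
  define C where "C = complex_of_real (1 / r) \<cdot>\<^sub>m B"
  have C: "C \<in> carrier_mat n n" using B by (simp add: C_def)
  have "norm m < 1" if m: "eigenvalue C m" for m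
  proof -
    obtain v where v: "\<exists>i<n. v i \<noteq> 0" "\<forall>i<n. mat_app C v i = m * v i"
      using m eigenvalue_iff_mat_app[OF C] by auto
    have "mat_app B v i = (of_real r * m) * v i" if "i < n" for i
    proof -
      have "mat_app B v i = of_real r * mat_app C v i"
        using B that r by (simp add: mat_app_def C_def sum_distrib_left)
      then show ?thesis using v(2) that by simp
    qed
    then have "eigenvalue B (of_real r * m)" using v(1) eigenvalue_iff_mat_app[OF B] by blast
    then have "r * norm m < r" using ev[of "of_real r * m"] r by (simp add: norm_mult)
    then show ?thesis using r by simp
  qed
  then have "spectral_radius C < 1"
    using spectral_radius_mem_max(1)[OF C] False by (auto simp: spectrum_def)
  then obtain c where c: "\<forall>k. norm_bound (C ^\<^sub>m k) c"
    using spectral_radius_jnf_norm_bound_less_1[OF C]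
    using jordan_nf_exists[OF C] char_poly_factorized[OF C] by blast
  have "norm ((B ^\<^sub>m k) $$ (i, j)) \<le> c * r ^ k" if "i < n" "j < n" for k i j
  proof -
    have "norm ((C ^\<^sub>m k) $$ (i, j)) \<le> c"
      using c that C by (auto simp: norm_bound_def)
    moreover have "(C ^\<^sub>m k) $$ (i, j) = (of_real (1 / r)) ^ k * (B ^\<^sub>m k) $$ (i, j)"
      using that B by (simp add: C_def smult_pow_mat[OF B])
    ultimately show ?thesis using r
      by (simp add: norm_mult norm_power norm_divide field_simps)
  qed
  then show ?thesis by blast
qed auto

lemma cmat_pow: "A \<in> carrier_mat n n \<Longrightarrow> cmat (A ^\<^sub>m k) = cmat A ^\<^sub>m k"
  by (rule of_real_hom.mat_hom_pow)

lemma mat_app_cmat_of_real: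
  "i < dim_row A \<Longrightarrow> mat_app (cmat A) (\<lambda>j. complex_of_real (x j)) i = complex_of_real (mat_app A x i)"
  by (simp add: mat_app_def)

lemma mat_app_mono:
  assumes "entrywise_nonneg A" "i < dim_row A" "\<And>j. j < dim_col A \<Longrightarrow> x j \<le> y j"
  shows "mat_app A x i \<le> mat_app A y i"
  using assms by (auto simp: mat_app_def entrywise_nonneg_def intro!: sum_mono mult_left_mono)

text \<open>For a nonnegative irreducible \<open>A\<close> some power of \<open>1 + A\<close> is positive. In
  this form irreducibility passes to the transpose and turns nonzero nonnegative vectors into
  positive ones.\<close>

definition connecting :: "real mat \<Rightarrow> nat \<Rightarrow> bool" where
  "connecting A N \<longleftrightarrow> (\<forall>i<dim_row A. \<forall>j<dim_row A. 0 < ((1\<^sub>m (dim_row A) + A) ^\<^sub>m N) $$ (i, j))"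

lemma connecting_mat_app_pos:
  assumes A: "A \<in> carrier_mat n n" and N: "connecting A N"
    and z: "\<And>j. j < n \<Longrightarrow> 0 \<le> z j" "\<exists>j<n. z j \<noteq> 0" and i: "i < n"
  shows "0 < mat_app ((1\<^sub>m n + A) ^\<^sub>m N) z i"
proof -
  let ?B = "(1\<^sub>m n + A) ^\<^sub>m N"
  have B: "?B \<in> carrier_mat n n" using A by auto
  obtain j where j: "j < n" "z j \<noteq> 0" using z by blast
  have pos: "0 < ?B $$ (i, k)" if "k < n" for k using N i that A by (auto simp: connecting_def)
  have "0 < ?B $$ (i, j) * z j" using pos[OF j(1)] z(1)[OF j(1)] j(2) by simp
  also have "\<dots> \<le> (\<Sum>k<n. ?B $$ (i, k) * z k)"
    using j(1) pos z(1) by (intro member_le_sum mult_nonneg_nonneg) (auto intro: less_imp_le)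
  finally show ?thesis unfolding mat_app_def carrier_matD(2)[OF B] .
qed

lemma mat_app_one_plus:
  fixes A :: "'a::comm_semiring_1 mat"
  assumes A: "A \<in> carrier_mat n n" and "i < n"
  shows "mat_app (1\<^sub>m n + A) x i = x i + mat_app A x i"
proof -
  have "mat_app (1\<^sub>m n + A) x i = mat_app (1\<^sub>m n) x i + mat_app A x i"
    using A assms(2) by (simp add: mat_app_def ring_distribs sum.distrib)
  then show ?thesis using assms by (simp add: mat_app_one)
qed

lemma commute_one_plus_pow:
  fixes A :: "'a::comm_ring_1 mat"
  assumes A: "A \<in> carrier_mat n n"
  shows "A * (1\<^sub>m n + A) ^\<^sub>m N = (1\<^sub>m n + A) ^\<^sub>m N * A"
proof (induction N)
  case 0
  then show ?case using A by simp
next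
  case (Suc N)
  let ?T = "1\<^sub>m n + A" and ?B = "(1\<^sub>m n + A) ^\<^sub>m N"
  have T: "?T \<in> carrier_mat n n" "?B \<in> carrier_mat n n" using A by auto
  have AT: "A * ?T = ?T * A"
    using A by (simp add: mult_add_distrib_mat[OF A one_carrier_mat A] add_mult_distrib_mat[OF one_carrier_mat A A])
  have "A * (?B * ?T) = (?B * A) * ?T" using A T Suc by (simp add: assoc_mult_mat[symmetric, of A n n ?B n ?T n])
  also have "\<dots> = ?B * (?T * A)" using A T AT by (simp add: assoc_mult_mat[of ?B n n A n ?T n])
  also have "\<dots> = (?B * ?T) * A" using A T by (simp add: assoc_mult_mat[of ?B n n ?T n A n])
  finally show ?case by simp
qed

lemma eigenvalue_le_spectral_radius:
  assumes "A \<in> carrier_mat n n" "n > 0" "eigenvalue A l"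
  shows "norm l \<le> spectral_radius A"
  using spectral_radius_mem_max(2)[OF assms(1,2)] assms(3) by (auto simp: spectrum_def)

text \<open>If \<open>r x \<le> A x\<close> were not an equality, then applying the positive matrix \<open>(1
  + A)\<^sup>N\<close> would give \<open>y > 0\<close> with \<open>A y \<ge> (r + 2d) y\<close> for
  some \<open>d > 0\<close>. The powers of \<open>A\<close> would grow at the rate \<open>r +
  2d\<close>, which the spectral radius forbids.\<close>

lemma spectral_radius_subinvariant_eq:
  fixes A :: "real mat"
  assumes A: "A \<in> carrier_mat n n" and nn: "entrywise_nonneg A" and N: "connecting A N"
    and r: "r = spectral_radius (cmat A)"
    and x: "\<And>j. j < n \<Longrightarrow> 0 \<le> x j" "\<exists>j<n. x j \<noteq> 0"
    and sub: "\<And>i. i < n \<Longrightarrow> r * x i \<le> mat_app A x i" and i: "i < n"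
  shows "mat_app A x i = r * x i"
proof (rule ccontr)
  assume neq: "mat_app A x i \<noteq> r * x i"
  have cA: "cmat A \<in> carrier_mat n n" using A by auto
  have n: "n > 0" using i by simp
  have r0: "r \<ge> 0" using spectral_radius_mem_max(1)[OF cA n] r by auto
  let ?B = "(1\<^sub>m n + A) ^\<^sub>m N"
  have B: "?B \<in> carrier_mat n n" using A by auto
  define z where "z = (\<lambda>j. mat_app A x j - r * x j)"
  define y where "y = mat_app ?B x"
  have y: "0 < y j" if "j < n" for j
    unfolding y_def using connecting_mat_app_pos[OF A N x that] by blast
  have Bz: "0 < mat_app ?B z j" if "j < n" for j
    by (rule connecting_mat_app_pos[OF A N _ _ that]) (use sub neq i in \<open>auto simp: z_def\<close>)
  have Ay: "mat_app A y j = r * y j + mat_app ?B z j" if "j < n" for j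
  proof -
    have "mat_app A y j = mat_app (A * ?B) x j" using A B that by (simp add: y_def mat_app_mult)
    also have "\<dots> = mat_app ?B (mat_app A x) j"
      unfolding commute_one_plus_pow[OF A] by (rule mat_app_mult[OF B A that])
    also have "\<dots> = r * y j + mat_app ?B z j"
      by (simp add: mat_app_def y_def z_def algebra_simps sum.distrib sum_distrib_left sum_subtractf)
    finally show ?thesis .
  qed
  \<comment> \<open>Half the smallest ratio, so that the growth rate \<open>r + 2 * d\<close> beats the bound \<open>r + d\<close> on the powers.\<close>
  define d where "d = Min ((\<lambda>j. mat_app ?B z j / y j) ` {..<n}) / 2"
  have d: "0 < d" using n y Bz by (auto simp: d_def Min_gr_iff lessThan_empty_iff)
  have d2: "2 * d * y j \<le> mat_app ?B z j" if "j < n" for j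
  proof -
    have "2 * d \<le> mat_app ?B z j / y j" using that by (simp add: d_def)
    then show ?thesis using y[OF that] by (simp add: field_simps)
  qed
  have grow: "(r + 2 * d) ^ k * y j \<le> mat_app (A ^\<^sub>m k) y j" if "j < n" for k j
    using that
  proof (induction k arbitrary: j)
    case 0
    then show ?case using A by (simp add: mat_app_one)
  next
    case (Suc k)
    have "(r + 2 * d) ^ Suc k * y j \<le> (r + 2 * d) ^ k * mat_app A y j"
      using mult_left_mono[of "(r + 2 * d) * y j" "mat_app A y j" "(r + 2 * d) ^ k"]
        Ay[OF Suc.prems] d2[OF Suc.prems] r0 d by (simp add: algebra_simps)
    also have "\<dots> = mat_app A (\<lambda>i. (r + 2 * d) ^ k * y i) j"
      by (simp add: mat_app_def sum_distrib_left mult_ac)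
    also have "\<dots> \<le> mat_app A (mat_app (A ^\<^sub>m k) y) j"
      using A Suc by (intro mat_app_mono[OF nn]) auto
    also have "\<dots> = mat_app (A * A ^\<^sub>m k) y j" using A Suc.prems by (simp add: mat_app_mult[of _ n])
    also have "A * A ^\<^sub>m k = A ^\<^sub>m Suc k" by (rule pow_mat_Suc_left[OF A, symmetric])
    finally show ?case .
  qed
  have "norm l < r + d" if "eigenvalue (cmat A) l" for l
    using eigenvalue_le_spectral_radius[OF cA n that] r d by simp
  then obtain c where c: "\<And>k i j. i < n \<Longrightarrow> j < n \<Longrightarrow> norm ((cmat A ^\<^sub>m k) $$ (i, j)) \<le> c * (r + d) ^ k"
    using powers_bounded_above_spectral_radius[OF cA, of "r + d"] r0 d by fastforce
  have bnd: "\<bar>(A ^\<^sub>m k) $$ (i, j)\<bar> \<le> c * (r + d) ^ k" if "j < n" for k j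
    using c[OF i that, of k] A i that unfolding cmat_pow[OF A, symmetric] by simp
  have up: "mat_app (A ^\<^sub>m k) y i \<le> (c * (\<Sum>j<n. y j)) * (r + d) ^ k" for k
  proof -
    have "mat_app (A ^\<^sub>m k) y i = (\<Sum>j<n. (A ^\<^sub>m k) $$ (i, j) * y j)"
      unfolding mat_app_def carrier_matD(2)[OF pow_carrier_mat[OF A]] ..
    also have "\<dots> \<le> (\<Sum>j<n. (c * (r + d) ^ k) * y j)"
      using bnd[of _ k] y by (intro sum_mono mult_right_mono) (auto simp: abs_le_iff less_imp_le)
    finally have "mat_app (A ^\<^sub>m k) y i \<le> (\<Sum>j<n. (c * (r + d) ^ k) * y j)" .
    then show ?thesis by (simp add: sum_distrib_left mult_ac)
  qed
  have pos: "0 < r + d" using r0 d by simp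
  have "((r + 2 * d) / (r + d)) ^ k \<le> c * (\<Sum>j<n. y j) / y i" for k
    using order_trans[OF grow[OF i, of k] up[of k]] y[OF i] pos by (simp add: power_divide field_simps)
  moreover have "1 < (r + 2 * d) / (r + d)" using pos d by simp
  then obtain k where "c * (\<Sum>j<n. y j) / y i < ((r + 2 * d) / (r + d)) ^ k"
    using real_arch_pow by blast
  ultimately show False by (meson not_le)
qed

text \<open>The moduli of an eigenvector satisfy \<open>r |v| \<le> A |v|\<close> by the triangle inequality.
  Existence of the Perron vector and simplicity of the Perron eigenvalue both follow from this one
  fact.\<close>

lemma peripheral_modulus_eigen:
  fixes A :: "real mat"
  assumes A: "A \<in> carrier_mat n n" and nn: "entrywise_nonneg A" and N: "connecting A N"
    and r: "r = spectral_radius (cmat A)"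
    and v: "\<exists>j<n. v j \<noteq> 0" "\<And>i. i < n \<Longrightarrow> mat_app (cmat A) v i = l * v i" and l: "norm l = r"
    and i: "i < n"
  shows "mat_app A (\<lambda>j. norm (v j)) i = r * norm (v i)" "0 < norm (v i)"
proof -
  have r0: "r \<ge> 0" using l by (metis norm_ge_zero)
  have eq: "mat_app A (\<lambda>j. norm (v j)) i = r * norm (v i)" if "i < n" for i
  proof (rule spectral_radius_subinvariant_eq[OF A nn N r _ _ _ that])
    fix i assume i: "i < n"
    have "r * norm (v i) = norm (mat_app (cmat A) v i)" using v(2)[OF i] l by (simp add: norm_mult)
    also have "\<dots> \<le> (\<Sum>j<n. norm (complex_of_real (A $$ (i, j)) * v j))"
      using A i by (simp add: mat_app_def norm_sum)
    also have "\<dots> = mat_app A (\<lambda>j. norm (v j)) i"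
      using A nn i by (simp add: mat_app_def norm_mult entrywise_nonneg_def)
    finally show "r * norm (v i) \<le> mat_app A (\<lambda>j. norm (v j)) i" .
  qed (use v in auto)
  then show "mat_app A (\<lambda>j. norm (v j)) i = r * norm (v i)" using i by simp
  have "mat_app (1\<^sub>m n + A) (\<lambda>j. norm (v j)) i = (1 + r) * norm (v i)" if "i < n" for i
    using eq[OF that] that by (simp add: mat_app_one_plus[OF A] algebra_simps)
  then have "mat_app ((1\<^sub>m n + A) ^\<^sub>m N) (\<lambda>j. norm (v j)) i = (1 + r) ^ N * norm (v i)"
    using A i by (intro mat_app_pow_eigen) auto
  moreover have "0 < mat_app ((1\<^sub>m n + A) ^\<^sub>m N) (\<lambda>j. norm (v j)) i"
    using v(1) by (intro connecting_mat_app_pos[OF A N _ _ i]) auto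
  ultimately show "0 < norm (v i)" using r0 by (simp add: zero_less_mult_iff)
qed

lemma perron_eigenvector_exists:
  fixes A :: "real mat"
  assumes A: "A \<in> carrier_mat n n" and n: "n > 0" and nn: "entrywise_nonneg A" and N: "connecting A N"
    and r: "r = spectral_radius (cmat A)"
  shows "\<exists>x. \<forall>i<n. 0 < x i \<and> mat_app A x i = r * x i"
proof -
  have cA: "cmat A \<in> carrier_mat n n" using A by auto
  obtain l where l: "norm l = r" "eigenvalue (cmat A) l"
    using spectral_radius_mem_max(1)[OF cA n] r by (auto simp: spectrum_def)
  obtain v where v: "\<exists>i<n. v i \<noteq> 0" "\<And>i. i < n \<Longrightarrow> mat_app (cmat A) v i = l * v i"
    using l(2) unfolding eigenvalue_iff_mat_app[OF cA] by auto
  show ?thesis using peripheral_modulus_eigen[OF A nn N r v l(1)] by (intro exI[of _ "\<lambda>j. norm (v j)"]) auto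
qed

lemma mat_digraph_arcs: "arcs (mat_digraph A) = {(i, j). i < dim_row A \<and> j < dim_col A \<and> A $$ (i, j) \<noteq> 0}"
  by (simp add: mat_digraph_def)

lemma irreducible_reachable:
  assumes irr: "irreducible_mat A"
  shows "dim_row A > 0"
    and "i < dim_row A \<Longrightarrow> j < dim_row A \<Longrightarrow> (i, j) \<in> (arcs (mat_digraph A))\<^sup>*"
proof -
  have verts: "verts (mat_digraph A) = {0..<dim_row A}" by (simp add: mat_digraph_def)
  show "dim_row A > 0" using irr verts by (auto simp: irreducible_mat_def strongly_connected_def)
  have ends: "arcs_ends (mat_digraph A) = arcs (mat_digraph A)"
    by (auto simp: arcs_ends_def arc_to_ends_def mat_digraph_def)
  assume "i < dim_row A" "j < dim_row A"
  then have "(i, j) \<in> rtrancl_on (verts (mat_digraph A)) (arcs_ends (mat_digraph A))"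
    using irr verts by (auto simp: irreducible_mat_def strongly_connected_def reachable_def)
  then have "(i, j) \<in> (arcs_ends (mat_digraph A))\<^sup>*"
    by (induction rule: rtrancl_on.induct) auto
  then show "(i, j) \<in> (arcs (mat_digraph A))\<^sup>*" by (simp add: ends)
qed

text \<open>Entries of \<open>(1 + A)\<^sup>k\<close> grow with \<open>k\<close>, and a walk from
  \<open>i\<close> to \<open>j\<close> makes the entry \<open>(i, j)\<close> positive from its
  length on. One exponent then serves all pairs.\<close>

lemma irreducible_connecting:
  fixes A :: "real mat"
  assumes A: "A \<in> carrier_mat n n" and nn: "entrywise_nonneg A" and irr: "irreducible_mat A"
  shows "\<exists>N. connecting A N"
proof -
  let ?M = "\<lambda>k. (1\<^sub>m n + A) ^\<^sub>m k"
  have M: "?M k \<in> carrier_mat n n" for k using A by auto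
  have step: "?M (Suc k) $$ (i, j) = ?M k $$ (i, j) + (\<Sum>l<n. ?M k $$ (i, l) * A $$ (l, j))"
    if "i < n" "j < n" for i j k
  proof -
    have "?M k * (1\<^sub>m n + A) = ?M k + ?M k * A" 
      by (simp add: mult_add_distrib_mat[OF M one_carrier_mat A] right_mult_one_mat[OF M])
    then show ?thesis using M[of k] A that
      by (auto simp: scalar_prod_def atLeast0LessThan intro!: sum.cong)
  qed
  have nonneg: "0 \<le> ?M k $$ (i, j)" if "i < n" "j < n" for i j k
    using that
  proof (induction k arbitrary: i j)
    case (Suc k)
    then show ?case using step[of i j k] nn A
      by (auto simp: entrywise_nonneg_def intro!: add_nonneg_nonneg sum_nonneg mult_nonneg_nonneg simp del: pow_mat.simps)
  qed (use A in auto)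
  have mono1: "?M k $$ (i, j) \<le> ?M (Suc k) $$ (i, j)" if "i < n" "j < n" for i j k
    using step[OF that, of k] nonneg[of i _ k] that nn A
    by (auto simp: entrywise_nonneg_def intro!: sum_nonneg mult_nonneg_nonneg simp del: pow_mat.simps)
  have mono: "?M k $$ (i, j) \<le> ?M m $$ (i, j)" if "i < n" "j < n" "k \<le> m" for i j k m
    using lift_Suc_mono_le[of "\<lambda>k. ?M k $$ (i, j)", OF mono1[OF that(1,2)] that(3)] .
  have ex: "\<exists>k. 0 < ?M k $$ (i, j)" if i: "i < n" and j: "j < n" for i j
  proof -
    note M_Suc = step
    have "(i, j) \<in> (arcs (mat_digraph A))\<^sup>*" using irreducible_reachable(2)[OF irr] i j A by auto
    then have "j < n \<and> (\<exists>k. 0 < ?M k $$ (i, j))"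
    proof induction
      case base
      then show ?case using i A by (auto intro!: exI[of _ 0])
    next
      case (step l m)
      then obtain k where k: "0 < ?M k $$ (i, l)" "l < n" by auto
      have m: "m < n" "A $$ (l, m) > 0"
        using step(2) A nn by (auto simp: mat_digraph_arcs entrywise_nonneg_def less_le)
      have "0 < ?M k $$ (i, l) * A $$ (l, m)" using k m by simp
      also have "\<dots> \<le> (\<Sum>l<n. ?M k $$ (i, l) * A $$ (l, m))"
        using k m nonneg[OF i] nn A
        by (intro member_le_sum) (auto simp: entrywise_nonneg_def intro!: mult_nonneg_nonneg)
      also have "\<dots> \<le> ?M (Suc k) $$ (i, m)"
        using \<open>i < n\<close> m nonneg[OF i, of m k] by (subst M_Suc) auto
      finally show ?case using m by blast
    qed
    then show ?thesis by blast
  qed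
  then obtain f where f: "\<And>i j. i < n \<Longrightarrow> j < n \<Longrightarrow> 0 < ?M (f i j) $$ (i, j)" by metis
  define N where "N = (\<Sum>i<n. \<Sum>j<n. f i j)"
  have "0 < ?M N $$ (i, j)" if "i < n" "j < n" for i j
  proof -
    have "f i j \<le> (\<Sum>j<n. f i j)" using that by (intro member_le_sum) auto
    also have "\<dots> \<le> N" unfolding N_def using that by (intro member_le_sum[of i "{..<n}" "\<lambda>i. \<Sum>j<n. f i j"]) auto
    finally show ?thesis using mono[OF that, of "f i j" N] f[OF that] by linarith
  qed
  then show ?thesis using A by (auto simp: connecting_def)
qed

section \<open>Counting compatible choices of branches\<close>

lemma norm_root_of_unity:
  assumes "x ^ k = 1" "k > 0" shows "norm (x::complex) = 1"
  using power_eq_1_iff[OF assms(1)] assms(2) by simp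

text \<open>The combinatorial part of the count. The set \<open>\<sigma>\<close> stands for the spectrum and
  \<open>\<rho>\<close> for the Perron root. The assumption on \<open>s\<close> says that \<open>u
  \<mapsto> u\<^sup>s\<close> picks, consistently with multiplication, a \<open>p\<close>-th root of
  every \<open>h\<close>-th root of unity.\<close>

locale root_branches =
  fixes h s p :: nat and \<sigma> :: "complex set" and \<rho> :: complex
  assumes h: "h > 0" and p: "p > 0"
    and sp: "\<And>u :: complex. u ^ h = 1 \<Longrightarrow> u ^ (s * p) = u"
    and fin: "finite \<sigma>" and nz: "0 \<notin> \<sigma>"
    and cnj_closed: "\<And>l. l \<in> \<sigma> \<Longrightarrow> cnj l \<in> \<sigma>"
    and rot_closed: "\<And>l u. l \<in> \<sigma> \<Longrightarrow> u ^ h = 1 \<Longrightarrow> u * l \<in> \<sigma>"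
    and rho: "\<rho> \<in> \<sigma>" "\<rho> \<in> pos_reals"
begin

definition orb :: "complex \<Rightarrow> complex set" where
  "orb l = {u * l | u. u ^ h = 1}"

definition cls :: "complex \<Rightarrow> complex set" where
  "cls l = orb l \<union> orb (cnj l)"

text \<open>A representative of the orbit of \<open>l\<close> under rotations and conjugation. A positive real
  number is taken when there is one: at such a point the constraint on the branch is just that its
  value is real. In particular \<open>\<rho>\<close> represents its own orbit.\<close>

definition rep :: "complex \<Rightarrow> complex" where
  "rep l = (SOME m. m \<in> cls l \<and> (cls l \<inter> pos_reals \<noteq> {} \<longrightarrow> m \<in> pos_reals))"

definition admissible :: "(complex \<Rightarrow> complex) set" where
  "admissible = {g \<in> extensional \<sigma>. (\<forall>l\<in>\<sigma>. g l ^ p = l \<and> g (cnj l) = cnj (g l) \<and>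
     (\<forall>u. u ^ h = 1 \<longrightarrow> g (u * l) = u ^ s * g l)) \<and> g \<rho> \<in> pos_reals}"

text \<open>The values that a compatible branch function can take at a representative \<open>m\<close>. The
  condition in the middle is compatibility with the stabiliser of \<open>m\<close>: a rotation
  composed with conjugation may fix \<open>m\<close>, whereas a rotation by \<open>u \<noteq>
  1\<close> never does.\<close>

definition choices :: "complex \<Rightarrow> complex set" where
  "choices m = {z. z ^ p = m \<and> (\<forall>u. u ^ h = 1 \<longrightarrow> u * cnj m = m \<longrightarrow> u ^ s * cnj z = z)
     \<and> (m = \<rho> \<longrightarrow> z \<in> pos_reals)}"

lemma rot_mult: "u ^ h = 1 \<Longrightarrow> v ^ h = 1 \<Longrightarrow> (u * v :: complex) ^ h = 1"
  by (simp add: power_mult_distrib)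

lemma rot_div: "u ^ h = 1 \<Longrightarrow> v ^ h = 1 \<Longrightarrow> (u / v :: complex) ^ h = 1"
  by (simp add: power_divide)

lemma rot_cnj: "u ^ h = 1 \<Longrightarrow> cnj u ^ h = 1"
  by (metis complex_cnj_one complex_cnj_power)

lemma rot_nonzero: "u ^ h = 1 \<Longrightarrow> u \<noteq> (0::complex)"
  using h by (auto simp: zero_power)

lemma rot_norm: "u ^ h = 1 \<Longrightarrow> norm (u::complex) = 1"
  using h by (rule norm_root_of_unity[rotated])

lemma orb_rot:
  assumes "u ^ h = 1"
  shows "orb (u * l) = orb l"
proof -
  have "v * (u * l) \<in> orb l" if "v ^ h = 1" for v
    using rot_mult[OF that assms] unfolding orb_def by (auto intro!: exI[of _ "v * u"] simp: mult.assoc)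
  moreover have "v * l \<in> orb (u * l)" if "v ^ h = 1" for v
    using rot_div[OF that assms] rot_nonzero[OF assms] unfolding orb_def
    by (auto intro!: exI[of _ "v / u"])
  ultimately show ?thesis by (auto simp: orb_def)
qed

lemma orb_self [simp]: "l \<in> orb l"
  by (auto simp: orb_def intro: exI[of _ 1])

lemma cnj_orb: "cnj ` orb l = orb (cnj l)"
proof -
  have "cnj ` orb m \<subseteq> orb (cnj m)" for m by (auto simp: orb_def intro: rot_cnj)
  from this[of l] image_mono[OF this[of "cnj l"], of cnj] show ?thesis
    by (force simp: image_image)
qed

lemma orb_eq_iff: "orb l = orb m \<longleftrightarrow> m \<in> orb l"
proof
  assume "m \<in> orb l"
  then obtain u where "u ^ h = 1" "m = u * l" by (auto simp: orb_def)
  then show "orb l = orb m" using orb_rot by simp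
qed (use orb_self[of m] in simp)

lemma orb_subset: "l \<in> \<sigma> \<Longrightarrow> orb l \<subseteq> \<sigma>"
  using rot_closed by (auto simp: orb_def)

lemma cls_subset: "l \<in> \<sigma> \<Longrightarrow> cls l \<subseteq> \<sigma>"
  using orb_subset[of l] orb_subset[of "cnj l"] cnj_closed by (auto simp: cls_def)

lemma cls_eq: "m \<in> cls l \<Longrightarrow> cls m = cls l"
proof -
  have "cls m = cls l" if "m \<in> orb l" for m l
  proof -
    have "orb m = orb l" using that orb_eq_iff by blast
    moreover from this have "orb (cnj m) = orb (cnj l)" by (metis cnj_orb)
    ultimately show ?thesis by (simp add: cls_def)
  qed
  moreover have "cls (cnj l) = cls l" by (auto simp: cls_def)
  ultimately show "m \<in> cls l \<Longrightarrow> cls m = cls l" by (metis UnE cls_def)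
qed

lemma rep_cls: "rep l \<in> cls l" and rep_pos: "cls l \<inter> pos_reals \<noteq> {} \<Longrightarrow> rep l \<in> pos_reals"
proof -
  have "\<exists>m. m \<in> cls l \<and> (cls l \<inter> pos_reals \<noteq> {} \<longrightarrow> m \<in> pos_reals)"
  proof (cases "cls l \<inter> pos_reals = {}")
    case True
    then show ?thesis using orb_self[of l] by (intro exI[of _ l]) (auto simp: cls_def)
  qed auto
  from someI_ex[OF this] show "rep l \<in> cls l" "cls l \<inter> pos_reals \<noteq> {} \<Longrightarrow> rep l \<in> pos_reals"
    by (auto simp: rep_def)
qed

lemma rep_eq_of_cls: "m \<in> cls l \<Longrightarrow> rep m = rep l"
  unfolding rep_def using cls_eq by simp

lemma reps_eqI: "m \<in> rep ` \<sigma> \<Longrightarrow> m' \<in> rep ` \<sigma> \<Longrightarrow> m' \<in> cls m \<Longrightarrow> m' = m"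
  using rep_eq_of_cls rep_cls by (metis imageE)

lemma reps_subset: "rep ` \<sigma> \<subseteq> \<sigma>"
  using rep_cls cls_subset by blast

lemma self_cls: "l \<in> cls l"
  using orb_self by (simp add: cls_def)

lemma in_cls_rep: "l \<in> cls (rep l)"
  using cls_eq[OF rep_cls[of l]] self_cls[of l] by simp

text \<open>Rotations and conjugation preserve the modulus, so an orbit contains at most one positive real
  number.\<close>

lemma pos_cls_rep_unique:
  assumes "t \<in> pos_reals" shows "rep t = t"
proof -
  have "rep t \<in> pos_reals" using rep_pos self_cls assms by blast
  then obtain a b where ab: "0 < a" "rep t = complex_of_real a" "0 < b" "t = complex_of_real b"
    using assms by (auto simp: pos_reals_def)
  then have "rep t \<in> orb t" using rep_cls[of t] by (simp add: cls_def)
  then obtain u where "u ^ h = 1" "rep t = u * t" by (auto simp: orb_def)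
  then have "norm (rep t) = norm t" using rot_norm by (simp add: norm_mult)
  then show ?thesis using ab by simp
qed

text \<open>A compatible function is determined by its values at the representatives. Conversely, values in
  \<open>choices\<close> propagate along the orbits; the stabiliser condition is what makes the
  result independent of the path.\<close>

lemma bij_admissible_choices:
  "bij_betw (\<lambda>g. restrict g (rep ` \<sigma>)) admissible (PiE (rep ` \<sigma>) choices)"
proof (rule bij_betw_imageI)
  show "inj_on (\<lambda>g. restrict g (rep ` \<sigma>)) admissible"
  proof (rule inj_onI)
    fix g g' assume g: "g \<in> admissible" and g': "g' \<in> admissible"
      and eq: "restrict g (rep ` \<sigma>) = restrict g' (rep ` \<sigma>)"
    show "g = g'"
    proof (rule extensionalityI[of _ \<sigma>])
      fix l assume l: "l \<in> \<sigma>"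
      have m: "rep l \<in> \<sigma>" using reps_subset l by blast
      have e: "g (rep l) = g' (rep l)" using fun_cong[OF eq, of "rep l"] l by simp
      from in_cls_rep[of l] consider u where "u ^ h = 1" "l = u * rep l"
        | u where "u ^ h = 1" "l = u * cnj (rep l)"
        by (auto simp: cls_def orb_def)
      then show "g l = g' l"
      proof cases
        case 1
        have "g (u * rep l) = u ^ s * g (rep l)" "g' (u * rep l) = u ^ s * g' (rep l)"
          using g g' m 1(1) by (auto simp: admissible_def)
        then show ?thesis using 1(2) e by metis
      next
        case 2
        have "g (u * cnj (rep l)) = u ^ s * cnj (g (rep l))" "g' (u * cnj (rep l)) = u ^ s * cnj (g' (rep l))"
          using g g' m 2(1) cnj_closed[OF m] by (auto simp: admissible_def)
        then show ?thesis using 2(2) e by metis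
      qed
    qed (use g g' in \<open>auto simp: admissible_def\<close>)
  qed
next
  show "(\<lambda>g. restrict g (rep ` \<sigma>)) ` admissible = PiE (rep ` \<sigma>) choices"
  proof (intro equalityI subsetI)
    fix f assume "f \<in> (\<lambda>g. restrict g (rep ` \<sigma>)) ` admissible"
    then obtain g where g: "g \<in> admissible" and f: "f = restrict g (rep ` \<sigma>)" by blast
    have "g m \<in> choices m" if "m \<in> rep ` \<sigma>" for m
    proof -
      have m: "m \<in> \<sigma>" using that reps_subset by blast
      have "u ^ s * cnj (g m) = g m" if u: "u ^ h = 1" "u * cnj m = m" for u
      proof -
        have "g (u * cnj m) = u ^ s * g (cnj m)" "g (cnj m) = cnj (g m)"
          using g m cnj_closed[OF m] u(1) by (auto simp: admissible_def)
        then show ?thesis using u(2) by simp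
      qed
      then show ?thesis using g m by (auto simp: choices_def admissible_def)
    qed
    then show "f \<in> PiE (rep ` \<sigma>) choices" unfolding f by (auto simp: PiE_def)
  next
    fix z assume z: "z \<in> PiE (rep ` \<sigma>) choices"
    \<comment> \<open>The graph of the extension of \<open>z\<close>: all images of the points \<open>(m, z m)\<close> under rotations and conjugation.\<close>
    define Rel where "Rel l w \<longleftrightarrow> (\<exists>m\<in>rep ` \<sigma>. \<exists>u. u ^ h = 1 \<and>
      (l = u * m \<and> w = u ^ s * z m \<or> l = u * cnj m \<and> w = u ^ s * cnj (z m)))" for l w
    have RelI1: "Rel (u * m) (u ^ s * z m)" if "m \<in> rep ` \<sigma>" "u ^ h = 1" for u m
      using that unfolding Rel_def by blast
    have RelI2: "Rel (u * cnj m) (u ^ s * cnj (z m))" if "m \<in> rep ` \<sigma>" "u ^ h = 1" for u m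
      using that unfolding Rel_def by blast
    have zm: "z m \<in> choices m" if "m \<in> rep ` \<sigma>" for m using z that by auto
    have total: "\<exists>w. Rel l w" if l: "l \<in> \<sigma>" for l
    proof -
      have "(\<exists>u. u ^ h = 1 \<and> l = u * rep l) \<or> (\<exists>u. u ^ h = 1 \<and> l = u * cnj (rep l))"
        using in_cls_rep[of l] by (auto simp: cls_def orb_def)
      then show ?thesis using RelI1[of "rep l"] RelI2[of "rep l"] l by (metis imageI)
    qed
    have mixed: "u ^ s * z m = v ^ s * cnj (z m)"
      if m: "m \<in> rep ` \<sigma>" and u: "u ^ h = 1" and v: "v ^ h = 1" and e: "u * m = v * cnj m" for m u v
    proof -
      have "(v / u) * cnj m = m" using e rot_nonzero[OF u] by (simp add: field_simps)
      then have "(v / u) ^ s * cnj (z m) = z m" using zm[OF m] rot_div[OF v u] by (auto simp: choices_def)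
      then show ?thesis using rot_nonzero[OF u] by (simp add: power_divide field_simps)
    qed
    have functional: "w = w'" if "Rel l w" "Rel l w'" for l w w'
    proof -
      from that(1) obtain m u where m: "m \<in> rep ` \<sigma>" and u: "u ^ h = 1"
        and c: "l = u * m \<and> w = u ^ s * z m \<or> l = u * cnj m \<and> w = u ^ s * cnj (z m)"
        unfolding Rel_def by blast
      from that(2) obtain m' v where m': "m' \<in> rep ` \<sigma>" and v: "v ^ h = 1"
        and c': "l = v * m' \<and> w' = v ^ s * z m' \<or> l = v * cnj m' \<and> w' = v ^ s * cnj (z m')"
        unfolding Rel_def by blast
      have "l \<in> cls m" using c u by (auto simp: cls_def orb_def)
      moreover have "l \<in> cls m'" using c' v by (auto simp: cls_def orb_def)
      ultimately have "m' \<in> cls m" using cls_eq self_cls by metis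
      then have mm: "m' = m" by (rule reps_eqI[OF m m'])
      have m0: "m \<noteq> 0" using m reps_subset nz by blast
      from c c' show ?thesis unfolding mm
        using mixed[OF m u v] mixed[OF m v u] m0 by (elim disjE conjE) auto
    qed
    have Rel_conv: "(THE w. Rel l w) = w" if "Rel l w" for l w
      using that functional by blast
    define g where "g = restrict (\<lambda>l. THE w. Rel l w) \<sigma>"
    have gI: "g l = w" if "l \<in> \<sigma>" "Rel l w" for l w
      using that Rel_conv by (simp add: g_def)
    have gRel: "Rel l (g l)" if "l \<in> \<sigma>" for l using total[OF that] gI[OF that] by metis
    have Rel_rot: "Rel (v * l) (v ^ s * w)" if "Rel l w" "v ^ h = 1" for l w v
    proof -
      from that(1) obtain m u where m: "m \<in> rep ` \<sigma>" and u: "u ^ h = 1"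
        and c: "l = u * m \<and> w = u ^ s * z m \<or> l = u * cnj m \<and> w = u ^ s * cnj (z m)"
        unfolding Rel_def by blast
      from c show ?thesis
        using RelI1[OF m rot_mult[OF that(2) u]] RelI2[OF m rot_mult[OF that(2) u]]
        by (auto simp: power_mult_distrib mult.assoc)
    qed
    have Rel_cnj: "Rel (cnj l) (cnj w)" if "Rel l w" for l w
    proof -
      from that(1) obtain m u where m: "m \<in> rep ` \<sigma>" and u: "u ^ h = 1"
        and c: "l = u * m \<and> w = u ^ s * z m \<or> l = u * cnj m \<and> w = u ^ s * cnj (z m)"
        unfolding Rel_def by blast
      from c show ?thesis
        using RelI1[OF m rot_cnj[OF u]] RelI2[OF m rot_cnj[OF u]] by auto
    qed
    have Rel_pow: "w ^ p = l" if "Rel l w" for l w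
    proof -
      from that(1) obtain m u where m: "m \<in> rep ` \<sigma>" and u: "u ^ h = 1"
        and c: "l = u * m \<and> w = u ^ s * z m \<or> l = u * cnj m \<and> w = u ^ s * cnj (z m)"
        unfolding Rel_def by blast
      have "z m ^ p = m" using zm[OF m] by (simp add: choices_def)
      moreover from this have "cnj (z m) ^ p = cnj m" by (metis complex_cnj_power)
      ultimately show ?thesis using c sp[OF u] by (auto simp: power_mult_distrib simp flip: power_mult)
    qed
    have rr: "rep \<rho> = \<rho>" using pos_cls_rep_unique rho by simp
    then have rR: "\<rho> \<in> rep ` \<sigma>" using image_eqI[where f=rep, OF rr[symmetric] rho(1)] by simp
    have "g \<rho> = z \<rho>" using gI[OF rho(1)] RelI1[OF rR, of 1] by simp
    then have "g \<rho> \<in> pos_reals" using zm[OF rR] by (simp add: choices_def)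
    moreover have "g l ^ p = l" "g (cnj l) = cnj (g l)" if "l \<in> \<sigma>" for l
      using Rel_pow[OF gRel[OF that]] gI[OF cnj_closed[OF that] Rel_cnj[OF gRel[OF that]]] by auto
    moreover have "g (u * l) = u ^ s * g l" if "l \<in> \<sigma>" "u ^ h = 1" for l u
      using gI[OF rot_closed[OF that] Rel_rot[OF gRel[OF that(1)] that(2)]] .
    ultimately have "g \<in> admissible" by (auto simp: admissible_def g_def)
    moreover have "restrict g (rep ` \<sigma>) = z"
    proof (rule extensionalityI[of _ "rep ` \<sigma>"])
      fix m assume m: "m \<in> rep ` \<sigma>"
      then show "restrict g (rep ` \<sigma>) m = z m"
        using gI[of m "z m"] RelI1[OF m, of 1] reps_subset by auto
    qed (use z in \<open>auto simp: PiE_def\<close>)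
    ultimately show "z \<in> (\<lambda>g. restrict g (rep ` \<sigma>)) ` admissible" by blast
  qed
qed

lemma card_admissible: "card admissible = (\<Prod>m\<in>rep ` \<sigma>. card (choices m))"
  using bij_betw_same_card[OF bij_admissible_choices] fin by (simp add: card_PiE)

lemma finite_choices: "m \<in> \<sigma> \<Longrightarrow> finite (choices m)"
  by (rule finite_subset[OF _ finite_nth_roots[OF p, of m]]) (auto simp: choices_def)

lemma finite_admissible: "finite admissible"
  using bij_betw_finite[OF bij_admissible_choices] fin finite_choices reps_subset
  by (auto intro!: finite_PiE)

definition self_conj :: "complex \<Rightarrow> bool" where
  "self_conj m \<longleftrightarrow> cnj ` orb m = orb m"

lemma self_conj_iff: "self_conj m \<longleftrightarrow> (\<exists>u. u ^ h = 1 \<and> u * cnj m = m)"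
  unfolding self_conj_def cnj_orb orb_eq_iff by (simp add: orb_def) metis

lemma real_self_conj: "t \<in> orb m \<Longrightarrow> t \<in> \<real> \<Longrightarrow> self_conj m"
proof -
  assume "t \<in> orb m" "t \<in> \<real>"
  then have "orb m = orb t" "cnj t = t" by (auto simp: orb_eq_iff Reals_cnj_iff)
  then show ?thesis by (simp add: self_conj_def cnj_orb)
qed

lemma pos_real_roots:
  assumes "0 < t"
  shows "z \<in> pos_reals \<and> z ^ p = complex_of_real t \<longleftrightarrow> z = complex_of_real (root p t)"
proof
  assume "z \<in> pos_reals \<and> z ^ p = complex_of_real t"
  then obtain x where x: "0 < x" "z = of_real x" "complex_of_real (x ^ p) = of_real t"
    by (auto simp: pos_reals_def)
  then have "root p t = x" using p by (metis of_real_eq_iff real_root_power_cancel less_imp_le)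
  then show "z = complex_of_real (root p t)" using x by simp
next
  assume z: "z = complex_of_real (root p t)"
  have "root p t > 0" "root p t ^ p = t" using p assms by auto
  then show "z \<in> pos_reals \<and> z ^ p = complex_of_real t"
    unfolding z pos_reals_def by (auto simp flip: of_real_power)
qed

lemma rot_fixing_real:
  assumes "t \<noteq> 0" "u * cnj (complex_of_real t) = complex_of_real t"
  shows "u = 1"
  using assms by simp

lemma card_choices_rho: "card (choices \<rho>) = 1"
proof -
  obtain t where t: "0 < t" "\<rho> = complex_of_real t" using rho by (auto simp: pos_reals_def)
  have "choices \<rho> = {complex_of_real (root p t)}"
  proof (intro equalityI subsetI)
    fix z assume "z \<in> choices \<rho>"
    then have "z \<in> pos_reals \<and> z ^ p = complex_of_real t" by (simp add: choices_def t(2)[symmetric])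
    then show "z \<in> {complex_of_real (root p t)}" by (simp add: pos_real_roots[OF t(1)])
  next
    fix z assume "z \<in> {complex_of_real (root p t)}"
    then have z: "z = complex_of_real (root p t)" by simp
    have "z \<in> pos_reals" "z ^ p = \<rho>" using pos_real_roots[OF t(1), of z] z t(2) by blast+
    moreover have "u ^ s * cnj z = z" if "u * cnj \<rho> = \<rho>" for u
      using rot_fixing_real[of t u] t that z by simp
    ultimately show "z \<in> choices \<rho>" unfolding choices_def by blast
  qed
  then show ?thesis by simp
qed

lemma card_choices_not_self_conj:
  assumes m: "m \<in> \<sigma>" and ns: "\<not> self_conj m"
  shows "card (choices m) = p"
proof -
  have "m \<noteq> \<rho>"
    using real_self_conj[of \<rho> \<rho>] rho ns by (auto simp: pos_reals_def)
  then have "choices m = {z. z ^ p = m}" using ns by (auto simp: choices_def self_conj_iff)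
  moreover have "m \<noteq> 0" using m nz by auto
  ultimately show ?thesis using card_nth_roots[of m p] p by simp
qed

text \<open>If \<open>u\<close> rotates the conjugate of \<open>m\<close> back to \<open>m\<close>, then
  \<open>z \<mapsto> u\<^sup>s cnj z\<close> acts on the \<open>p\<close>-th roots of
  \<open>m\<close>. Relative to one root \<open>z\<^sub>0\<close> this is the map \<open>x \<mapsto>
  e/x\<close> on the \<open>p\<close>-th roots of unity. Its fixed points solve \<open>x\<^sup>2 =
  e\<close>, and for odd \<open>p\<close> squaring is a bijection there.\<close>

lemma card_choices_self_conj_odd:
  assumes m: "m \<in> \<sigma>" and sc: "self_conj m" and odd: "odd p"
  shows "card (choices m) = 1"
proof (cases "m = \<rho>")
  case False
  have m0: "m \<noteq> 0" using m nz by auto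
  obtain u where u: "u ^ h = 1" "u * cnj m = m" using sc by (auto simp: self_conj_iff)
  have uu: "v = u" if "v * cnj m = m" for v using that u m0 by (metis complex_cnj_zero_iff mult_right_cancel)
  have "card {z. z ^ p = m} \<noteq> 0" using card_nth_roots[OF m0 p] p by simp
  then have "{z. z ^ p = m} \<noteq> {}" by (metis card.empty)
  then obtain z0 where z0: "z0 ^ p = m" by blast
  have z00: "z0 \<noteq> 0" using z0 m0 p by (auto simp: zero_power)
  have ch: "choices m = {z. z ^ p = m \<and> u ^ s * cnj z = z}"
  proof -
    have "(\<forall>v. v ^ h = 1 \<longrightarrow> v * cnj m = m \<longrightarrow> v ^ s * cnj z = z) \<longleftrightarrow> u ^ s * cnj z = z" for z
      using u uu by blast
    then show ?thesis using False by (simp add: choices_def)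
  qed
  obtain k where k: "p = 2 * k + 1" using odd by (auto elim: oddE)
  define e where "e = u ^ s * cnj z0 / z0"
  have usp: "(u ^ s) ^ p = u" using sp[OF u(1)] by (simp only: power_mult)
  have "e ^ p = (u ^ s) ^ p * cnj (z0 ^ p) / z0 ^ p"
    by (simp add: e_def power_divide power_mult_distrib)
  also have "\<dots> = m / m" unfolding usp z0 u(2) ..
  finally have ep: "e ^ p = 1" using m0 by simp
  have cnj_root: "cnj x = 1 / x" if "x ^ p = 1" for x :: complex
  proof -
    have "norm x = 1" using norm_root_of_unity[OF that p] .
    then have "x * cnj x = 1" by (simp flip: complex_norm_square)
    moreover from this have "x \<noteq> 0" by auto
    ultimately show ?thesis by (simp add: field_simps)
  qed
  have fix_iff: "u ^ s * cnj (z0 * x) = z0 * x \<longleftrightarrow> x ^ 2 = e" if x: "x ^ p = 1" for x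
  proof -
    have x0: "x \<noteq> 0" using x p by (auto simp: zero_power)
    have "u ^ s * cnj (z0 * x) = e * z0 / x"
      using cnj_root[OF x] z00 by (simp add: e_def)
    then have "u ^ s * cnj (z0 * x) = z0 * x \<longleftrightarrow> e * z0 / x = z0 * x" by simp
    also have "\<dots> \<longleftrightarrow> z0 * e = z0 * x ^ 2" using x0
      by (simp add: nonzero_divide_eq_eq power2_eq_square mult_ac)
    finally show ?thesis using z00 by auto
  qed
  \<comment> \<open>Since \<open>2 (k + 1) = p + 1\<close>, the only square root of \<open>e\<close> among the \<open>p\<close>-th roots of unity is \<open>e ^ (k + 1)\<close>.\<close>
  have "choices m = {z0 * e ^ (k + 1)}"
  proof (intro equalityI subsetI)
    fix z assume "z \<in> choices m"
    then have z: "z ^ p = m" "u ^ s * cnj z = z" by (auto simp: ch)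
    define x where "x = z / z0"
    have x: "x ^ p = 1" "z = z0 * x" using z z0 z00 m0 by (auto simp: x_def power_divide)
    then have "x ^ 2 = e" using fix_iff z by auto
    then have "e ^ (k + 1) = x ^ (2 * (k + 1))" by (simp only: power_mult)
    also have "\<dots> = x ^ p * x" by (simp add: k)
    finally show "z \<in> {z0 * e ^ (k + 1)}" using x by simp
  next
    fix z assume "z \<in> {z0 * e ^ (k + 1)}"
    then have z: "z = z0 * e ^ (k + 1)" by simp
    have xp: "(e ^ (k + 1)) ^ p = 1" using ep 
    proof -
      have "(e ^ (k + 1)) ^ p = (e ^ p) ^ (k + 1)" by (simp only: power_mult[symmetric] mult.commute)
      then show ?thesis using ep by simp
    qed
    have "(e ^ (k + 1)) ^ 2 = e ^ p * e" unfolding k power_mult[symmetric] by (simp add: algebra_simps power_add)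
    then have "u ^ s * cnj z = z" unfolding z using fix_iff[OF xp] ep by simp
    then show "z \<in> choices m" unfolding ch using z xp z0 by (simp add: power_mult_distrib)
  qed
  then show ?thesis by simp
qed (use card_choices_rho in simp)

lemma card_choices_pos_even:
  assumes m: "m \<in> pos_reals" "m \<noteq> \<rho>" and ev: "even p"
  shows "card (choices m) = 2"
proof -
  obtain t where t: "0 < t" "m = complex_of_real t" using m by (auto simp: pos_reals_def)
  let ?r = "root p t"
  have r: "?r > 0" "?r ^ p = t" using t p by auto
  have "choices m = {of_real ?r, - of_real ?r}"
  proof (intro equalityI subsetI)
    fix z assume "z \<in> choices m"
    then have z: "z ^ p = of_real t" "cnj z = z"
      using t by (auto simp: choices_def dest!: spec[of _ 1])
    then obtain x where x: "z = of_real x" by (metis Reals_cases Reals_cnj_iff)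
    have "complex_of_real (\<bar>x\<bar> ^ p) = of_real t"
      using z(1) ev unfolding x by (metis of_real_power power_even_abs)
    then have "\<bar>x\<bar> ^ p = t" using of_real_eq_iff by blast
    then have "\<bar>x\<bar> = ?r" using p by (metis abs_ge_zero real_root_power_cancel)
    then show "z \<in> {of_real ?r, - of_real ?r}" unfolding x by (auto simp: abs_if split: if_splits)
  next
    fix z assume "z \<in> {complex_of_real ?r, - of_real ?r}"
    then have "z ^ p = of_real t" "cnj z = z" using r ev by (auto simp flip: of_real_power)
    moreover have "u = 1" if "u * cnj m = m" for u
      using rot_fixing_real[of t u] t that by simp
    ultimately show "z \<in> choices m" unfolding choices_def using m(2) t(2) by auto
  qed
  moreover have "complex_of_real ?r \<noteq> - of_real ?r"
    using r by (metis less_irrefl neg_equal_zero of_real_eq_iff of_real_minus)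
  ultimately show ?thesis by simp
qed

text \<open>If the rotation orbit of \<open>m\<close> is not self-conjugate, then the full orbit of
  \<open>m\<close> is the union of two rotation orbits that are conjugate to each other. So these
  representatives correspond to the conjugate pairs.\<close>

lemma card_not_self_conj_reps:
  "card {m \<in> rep ` \<sigma>. \<not> self_conj m} = card {{S, cnj ` S} | S. S \<in> orb ` \<sigma> \<and> cnj ` S \<noteq> S}"
proof (rule bij_betw_same_card[of "\<lambda>m. {orb m, cnj ` orb m}"], rule bij_betw_imageI)
  show "inj_on (\<lambda>m. {orb m, cnj ` orb m}) {m \<in> rep ` \<sigma>. \<not> self_conj m}"
  proof (rule inj_onI)
    fix m m' assume m: "m \<in> {m \<in> rep ` \<sigma>. \<not> self_conj m}" "m' \<in> {m \<in> rep ` \<sigma>. \<not> self_conj m}"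
      and "{orb m, cnj ` orb m} = {orb m', cnj ` orb m'}"
    then have "orb m = orb m' \<or> orb m = orb (cnj m')" unfolding cnj_orb by blast
    then have "m \<in> orb m' \<or> m \<in> orb (cnj m')" by (metis orb_self)
    then have "m \<in> cls m'" by (simp add: cls_def)
    then show "m = m'" using reps_eqI m by blast
  qed
  show "(\<lambda>m. {orb m, cnj ` orb m}) ` {m \<in> rep ` \<sigma>. \<not> self_conj m}
      = {{S, cnj ` S} | S. S \<in> orb ` \<sigma> \<and> cnj ` S \<noteq> S}"
  proof (intro equalityI subsetI)
    fix T assume "T \<in> (\<lambda>m. {orb m, cnj ` orb m}) ` {m \<in> rep ` \<sigma>. \<not> self_conj m}"
    then show "T \<in> {{S, cnj ` S} | S. S \<in> orb ` \<sigma> \<and> cnj ` S \<noteq> S}"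
      using reps_subset by (auto simp: self_conj_def)
  next
    fix T assume "T \<in> {{S, cnj ` S} | S. S \<in> orb ` \<sigma> \<and> cnj ` S \<noteq> S}"
    then obtain l where l: "l \<in> \<sigma>" "cnj ` orb l \<noteq> orb l" "T = {orb l, cnj ` orb l}" by auto
    have cc: "cnj ` cnj ` orb l = orb l" by (simp add: image_image)
    have "rep l \<in> orb l \<or> rep l \<in> orb (cnj l)" using rep_cls[of l] by (simp add: cls_def)
    then have "orb (rep l) = orb l \<or> orb (rep l) = cnj ` orb l" unfolding cnj_orb by (metis orb_eq_iff)
    then have "\<not> self_conj (rep l) \<and> T = {orb (rep l), cnj ` orb (rep l)}"
      unfolding self_conj_def l(3) using l(2) cc by (elim disjE) auto
    then show "T \<in> (\<lambda>m. {orb m, cnj ` orb m}) ` {m \<in> rep ` \<sigma>. \<not> self_conj m}" using l(1) by blast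
  qed
qed

lemma card_self_conj_reps:
  "card {m \<in> rep ` \<sigma>. self_conj m} = card {S \<in> orb ` \<sigma>. cnj ` S = S}"
proof (rule bij_betw_same_card[of orb], rule bij_betw_imageI)
  show "inj_on orb {m \<in> rep ` \<sigma>. self_conj m}"
  proof (rule inj_onI)
    fix m m' assume m: "m \<in> {m \<in> rep ` \<sigma>. self_conj m}" "m' \<in> {m \<in> rep ` \<sigma>. self_conj m}"
      and "orb m = orb m'"
    then have "m \<in> orb m' \<or> m \<in> orb (cnj m')" by (metis orb_self)
    then have "m \<in> cls m'" by (simp add: cls_def)
    then show "m = m'" using reps_eqI m by blast
  qed
  show "orb ` {m \<in> rep ` \<sigma>. self_conj m} = {S \<in> orb ` \<sigma>. cnj ` S = S}"
  proof (intro equalityI subsetI)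
    fix S assume "S \<in> {S \<in> orb ` \<sigma>. cnj ` S = S}"
    then obtain l where l: "l \<in> \<sigma>" "S = orb l" "cnj ` orb l = orb l" by auto
    have "rep l \<in> orb l" using rep_cls[of l] l(3) by (simp add: cls_def cnj_orb)
    then have "orb (rep l) = orb l" by (metis orb_eq_iff)
    then show "S \<in> orb ` {m \<in> rep ` \<sigma>. self_conj m}" using l unfolding self_conj_def
      by (intro image_eqI[of _ _ "rep l"]) auto
  qed (use reps_subset in \<open>auto simp: self_conj_def\<close>)
qed

lemma card_admissible_split:
  "card admissible = (\<Prod>m\<in>{m \<in> rep ` \<sigma>. self_conj m}. card (choices m))
     * p ^ card {{S, cnj ` S} | S. S \<in> orb ` \<sigma> \<and> cnj ` S \<noteq> S}"
proof -
  have "rep ` \<sigma> = {m \<in> rep ` \<sigma>. self_conj m} \<union> {m \<in> rep ` \<sigma>. \<not> self_conj m}" by auto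
  then have "card admissible = (\<Prod>m\<in>{m \<in> rep ` \<sigma>. self_conj m}. card (choices m))
      * (\<Prod>m\<in>{m \<in> rep ` \<sigma>. \<not> self_conj m}. card (choices m))"
    unfolding card_admissible using fin by (subst prod.union_disjoint[symmetric]) auto
  moreover have "(\<Prod>m\<in>{m \<in> rep ` \<sigma>. \<not> self_conj m}. card (choices m))
      = (\<Prod>m\<in>{m \<in> rep ` \<sigma>. \<not> self_conj m}. p)"
    using reps_subset by (intro prod.cong) (auto intro!: card_choices_not_self_conj)
  ultimately show ?thesis by (simp add: card_not_self_conj_reps)
qed

theorem card_admissible_odd:
  assumes "odd p"
  shows "card admissible = p ^ card {{S, cnj ` S} | S. S \<in> orb ` \<sigma> \<and> cnj ` S \<noteq> S}"
proof -
  have "(\<Prod>m\<in>{m \<in> rep ` \<sigma>. self_conj m}. card (choices m)) = 1"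
    using reps_subset assms card_choices_self_conj_odd by (intro prod.neutral) blast
  then show ?thesis by (simp add: card_admissible_split)
qed


theorem card_admissible_even:
  assumes "even p" and pos: "\<And>S. S \<in> orb ` \<sigma> \<Longrightarrow> cnj ` S = S \<Longrightarrow> S \<inter> pos_reals \<noteq> {}"
  shows "card admissible = 2 ^ (card {S \<in> orb ` \<sigma>. cnj ` S = S} - 1)
     * p ^ card {{S, cnj ` S} | S. S \<in> orb ` \<sigma> \<and> cnj ` S \<noteq> S}"
proof -
  let ?R = "{m \<in> rep ` \<sigma>. self_conj m}"
  have rR: "\<rho> \<in> ?R"
  proof -
    have "\<rho> \<in> rep ` \<sigma>"
      by (rule image_eqI[where f=rep, OF pos_cls_rep_unique[OF rho(2), symmetric] rho(1)])
    moreover have "\<rho> \<in> \<real>" using rho(2) by (auto simp: pos_reals_def)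
    ultimately show ?thesis using real_self_conj[of \<rho> \<rho>] by simp
  qed
  have mpos: "m \<in> pos_reals" if "m \<in> ?R" for m
  proof -
    have "m \<in> \<sigma>" using that reps_subset by auto
    then have "orb m \<inter> pos_reals \<noteq> {}" using that by (intro pos) (auto simp: self_conj_def)
    then have "rep m \<in> pos_reals" by (intro rep_pos) (auto simp: cls_def)
    moreover have "rep m = m" using that rep_eq_of_cls[OF rep_cls] by auto
    ultimately show ?thesis by simp
  qed
  have "card (choices m) = 2" if "m \<in> ?R - {\<rho>}" for m
    by (rule card_choices_pos_even[OF mpos _ assms(1)]) (use that in blast)+
  then have two: "(\<Prod>m\<in>?R - {\<rho>}. card (choices m)) = (\<Prod>m\<in>?R - {\<rho>}. 2)"
    by (rule prod.cong[OF refl])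
  have finR: "finite ?R" using fin by simp
  have "(\<Prod>m\<in>?R. card (choices m)) = card (choices \<rho>) * (\<Prod>m\<in>?R - {\<rho>}. card (choices m))"
    by (rule prod.remove[OF finR rR])
  also have "\<dots> = 2 ^ card (?R - {\<rho>})" unfolding two card_choices_rho by simp
  also have "card (?R - {\<rho>}) = card ?R - 1" by (rule card_Diff_singleton[OF rR])
  finally have "(\<Prod>m\<in>?R. card (choices m)) = 2 ^ (card ?R - 1)" .
  then show ?thesis unfolding card_admissible_split card_self_conj_reps by simp
qed

end

section \<open>Phases along walks and the cyclic index\<close>

text \<open>Equality in the triangle inequality. With \<open>c = cnj (e D\<^sub>i)\<close>, row
  \<open>i\<close> of the second eigenvector equation exhibits \<open>m x\<^sub>i = \<Sum>\<^sub>k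
  Y\<^sub>i\<^sub>k x\<^sub>k\<close> as \<open>\<Sum>\<^sub>k Y\<^sub>i\<^sub>k x\<^sub>k Re (c
  D\<^sub>k)\<close>, where each real part is at most 1.\<close>

lemma phase_alignment:
  fixes Y :: "real mat" and D :: "nat \<Rightarrow> complex"
  assumes Y: "Y \<in> carrier_mat n n" and nn: "entrywise_nonneg Y"
    and x: "\<And>i. i < n \<Longrightarrow> 0 < x i" "\<And>i. i < n \<Longrightarrow> mat_app Y x i = m * x i"
    and D: "\<And>i. i < n \<Longrightarrow> norm (D i) = 1" and e: "norm e = 1"
    and ev: "\<And>i. i < n \<Longrightarrow> mat_app (cmat Y) (\<lambda>j. D j * of_real (x j)) i = of_real m * e * (D i * of_real (x i))"
    and ij: "i < n" "j < n" "Y $$ (i, j) \<noteq> 0"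
  shows "D j = e * D i"
proof -
  define c where "c = cnj (e * D i)"
  have nc: "norm c = 1" using e D[OF ij(1)] by (simp add: c_def norm_mult)
  have cc: "c * (e * D i) = 1"
    using nc by (simp add: c_def complex_norm_square[symmetric] mult.commute[of "cnj _"] del: complex_cnj_mult)
  have "(\<Sum>k<n. of_real (Y $$ (i, k) * x k) * (c * D k)) = c * mat_app (cmat Y) (\<lambda>j. D j * of_real (x j)) i"
    using Y ij(1) by (simp add: mat_app_def sum_distrib_left mult_ac)
  also have "\<dots> = of_real (m * x i) * (c * (e * D i))"
    unfolding ev[OF ij(1)] by (simp add: mult_ac)
  finally have "Re (\<Sum>k<n. of_real (Y $$ (i, k) * x k) * (c * D k)) = m * x i" unfolding cc by simp
  moreover have "Re (of_real a * z) = a * Re z" for a z by simp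
  ultimately have "(\<Sum>k<n. Y $$ (i, k) * x k * Re (c * D k)) = m * x i" by (simp only: Re_sum)
  then have "(\<Sum>k<n. Y $$ (i, k) * x k * Re (c * D k)) = (\<Sum>k<n. Y $$ (i, k) * x k)"
    using x(2)[OF ij(1)] Y by (simp add: mat_app_def)
  then have "(\<Sum>k<n. Y $$ (i, k) * x k * (1 - Re (c * D k))) = 0"
    by (simp add: algebra_simps sum_subtractf del: times_complex.simps)
  moreover have le: "Re (c * D k) \<le> 1" if "k < n" for k
    using complex_Re_le_cmod[of "c * D k"] nc D[OF that] by (simp add: norm_mult del: times_complex.simps)
  moreover have "0 \<le> Y $$ (i, k) * x k" if "k < n" for k
    using nn Y ij(1) that x(1)[OF that] by (simp add: entrywise_nonneg_def)
  ultimately have "Y $$ (i, j) * x j * (1 - Re (c * D j)) = 0"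
    using ij(2) by (subst (asm) sum_nonneg_eq_0_iff) (auto simp del: times_complex.simps mult_eq_0_iff)
  then have re: "Re (c * D j) = 1" using ij x(1)[OF ij(2)] by simp
  have "norm (c * D j) = 1" using nc D[OF ij(2)] by (simp add: norm_mult)
  then have "(Re (c * D j))\<^sup>2 + (Im (c * D j))\<^sup>2 = 1" by (metis cmod_power2 one_power2)
  then have "Im (c * D j) = 0" unfolding re by simp
  then have cD: "c * D j = 1" using re by (simp add: complex_eq_iff)
  have "c \<noteq> 0" using nc by auto
  then show ?thesis using cD cc by (metis mult_left_cancel)
qed

lemma walk_phase:
  fixes D :: "nat \<Rightarrow> 'a::comm_monoid_mult"
  assumes "\<And>i j. (i, j) \<in> E \<Longrightarrow> D j = e * D i" and "(i, j) \<in> E ^^ k"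
  shows "D j = e ^ k * D i"
  using assms(2)
proof (induction k arbitrary: j)
  case (Suc k)
  then obtain l where "(i, l) \<in> E ^^ k" "(l, j) \<in> E" by auto
  then show ?case using Suc.IH[of l] assms(1)[of l j] by (simp add: mult_ac)
qed simp

lemma cyclic_mat_le_dim:
  assumes "cyclic_mat h A" shows "h \<le> dim_row A"
proof -
  obtain Ps where Ps: "length Ps = h" "distinct Ps" "partition_on {0..<dim_row A} (set Ps)"
    using assms by (auto simp: cyclic_mat_def describes_cyclic_def)
  have "\<forall>P\<in>set Ps. \<exists>i. i \<in> P" using Ps(3) unfolding partition_on_def by (metis ex_in_conv)
  then obtain f where f: "\<And>P. P \<in> set Ps \<Longrightarrow> f P \<in> P" by metis
  have "inj_on f (set Ps)"
  proof (rule inj_onI)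
    fix P Q assume "P \<in> set Ps" "Q \<in> set Ps" "f P = f Q"
    then show "P = Q" using f[of P] f[of Q] Ps(3) by (auto simp: partition_on_def disjoint_def)
  qed
  then have "card (set Ps) \<le> card {0..<dim_row A}"
    using f Ps(3) by (intro card_inj_on_le[of f]) (auto simp: partition_on_def)
  then show ?thesis using Ps distinct_card by fastforce
qed

lemma describes_cyclic_phase:
  assumes A: "A \<in> carrier_mat n n" and d: "describes_cyclic h Ps A"
    and w: "w ^ h = (1 :: complex)"
  shows "\<exists>D. (\<forall>i<n. D i ^ h = 1) \<and> (\<forall>i j. (i, j) \<in> arcs (mat_digraph A) \<longrightarrow> D j = w * D i)"
proof -
  have Ps: "length Ps = h" "distinct Ps" "partition_on {0..<n} (set Ps)"
    and step: "\<And>i j. (i, j) \<in> arcs (mat_digraph A) \<Longrightarrow> \<exists>l < h. i \<in> Ps ! l \<and> j \<in> Ps ! (Suc l mod h)"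
    using d A by (auto simp: describes_cyclic_def)
  define L where "L i = (THE l. l < h \<and> i \<in> Ps ! l)" for i
  have L: "L i = l" if "l < h" "i \<in> Ps ! l" for i l
    unfolding L_def
  proof (rule the_equality)
    fix l' assume l': "l' < h \<and> i \<in> Ps ! l'"
    have "Ps ! l \<in> set Ps" "Ps ! l' \<in> set Ps" using Ps(1) that l' by auto
    moreover have "Ps ! l \<inter> Ps ! l' \<noteq> {}" using that l' by blast
    ultimately have "Ps ! l = Ps ! l'"
      using Ps(3) unfolding partition_on_def disjoint_def by blast
    then show "l' = l" using Ps that l' nth_eq_iff_index_eq by metis
  qed (use that in auto)
  have wmod: "w ^ (k mod h) = w ^ k" for k
  proof -
    have "w ^ k = w ^ (h * (k div h) + k mod h)" by simp
    also have "\<dots> = w ^ (k mod h)" by (simp only: power_add power_mult w power_one mult_1)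
    finally show ?thesis ..
  qed
  have "w ^ L j = w * w ^ L i" if ij: "(i, j) \<in> arcs (mat_digraph A)" for i j
  proof -
    obtain l where l: "l < h" "i \<in> Ps ! l" "j \<in> Ps ! (Suc l mod h)" using step[OF ij] by auto
    then have "L i = l" "L j = Suc l mod h" using L by auto
    then show ?thesis using wmod[of "Suc l"] by simp
  qed
  moreover have "(w ^ L i) ^ h = 1" for i using w by (metis power_mult mult.commute power_one)
  ultimately show ?thesis by (intro exI[of _ "\<lambda>i. w ^ L i"]) auto
qed

text \<open>The residue modulo \<open>d\<close> of the length of a walk from \<open>0\<close> to
  \<open>i\<close> depends on \<open>i\<close> alone: two such walks close up with the same return
  walk, and \<open>d\<close> divides the length of every closed walk. The residues are the parts,
  and none is empty because a closed walk of length at least \<open>d\<close> passes through all of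
  them.\<close>

lemma closed_walk_gcd_cyclic:
  fixes A :: "'a::zero mat"
  assumes A: "A \<in> carrier_mat n n" and irr: "irreducible_mat A"
    and C: "C = {k. 0 < k \<and> (0, 0) \<in> arcs (mat_digraph A) ^^ k}" "C \<noteq> {}"
    and d2: "Gcd C \<ge> 2"
  shows "cyclic_mat (Gcd C) A"
proof -
  define E where "E = arcs (mat_digraph A)"
  define d where "d = Gcd C"
  have d: "d \<ge> 2" using d2 by (simp add: d_def)
  have n: "n > 0" using irreducible_reachable(1)[OF irr] A by simp
  have reach: "\<exists>k. (i, j) \<in> E ^^ k" if "i < n" "j < n" for i j
    using irreducible_reachable(2)[OF irr] A that by (auto simp: E_def rtrancl_power)
  have dvd: "d dvd k" if "(0, 0) \<in> E ^^ k" for k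
    using that C by (cases "k = 0") (auto simp: d_def E_def intro!: Gcd_dvd)
  have cong: "k mod d = l mod d" if i: "i < n" and k: "(0, i) \<in> E ^^ k" and l: "(0, i) \<in> E ^^ l" for i k l
  proof -
    obtain m where m: "(i, 0) \<in> E ^^ m" using reach[OF i n] by blast
    have "d dvd k + m" "d dvd l + m" using dvd relpow_trans[OF k m] relpow_trans[OF l m] by auto
    then have "int d dvd int (k + m) - int (l + m)" by (intro dvd_diff) (simp_all only: int_dvd_int_iff)
    then have "int d dvd int k - int l" by simp
    then show ?thesis by (metis mod_eq_dvd_iff of_nat_eq_iff zmod_int)
  qed
  define P where "P l = {i. i < n \<and> (\<exists>k. (0, i) \<in> E ^^ k \<and> k mod d = l)}" for l
  define Ps where "Ps = map P [0..<d]"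
  have disj: "l = l'" if "i \<in> P l" "i \<in> P l'" for i l l'
    using that cong by (auto simp: P_def)
  have EnD: "i < n \<and> j < n" if "(i, j) \<in> E" for i j
    using that A by (auto simp: E_def mat_digraph_arcs)
  have pow_n: "j < n" if "(0, j) \<in> E ^^ k" for j k
    using that n EnD by (cases k) auto
  have ne: "P l \<noteq> {}" if l: "l < d" for l
  proof -
    obtain k where k: "0 < k" "(0, 0) \<in> E ^^ k" using C by (auto simp: E_def)
    then have "d \<le> k" using dvd by (auto intro: dvd_imp_le)
    then have "(0, 0) \<in> E ^^ l O E ^^ (k - l)" using k(2) l by (simp flip: relpow_add)
    then obtain i where "(0, i) \<in> E ^^ l" by auto
    then have "i \<in> P l" using l pow_n by (auto simp: P_def intro!: exI[of _ l])
    then show ?thesis by auto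
  qed
  have "inj_on P {0..<d}"
    using disj ne by (intro inj_onI) (metis atLeastLessThan_iff ex_in_conv)
  then have dist: "distinct Ps" by (simp add: Ps_def distinct_map)
  have part: "partition_on {0..<n} (set Ps)"
  proof (rule partition_onI)
    show "\<Union> (set Ps) = {0..<n}"
    proof
      show "{0..<n} \<subseteq> \<Union> (set Ps)"
      proof
        fix i assume "i \<in> {0..<n}"
        then obtain k where "(0, i) \<in> E ^^ k" "i < n" using reach[OF n, of i] by auto
        then have "i \<in> P (k mod d)" by (auto simp: P_def)
        then show "i \<in> \<Union> (set Ps)" using d by (auto simp: Ps_def intro!: bexI[of _ "k mod d"])
      qed
    qed (auto simp: Ps_def P_def)
    show "{} \<notin> set Ps" using ne by (force simp: Ps_def)
    fix S T assume "S \<in> set Ps" "T \<in> set Ps" "S \<noteq> T"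
    then obtain l l' where "S = P l" "T = P l'" "l \<noteq> l'" by (auto simp: Ps_def)
    then show "disjnt S T" using disj[of _ l l'] by (meson disjnt_iff)
  qed
  have arcs: "\<exists>l < d. i \<in> Ps ! l \<and> j \<in> Ps ! (Suc l mod d)" if ij: "(i, j) \<in> E" for i j
  proof -
    have n': "i < n" "j < n" using EnD[OF ij] by auto
    obtain k where k: "(0, i) \<in> E ^^ k" using reach[OF n n'(1)] by blast
    have "(0, j) \<in> E ^^ Suc k" using k ij by auto
    then have "j \<in> P (Suc k mod d)" using n' unfolding P_def by blast
    moreover have "i \<in> P (k mod d)" using k n' unfolding P_def by blast
    moreover have "Suc (k mod d) mod d = Suc k mod d" by (rule mod_Suc_eq)
    ultimately have "i \<in> P (k mod d)" "j \<in> P (Suc (k mod d) mod d)" by simp_all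
    then show ?thesis using d by (intro exI[of _ "k mod d"]) (auto simp: Ps_def)
  qed
  have "describes_cyclic d Ps A"
    using d dist part arcs A by (auto simp: describes_cyclic_def Ps_def E_def)
  then show ?thesis by (auto simp: cyclic_mat_def d_def)
qed

text \<open>A phase that is multiplied by \<open>e\<close> along every arc satisfies \<open>e\<^sup>k =
  1\<close> for the length \<open>k\<close> of each closed walk. So it suffices that the greatest
  common divisor of these lengths is \<open>h\<close>. It is a multiple of \<open>h\<close>, as the
  phases of the cyclic structure show, and not larger, since it is itself a cyclicity of
  \<open>A\<close>.\<close>

lemma cyclic_index_phase:
  fixes A :: "'a::zero mat"
  assumes A: "A \<in> carrier_mat n n" and irr: "irreducible_mat A"
    and row: "\<exists>j. (0, j) \<in> arcs (mat_digraph A)"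
    and h: "h = cyclic_index A" and cyc: "cyclic_mat h A"
    and e: "\<And>i j. (i, j) \<in> arcs (mat_digraph A) \<Longrightarrow> E j = e * E i" and E0: "E 0 \<noteq> (0 :: complex)"
  shows "e ^ h = 1"
proof -
  define C where "C = {k. 0 < k \<and> (0, 0) \<in> arcs (mat_digraph A) ^^ k}"
  have n: "n > 0" using irreducible_reachable(1)[OF irr] A by simp
  have "C \<noteq> {}"
  proof -
    obtain j where j: "(0, j) \<in> arcs (mat_digraph A)" using row by blast
    then have "j < n" using A by (auto simp: mat_digraph_arcs)
    then obtain k where "(j, 0) \<in> arcs (mat_digraph A) ^^ k"
      using irreducible_reachable(2)[OF irr, of j 0] A n by (auto simp: rtrancl_power)
    then have "Suc k \<in> C" using relpow_Suc_I2[OF j] by (auto simp: C_def)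
    then show ?thesis by blast
  qed
  have closed1: "f ^ k = 1" if f: "\<And>i j. (i, j) \<in> arcs (mat_digraph A) \<Longrightarrow> F j = f * F i" "F 0 \<noteq> (0 :: complex)"
    and k: "k \<in> C" for f F k
    using walk_phase[of "arcs (mat_digraph A)" F f 0 0 k] f k by (auto simp: C_def)
  define w where "w = cis (2 * pi / h)"
  have h2: "h \<ge> 2" using cyc by (auto simp: cyclic_mat_def describes_cyclic_def)
  have wh: "w ^ h = 1" using h2 by (simp add: w_def DeMoivre)
  obtain Ps where "describes_cyclic h Ps A" using cyc by (auto simp: cyclic_mat_def)
  then obtain D where D: "\<forall>i<n. D i ^ h = 1" "\<And>i j. (i, j) \<in> arcs (mat_digraph A) \<Longrightarrow> D j = w * D i"
    using describes_cyclic_phase[OF A _ wh] by blast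
  have D0: "D 0 \<noteq> 0" using D(1) n h2 by (auto simp: zero_power)
  have prim: "h dvd k" if "w ^ k = 1" for k
  proof -
    have "w ^ (h * (k div h) + k mod h) = 1" using that by simp
    then have "w ^ (k mod h) = 1" by (simp only: power_add power_mult wh power_one mult_1)
    then have "cis (2 * pi * real (k mod h) / real h) = cis (2 * pi * real 0 / real h)"
      by (simp add: w_def DeMoivre mult_ac)
    moreover have "inj_on (\<lambda>k. cis (2 * pi * real k / real h)) {..<h}"
      using bij_betw_roots_unity[of h] h2 by (auto simp: bij_betw_def)
    ultimately have "k mod h = 0" using h2 by (auto dest!: inj_onD[where x="k mod h" and y=0])
    then show ?thesis by auto
  qed
  have "h dvd Gcd C" using prim closed1[of D w, OF D(2) D0] by (intro Gcd_greatest) auto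
  moreover have "Gcd C \<noteq> 0" using \<open>C \<noteq> {}\<close> by (auto simp: C_def)
  ultimately have "h \<le> Gcd C" by (meson dvd_imp_le neq0_conv)
  moreover have "Gcd C \<le> h"
    unfolding h cyclic_index_def
    using closed_walk_gcd_cyclic[OF A irr C_def \<open>C \<noteq> {}\<close>] \<open>h \<le> Gcd C\<close> h2 cyclic_mat_le_dim[of _ A]
    by (intro Greatest_le_nat[of _ _ "dim_row A"]) auto
  ultimately have gcd: "Gcd C = h" by simp
  obtain k0 where k0: "k0 \<in> C" using \<open>C \<noteq> {}\<close> by blast
  \<comment> \<open>The order of \<open>e\<close> divides all closed walk lengths, hence their greatest common divisor.\<close>
  define q where "q = (LEAST q. 0 < q \<and> e ^ q = 1)"
  have q: "0 < q \<and> e ^ q = 1"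
    unfolding q_def
  proof (rule LeastI)
    show "0 < k0 \<and> e ^ k0 = 1" using closed1[of E e, OF e E0 k0] k0 by (simp add: C_def)
  qed
  have "q dvd k" if "k \<in> C" for k
  proof (rule ccontr)
    assume "\<not> q dvd k"
    then have r: "0 < k mod q" "k mod q < q" using q by (auto simp: dvd_eq_mod_eq_0)
    have "e ^ (q * (k div q) + k mod q) = 1" using closed1[of E e, OF e E0 that] by simp
    then have "e ^ (k mod q) = 1" using q by (simp only: power_add power_mult power_one mult_1)
    then have "(LEAST q. 0 < q \<and> e ^ q = 1) \<le> k mod q" using r by (intro Least_le conjI)
    then have "q \<le> k mod q" by (simp only: q_def[symmetric])
    then show False using r by simp
  qed
  then have "q dvd h" using Gcd_greatest[of C q] gcd by simp
  then show ?thesis using q by (metis dvdE power_mult power_one)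
qed

section \<open>Powers of a root with the shifted cyclic structure\<close>

text \<open>The spectral data of an irreducible \<open>h\<close>-cyclic matrix that the theory of its roots
  rests on: positive left and right eigenvectors, the phases \<open>D\<^sub>i\<close> of the cyclic
  structure, and the fact that eigenvectors of maximal modulus are those obtained from
  \<open>x\<close> by these phases.\<close>

locale cyclic_perron =
  fixes A :: "real mat" and n h :: nat and w :: complex and D :: "nat \<Rightarrow> complex"
    and \<rho> :: real and x y :: "nat \<Rightarrow> real"
  assumes A: "A \<in> carrier_mat n n" and nn: "entrywise_nonneg A" and n: "n > 0" and h: "h > 0"
    and roots: "\<And>u :: complex. u ^ h = 1 \<longleftrightarrow> (\<exists>j. u = w ^ j)"
    and D: "\<And>i. i < n \<Longrightarrow> D i ^ h = 1"
    and arc: "\<And>i j. i < n \<Longrightarrow> j < n \<Longrightarrow> A $$ (i, j) \<noteq> 0 \<Longrightarrow> D j = w * D i"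
    and rho: "\<rho> > 0"
    and x: "\<And>i. i < n \<Longrightarrow> 0 < x i" "\<And>i. i < n \<Longrightarrow> mat_app A x i = \<rho> * x i"
    and y: "\<And>i. i < n \<Longrightarrow> 0 < y i" "\<And>i. i < n \<Longrightarrow> mat_app (transpose_mat A) y i = \<rho> * y i"
    and dominant: "\<And>l. eigenvalue (cmat A) l \<Longrightarrow> norm l \<le> \<rho>"
    and peripheral: "\<And>l v. \<exists>i<n. v i \<noteq> 0 \<Longrightarrow> \<forall>i<n. mat_app (cmat A) v i = l * v i \<Longrightarrow> norm l = \<rho>
       \<Longrightarrow> \<exists>c j. c \<noteq> 0 \<and> (\<forall>i<n. v i = c * D i ^ j * of_real (x i))"
begin

lemma wh: "w ^ h = 1"
  using roots[of w] by (metis power_one_right)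

lemma w0: "w \<noteq> 0"
  using wh h by (auto simp: zero_power)

lemma D0: "i < n \<Longrightarrow> D i \<noteq> 0"
  using D[of i] h by (auto simp: zero_power)

lemma D_norm: "i < n \<Longrightarrow> norm (D i) = 1"
  using norm_root_of_unity[OF D h] .

lemma w_norm: "norm w = 1"
  using norm_root_of_unity[OF wh h] .

definition class_weight :: "complex \<Rightarrow> real" where
  "class_weight d = (\<Sum>c<n. if D c = d then x c * y c else 0)"

lemma left_eigen:
  assumes "B \<in> carrier_mat n n" and "j < n"
  shows "mat_app (transpose_mat B) y j = (\<Sum>i<n. y i * B $$ (i, j))"
  using assms by (simp add: mat_app_def mult.commute)

text \<open>Evaluate the bilinear form of \<open>A\<close> on the arcs that leave a class in two ways: with
  \<open>A x = \<rho> x\<close> at the tails, and with the left eigenvector equation at the heads,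
  which lie in the next class.\<close>

lemma class_weight_rot: "class_weight (w * d) = class_weight d"
proof -
  have "\<rho> * class_weight d = (\<Sum>c<n. if D c = d then y c * mat_app A x c else 0)"
    unfolding class_weight_def sum_distrib_left using x(2) by (intro sum.cong) auto
  also have "\<dots> = (\<Sum>c<n. \<Sum>b<n. if D c = d then y c * (A $$ (c, b) * x b) else 0)"
    using A by (intro sum.cong) (auto simp: mat_app_def sum_distrib_left)
  also have "\<dots> = (\<Sum>c<n. \<Sum>b<n. if D b = w * d then x b * (y c * A $$ (c, b)) else 0)"
  proof (intro sum.cong refl)
    fix c b assume "c \<in> {..<n}" "b \<in> {..<n}"
    then show "(if D c = d then y c * (A $$ (c, b) * x b) else 0)
        = (if D b = w * d then x b * (y c * A $$ (c, b)) else 0)"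
      using arc[of c b] w0 by (cases "A $$ (c, b) = 0") auto
  qed
  also have "\<dots> = (\<Sum>b<n. if D b = w * d then x b * mat_app (transpose_mat A) y b else 0)"
    by (subst sum.swap) (auto simp: left_eigen[OF A] sum_distrib_left intro!: sum.cong)
  also have "\<dots> = \<rho> * class_weight (w * d)"
    unfolding class_weight_def sum_distrib_left using y(2) by (intro sum.cong) auto
  finally show ?thesis using rho by simp
qed

lemma class_weight_eq: "i < n \<Longrightarrow> class_weight (D i) = class_weight 1"
proof -
  assume "i < n"
  then obtain j where "D i = w ^ j" using D roots by blast
  moreover have "class_weight (w ^ j) = class_weight 1"
    by (induction j) (simp_all add: class_weight_rot)
  ultimately show ?thesis by simp
qed

lemma class_weight_pos: "class_weight 1 > 0"
proof -
  have "0 < x 0 * y 0" using x(1)[OF n] y(1)[OF n] by simp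
  also have "\<dots> = (if D 0 = D 0 then x 0 * y 0 else 0)" by simp
  also have "\<dots> \<le> class_weight (D 0)" unfolding class_weight_def
    by (rule member_le_sum[of 0 "{..<n}" "\<lambda>c. if D c = D 0 then x c * y c else 0"])
      (use n x(1) y(1) in \<open>auto intro: less_imp_le\<close>)
  finally show ?thesis using class_weight_eq[OF n] by simp
qed

text \<open>The spectral projection onto the span of the peripheral eigenvectors \<open>D\<^sup>j x\<close>.
  Summing the \<open>h\<close> rank-one projections cancels all entries between different classes,
  so the matrix is real and vanishes off the diagonal blocks.\<close>

definition perron_proj :: "real mat" where
  "perron_proj = mat n n (\<lambda>(a, b). if D b = D a then x a * y b / class_weight 1 else 0)"

lemma perron_proj_carrier [simp]: "perron_proj \<in> carrier_mat n n"
  by (simp add: perron_proj_def)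

lemma perron_proj_idem: "perron_proj * perron_proj = perron_proj"
proof (rule eq_matI)
  fix a b assume "a < dim_row perron_proj" "b < dim_col perron_proj"
  then have ab: "a < n" "b < n" by (auto simp: perron_proj_def)
  let ?S = "class_weight 1"
  have "(perron_proj * perron_proj) $$ (a, b)
      = (\<Sum>c<n. perron_proj $$ (a, c) * perron_proj $$ (c, b))"
    using ab by (auto simp: perron_proj_def scalar_prod_def atLeast0LessThan intro!: sum.cong)
  also have "\<dots> = (\<Sum>c<n. (if D b = D a then x a * y b / (?S * ?S) else 0) * (if D c = D a then x c * y c else 0))"
    using ab by (intro sum.cong) (auto simp: perron_proj_def)
  also have "\<dots> = (if D b = D a then x a * y b / (?S * ?S) else 0) * class_weight (D a)"
    by (simp only: sum_distrib_left[symmetric] class_weight_def)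
  also have "\<dots> = perron_proj $$ (a, b)"
    using class_weight_eq[OF ab(1)] class_weight_pos ab by (simp add: perron_proj_def)
  finally show "(perron_proj * perron_proj) $$ (a, b) = perron_proj $$ (a, b)" .
qed (auto simp: perron_proj_def)

lemma shift_pow:
  fixes X :: "'a::semiring_1 mat"
  assumes X: "X \<in> carrier_mat n n"
    and sh: "\<And>a b. a < n \<Longrightarrow> b < n \<Longrightarrow> X $$ (a, b) \<noteq> 0 \<Longrightarrow> D b = u * D a"
    and ab: "a < n" "b < n" "(X ^\<^sub>m k) $$ (a, b) \<noteq> 0"
  shows "D b = u ^ k * D a"
  using ab
proof (induction k arbitrary: b)
  case 0
  then show ?case using X by (simp split: if_splits)
next
  case (Suc k)
  have "(X ^\<^sub>m Suc k) $$ (a, b) = (\<Sum>c<n. (X ^\<^sub>m k) $$ (a, c) * X $$ (c, b))"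
    using X Suc.prems pow_carrier_mat[OF X, of k]
    by (auto simp: scalar_prod_def atLeast0LessThan intro!: sum.cong)
  then have "\<exists>c<n. (X ^\<^sub>m k) $$ (a, c) * X $$ (c, b) \<noteq> 0"
    using Suc.prems(3) by (metis (mono_tags, lifting) lessThan_iff sum.neutral)
  then obtain c where c: "c < n" "(X ^\<^sub>m k) $$ (a, c) \<noteq> 0" "X $$ (c, b) \<noteq> 0"
    by (metis mult_zero_left mult_zero_right)
  show ?case using Suc.IH[OF ab(1) c(1,2)] sh[OF c(1) Suc.prems(2) c(3)] by simp
qed

text \<open>On the range of the projection the powers of \<open>X\<close> shift classes and scale by
  \<open>m\<^sup>k\<close>.\<close>

lemma pow_mult_proj:
  assumes X: "X \<in> carrier_mat n n"
    and sh: "\<And>a b. a < n \<Longrightarrow> b < n \<Longrightarrow> X $$ (a, b) \<noteq> 0 \<Longrightarrow> D b = u * D a"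
    and Xx: "\<And>i. i < n \<Longrightarrow> mat_app X x i = m * x i"
    and ab: "a < n" "b < n"
  shows "(X ^\<^sub>m k * perron_proj) $$ (a, b)
    = (if D b = u ^ k * D a then m ^ k * x a * y b / class_weight 1 else 0)"
proof -
  let ?S = "class_weight 1" and ?Y = "X ^\<^sub>m k"
  have Y: "?Y \<in> carrier_mat n n" using X by simp
  have "(?Y * perron_proj) $$ (a, b) = (\<Sum>c<n. ?Y $$ (a, c) * perron_proj $$ (c, b))"
    using Y ab carrier_matD[OF perron_proj_carrier] carrier_matD[OF Y]
    by (auto simp: scalar_prod_def atLeast0LessThan intro!: sum.cong)
  also have "\<dots> = (\<Sum>c<n. ?Y $$ (a, c) * x c * (if D b = u ^ k * D a then y b / ?S else 0))"
  proof (intro sum.cong refl)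
    fix c assume c: "c \<in> {..<n}"
    show "?Y $$ (a, c) * perron_proj $$ (c, b)
        = ?Y $$ (a, c) * x c * (if D b = u ^ k * D a then y b / ?S else 0)"
      using shift_pow[OF X sh ab(1), of c k] c ab
      by (cases "?Y $$ (a, c) = 0") (auto simp: perron_proj_def)
  qed
  also have "\<dots> = mat_app ?Y x a * (if D b = u ^ k * D a then y b / ?S else 0)"
    unfolding mat_app_def carrier_matD(2)[OF Y] by (rule sum_distrib_right[symmetric])
  also have "mat_app ?Y x a = m ^ k * x a" by (rule mat_app_pow_eigen[OF X Xx ab(1)])
  finally show ?thesis by simp
qed

lemma proj_commute:
  assumes X: "X \<in> carrier_mat n n" and u: "u \<noteq> 0"
    and sh: "\<And>a b. a < n \<Longrightarrow> b < n \<Longrightarrow> X $$ (a, b) \<noteq> 0 \<Longrightarrow> D b = u * D a"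
    and Xx: "\<And>i. i < n \<Longrightarrow> mat_app X x i = m * x i"
    and yX: "\<And>i. i < n \<Longrightarrow> mat_app (transpose_mat X) y i = m * y i"
  shows "perron_proj * X = X * perron_proj"
proof (rule eq_matI)
  fix a b assume "a < dim_row (X * perron_proj)" "b < dim_col (X * perron_proj)"
  then have ab: "a < n" "b < n" using X by (auto simp: perron_proj_def)
  let ?S = "class_weight 1"
  have "(perron_proj * X) $$ (a, b) = (\<Sum>c<n. perron_proj $$ (a, c) * X $$ (c, b))"
    using X ab by (auto simp: perron_proj_def scalar_prod_def atLeast0LessThan intro!: sum.cong)
  also have "\<dots> = (\<Sum>c<n. (if D b = u * D a then x a / ?S else 0) * (y c * X $$ (c, b)))"
  proof (intro sum.cong refl)
    fix c assume c: "c \<in> {..<n}"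
    show "perron_proj $$ (a, c) * X $$ (c, b)
        = (if D b = u * D a then x a / ?S else 0) * (y c * X $$ (c, b))"
      using sh[of c b] c ab u by (cases "X $$ (c, b) = 0") (auto simp: perron_proj_def)
  qed
  also have "\<dots> = (if D b = u * D a then x a / ?S else 0) * (m * y b)"
    by (simp only: sum_distrib_left[symmetric] left_eigen[OF X ab(2), symmetric] yX[OF ab(2)])
  also have "\<dots> = (X ^\<^sub>m 1 * perron_proj) $$ (a, b)"
    by (subst pow_mult_proj[OF X sh Xx ab, where k = 1]) auto
  finally show "(perron_proj * X) $$ (a, b) = (X * perron_proj) $$ (a, b)" using X by simp
qed (use X in \<open>auto simp: perron_proj_def\<close>)

lemma mat_app_proj:
  assumes v: "\<And>i. i < n \<Longrightarrow> v i = c * D i ^ j * of_real (x i)" and a: "a < n"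
  shows "mat_app (cmat perron_proj) v a = v a"
proof -
  let ?S = "class_weight 1"
  have "mat_app (cmat perron_proj) v a
      = (\<Sum>b<n. (v a / of_real ?S) * of_real (if D b = D a then x b * y b else 0))"
    unfolding mat_app_def using a v by (auto simp: perron_proj_def intro!: sum.cong)
  also have "\<dots> = v a / of_real ?S * of_real (class_weight (D a))"
    by (simp only: sum_distrib_left[symmetric] class_weight_def of_real_sum)
  finally show ?thesis using class_weight_eq[OF a] class_weight_pos by simp
qed

text \<open>With \<open>M = X/m\<close> and \<open>Q = 1 - P\<close>, where \<open>P\<close> is the peripheral
  projection, \<open>(M Q)\<^sup>k = M\<^sup>k Q = M\<^sup>k - M\<^sup>k P\<close>. An eigenvector
  of \<open>M Q\<close> with \<open>|\<lambda>| \<ge> 1\<close> would be an eigenvector of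
  \<open>A\<close> of maximal modulus, hence fixed by \<open>P\<close>, although \<open>P Q =
  0\<close>. So \<open>(M Q)\<^sup>k\<close> tends to zero, and \<open>M\<^sup>k P\<close> is
  positive exactly on the entries that the shift by \<open>u\<^sup>k\<close> permits.\<close>

lemma eventually_nonneg_root:
  assumes X: "X \<in> carrier_mat n n" and u: "u ^ h = 1" and p: "p > 0"
    and sh: "\<And>a b. a < n \<Longrightarrow> b < n \<Longrightarrow> X $$ (a, b) \<noteq> 0 \<Longrightarrow> D b = u * D a"
    and Xx: "\<And>i. i < n \<Longrightarrow> mat_app X x i = m * x i"
    and yX: "\<And>i. i < n \<Longrightarrow> mat_app (transpose_mat X) y i = m * y i"
    and Xp: "X ^\<^sub>m p = A" and m: "m > 0"
  shows "eventually_nonneg X"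
proof -
  let ?P = perron_proj and ?S = "class_weight 1"
  have u0: "u \<noteq> 0" using u h by (auto simp: zero_power)
  define Q where "Q = 1\<^sub>m n + (-1) \<cdot>\<^sub>m ?P"
  define M where "M = (1 / m) \<cdot>\<^sub>m X"
  define N where "N = M * Q"
  have Q: "Q \<in> carrier_mat n n" and M: "M \<in> carrier_mat n n"
    using X by (auto simp: Q_def M_def)
  then have N: "N \<in> carrier_mat n n" by (simp add: N_def)
  have P: "?P \<in> carrier_mat n n" and mP: "(-1) \<cdot>\<^sub>m ?P \<in> carrier_mat n n" by auto
  have PQ: "?P * Q = 0\<^sub>m n n"
  proof -
    have "?P * Q = ?P + (-1) \<cdot>\<^sub>m ?P" unfolding Q_def
      by (simp add: mult_add_distrib_mat[OF P one_carrier_mat mP] mult_smult_distrib[OF P P] perron_proj_idem right_mult_one_mat[OF P])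
    also have "\<dots> = 0\<^sub>m n n" using carrier_matD[OF P] by (intro eq_matI) auto
    finally show ?thesis .
  qed
  have QQ: "Q * Q = Q"
  proof -
    have "Q * Q = 1\<^sub>m n * Q + (-1) \<cdot>\<^sub>m ?P * Q"
      using add_mult_distrib_mat[OF one_carrier_mat mP Q] by (simp add: Q_def)
    also have "(-1) \<cdot>\<^sub>m ?P * Q = 0\<^sub>m n n" using mult_smult_assoc_mat[OF P Q] PQ by simp
    finally show ?thesis using Q by simp
  qed
  have PM: "?P * M = M * ?P"
    using proj_commute[OF X u0 sh Xx yX] X
    by (simp add: M_def mult_smult_distrib[OF P X] mult_smult_assoc_mat[OF X P])
  have QM: "Q * M = M * Q"
    unfolding Q_def
    by (simp add: add_mult_distrib_mat[OF one_carrier_mat mP M] mult_add_distrib_mat[OF M one_carrier_mat mP]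
      mult_smult_distrib[OF M P] mult_smult_assoc_mat[OF P M] PM left_mult_one_mat[OF M] right_mult_one_mat[OF M])
  have QN: "Q * N = N"
  proof -
    have "Q * N = Q * M * Q" unfolding N_def using assoc_mult_mat[OF Q M Q] by simp
    also have "\<dots> = M * (Q * Q)" unfolding QM using assoc_mult_mat[OF M Q Q] by simp
    finally show ?thesis by (simp add: QQ N_def)
  qed
  have Npow: "N ^\<^sub>m Suc k = M ^\<^sub>m Suc k * Q" for k
  proof (induction k)
    case 0
    then show ?case using M N by (simp add: N_def)
  next
    case (Suc k)
    let ?Mk = "M ^\<^sub>m Suc k"
    have Mk: "?Mk \<in> carrier_mat n n" using M by (intro pow_carrier_mat)
    have "N ^\<^sub>m Suc (Suc k) = ?Mk * Q * N" using Suc by simp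
    also have "\<dots> = ?Mk * (Q * N)" by (rule assoc_mult_mat[OF Mk Q N])
    also have "\<dots> = ?Mk * M * Q" unfolding QN unfolding N_def using assoc_mult_mat[OF Mk M Q] by simp
    finally show ?case by simp
  qed
  have cA: "cmat A \<in> carrier_mat n n" and cX: "cmat X \<in> carrier_mat n n"
    and cN: "cmat N \<in> carrier_mat n n" and cQ: "cmat Q \<in> carrier_mat n n" and cM: "cmat M \<in> carrier_mat n n"
    using A X N Q M by auto
  have small: "norm l < 1" if ev: "eigenvalue (cmat N) l" for l
  proof (rule ccontr)
    assume "\<not> norm l < 1"
    then have l: "1 \<le> norm l" by simp
    then have l0: "l \<noteq> 0" by auto
    obtain v where v: "\<exists>i<n. v i \<noteq> 0" "\<And>i. i < n \<Longrightarrow> mat_app (cmat N) v i = l * v i"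
      using ev unfolding eigenvalue_iff_mat_app[OF cN] by auto
    have cmult: "cmat (B * C) = cmat B * cmat C" if "B \<in> carrier_mat n n" "C \<in> carrier_mat n n" for B C
      using of_real_hom.mat_hom_mult[OF that] .
    have scal: "mat_app B (\<lambda>j. l * v j) i = l * mat_app B v i" for B i
      by (simp add: mat_app_def sum_distrib_left mult_ac)
    have Qv: "mat_app (cmat Q) v i = v i" if i: "i < n" for i
    proof -
      have "l * v i = mat_app (cmat Q * cmat N) v i"
        using v(2)[OF i] QN cmult[OF Q N] by simp
      also have "\<dots> = mat_app (cmat Q) (mat_app (cmat N) v) i" by (rule mat_app_mult[OF cQ cN i])
      also have "\<dots> = mat_app (cmat Q) (\<lambda>j. l * v j) i"
        using v(2) Q by (intro mat_app_cong) auto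
      finally show ?thesis using l0 by (simp add: scal)
    qed
    have Mv: "mat_app (cmat M) v i = l * v i" if i: "i < n" for i
    proof -
      have "l * v i = mat_app (cmat M * cmat Q) v i"
        using v(2)[OF i] cmult[OF M Q] by (simp add: N_def)
      also have "\<dots> = mat_app (cmat M) (mat_app (cmat Q) v) i" by (rule mat_app_mult[OF cM cQ i])
      also have "\<dots> = mat_app (cmat M) v i" using Qv M by (intro mat_app_cong) auto
      finally show ?thesis ..
    qed
    have Pv: "mat_app (cmat ?P) v i = 0" if i: "i < n" for i
    proof -
      have "cmat Q $$ (i, j) * v j = 1\<^sub>m n $$ (i, j) * v j - cmat ?P $$ (i, j) * v j" if "j < n" for j
        using carrier_matD[OF P] i that by (simp add: Q_def left_diff_distrib)
      then have "mat_app (cmat Q) v i = mat_app (1\<^sub>m n) v i - mat_app (cmat ?P) v i"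
        using carrier_matD[OF P] carrier_matD[OF Q] by (simp add: mat_app_def sum_subtractf)
      then show ?thesis using Qv[OF i] i by (simp add: mat_app_one)
    qed
    have Xv: "mat_app (cmat X) v i = (of_real m * l) * v i" if i: "i < n" for i
    proof -
      have "mat_app (cmat M) v i = of_real (1 / m) * mat_app (cmat X) v i"
        using X i by (simp add: M_def mat_app_def sum_distrib_left mult_ac)
      then show ?thesis using Mv[OF i] m by (simp add: field_simps)
    qed
    have Av: "mat_app (cmat A) v i = (of_real m * l) ^ p * v i" if i: "i < n" for i
      using mat_app_pow_eigen[OF cX Xv i, of p] cmat_pow[OF X, of p] Xp by simp
    have mp: "m ^ p = \<rho>"
      using mat_app_pow_eigen[OF X Xx n, of p] Xp x(2)[OF n] x(1)[OF n] by simp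
    have nl: "norm ((of_real m * l) ^ p) = \<rho> * norm l ^ p"
      using m mp by (simp add: norm_mult norm_power power_mult_distrib)
    have "eigenvalue (cmat A) ((of_real m * l) ^ p)"
      using v(1) Av unfolding eigenvalue_iff_mat_app[OF cA] by blast
    from dominant[OF this] have "norm l ^ p \<le> 1" unfolding nl using rho by simp
    then have "norm l ^ p = 1" using one_le_power[OF l, of p] by simp
    then have "norm ((of_real m * l) ^ p) = \<rho>" using nl by simp
    with peripheral[OF v(1)] Av obtain c j where c: "c \<noteq> 0" "\<forall>i<n. v i = c * D i ^ j * of_real (x i)"
      by blast
    have "mat_app (cmat ?P) v 0 = v 0" by (rule mat_app_proj[OF _ n]) (use c in blast)
    then have "v 0 = 0" using Pv[OF n] by simp
    then show False using c x(1)[OF n] D0[OF n] n by simp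
  qed
  \<comment> \<open>A decay rate strictly between the spectral radius and 1.\<close>
  define r where "r = (1 + spectral_radius (cmat N)) / 2"
  have sr: "spectral_radius (cmat N) < 1" "0 \<le> spectral_radius (cmat N)"
    using spectral_radius_mem_max(1)[OF cN n] small by (auto simp: spectrum_def)
  have r: "0 < r" "r < 1" using sr by (auto simp: r_def)
  have "norm l < r" if "eigenvalue (cmat N) l" for l
    using eigenvalue_le_spectral_radius[OF cN n that] sr by (simp add: r_def)
  then obtain c where c: "\<forall>k i j. i < n \<longrightarrow> j < n \<longrightarrow> norm ((cmat N ^\<^sub>m k) $$ (i, j)) \<le> c * r ^ k"
    using powers_bounded_above_spectral_radius[OF cN r(1)] by blast
  have Nbound: "\<bar>(N ^\<^sub>m k) $$ (a, b)\<bar> \<le> c * r ^ k" if "a < n" "b < n" for a b k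
    using c[rule_format, OF that, of k] carrier_matD[OF pow_carrier_mat[OF N, of k]] that
    unfolding cmat_pow[OF N, symmetric] by (simp del: pow_mat_dim)
  have Mx: "mat_app M x i = 1 * x i" if "i < n" for i
  proof -
    have "mat_app M x i = 1 / m * mat_app X x i"
      using X that by (simp add: M_def mat_app_def sum_distrib_left mult_ac)
    then show ?thesis using Xx[OF that] m by simp
  qed
  have Msh: "D b = u * D a" if "a < n" "b < n" "M $$ (a, b) \<noteq> 0" for a b
    using sh[OF that(1,2)] that X by (simp add: M_def)
  have lower: "(M ^\<^sub>m Suc k) $$ (a, b) \<ge> x a * y b / ?S - c * r ^ Suc k"
    if ab: "a < n" "b < n" and Db: "D b = u ^ Suc k * D a" for a b k
  proof -
    have Mk: "M ^\<^sub>m Suc k \<in> carrier_mat n n" using M by (intro pow_carrier_mat)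
    have "M ^\<^sub>m Suc k * Q = M ^\<^sub>m Suc k + (-1) \<cdot>\<^sub>m (M ^\<^sub>m Suc k * ?P)"
      unfolding Q_def
      by (simp only: mult_add_distrib_mat[OF Mk one_carrier_mat mP] mult_smult_distrib[OF Mk P] right_mult_one_mat[OF Mk])
    then have "(N ^\<^sub>m Suc k) $$ (a, b) = (M ^\<^sub>m Suc k) $$ (a, b) - (M ^\<^sub>m Suc k * ?P) $$ (a, b)"
      unfolding Npow using ab carrier_matD[OF Mk] carrier_matD[OF P]
      by (simp del: pow_mat.simps pow_mat_dim)
    also have "(M ^\<^sub>m Suc k * ?P) $$ (a, b) = x a * y b / ?S"
      by (subst pow_mult_proj[OF M Msh Mx ab, where k = "Suc k"]) (use Db in \<open>auto simp del: power_Suc\<close>)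
    finally show ?thesis using Nbound[OF ab, of "Suc k"] by linarith
  qed
  have "\<forall>\<^sub>F k in sequentially. c * r ^ k < x a * y b / ?S" if "a < n" "b < n" for a b
  proof -
    have "(\<lambda>k. c * r ^ k) \<longlonglongrightarrow> c * 0"
      using r by (intro tendsto_mult_left LIMSEQ_power_zero) auto
    moreover have "c * 0 < x a * y b / ?S"
      using x(1)[OF that(1)] y(1)[OF that(2)] class_weight_pos by simp
    ultimately show ?thesis by (rule order_tendstoD(2))
  qed
  then have "\<forall>\<^sub>F k in sequentially. \<forall>ab\<in>{..<n} \<times> {..<n}. c * r ^ k < x (fst ab) * y (snd ab) / ?S"
    by (intro eventually_ball_finite) auto
  then obtain K where K: "\<And>k a b. K \<le> k \<Longrightarrow> a < n \<Longrightarrow> b < n \<Longrightarrow> c * r ^ k < x a * y b / ?S"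
    unfolding eventually_sequentially by force
  have "0 \<le> (X ^\<^sub>m k) $$ (a, b)" if k: "Suc K \<le> k" and ab: "a < n" "b < n" for k a b
  proof (cases "D b = u ^ k * D a")
    case True
    obtain k' where k': "k = Suc k'" "K \<le> k" using k by (cases k) auto
    have "0 < (M ^\<^sub>m k) $$ (a, b)"
      using lower[OF ab, of k'] True K[OF k'(2) ab] by (simp add: k'(1) del: pow_mat.simps power_Suc)
    also have "(M ^\<^sub>m k) $$ (a, b) = (1 / m) ^ k * (X ^\<^sub>m k) $$ (a, b)"
      unfolding M_def smult_pow_mat[OF X] using carrier_matD[OF pow_carrier_mat[OF X, of k]] ab
      by (simp del: pow_mat_dim)
    finally show ?thesis using m by (simp add: zero_less_mult_iff less_imp_le)
  next
    case False
    then have "(X ^\<^sub>m k) $$ (a, b) = 0" using shift_pow[OF X sh ab, of k] by blast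
    then show ?thesis by (rule eq_refl[OF sym])
  qed
  then show ?thesis
    unfolding eventually_nonneg_def entrywise_nonneg_def carrier_matD[OF pow_carrier_mat[OF X]]
    by (intro exI[of _ "Suc K"]) blast
qed

end

section \<open>The peripheral spectrum of an irreducible matrix\<close>

lemma transpose_pow_mat:
  fixes B :: "'a::comm_semiring_1 mat"
  assumes B: "B \<in> carrier_mat n n"
  shows "transpose_mat (B ^\<^sub>m k) = transpose_mat B ^\<^sub>m k"
proof (induction k)
  case 0
  then show ?case using B by simp
next
  case (Suc k)
  have "transpose_mat (B ^\<^sub>m Suc k) = transpose_mat (B * B ^\<^sub>m k)" by (simp only: pow_mat_Suc_left[OF B])
  also have "\<dots> = transpose_mat (B ^\<^sub>m k) * transpose_mat B"
    by (rule transpose_mult[OF B pow_carrier_mat[OF B]])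
  finally show ?case using Suc by simp
qed

lemma connecting_transpose:
  assumes A: "A \<in> carrier_mat n n" and N: "connecting A N"
  shows "connecting (transpose_mat A) N"
proof -
  let ?B = "1\<^sub>m n + A"
  have B: "?B \<in> carrier_mat n n" using A by auto
  have "transpose_mat ?B = 1\<^sub>m n + transpose_mat A" using A by (intro eq_matI) auto
  then have "(1\<^sub>m n + transpose_mat A) ^\<^sub>m N = transpose_mat (?B ^\<^sub>m N)"
    using transpose_pow_mat[OF B] by simp
  then show ?thesis using N A pow_carrier_mat[OF B, of N]
    unfolding connecting_def by (auto simp: carrier_matD)
qed

lemma roots_of_unity_powers:
  fixes w :: complex
  assumes h: "h > 0" and w: "w = cis (2 * pi / h)"
  shows "u ^ h = 1 \<longleftrightarrow> (\<exists>j. u = w ^ j)"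
proof
  assume "u ^ h = 1"
  then obtain k where "u = cis (2 * pi * real k / real h)"
    using bij_betw_roots_unity[OF h] by (auto simp: bij_betw_def)
  then have "u = w ^ k" by (simp add: w DeMoivre mult_ac)
  then show "\<exists>j. u = w ^ j" by blast
next
  assume "\<exists>j. u = w ^ j"
  then obtain j where "u = w ^ j" by blast
  then have "u ^ h = (w ^ h) ^ j" by (simp only: power_mult[symmetric] mult.commute)
  moreover have "w ^ h = 1" using h by (simp add: w DeMoivre)
  ultimately show "u ^ h = 1" by simp
qed

lemma invertible_row_nonzero:
  fixes A :: "'a::semiring_1 mat"
  assumes A: "A \<in> carrier_mat n n" and inv: "invertible_mat A" and i: "i < n"
  shows "\<exists>j<n. A $$ (i, j) \<noteq> 0"
proof (rule ccontr)
  assume "\<not> (\<exists>j<n. A $$ (i, j) \<noteq> 0)"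
  then have z: "A $$ (i, j) = 0" if "j < n" for j using that by blast
  obtain B where B: "A * B = 1\<^sub>m n" "B * A = 1\<^sub>m (dim_row B)"
    using inv A by (auto simp: invertible_mat_def inverts_mat_def)
  have "dim_col B = n" using B(1) by (metis index_mult_mat(3) index_one_mat(3))
  moreover have "dim_row B = n" using B(2) A by (metis index_mult_mat(3) index_one_mat(3) carrier_matD(2))
  ultimately have "(A * B) $$ (i, i) = 0"
    using A i z by (auto simp: scalar_prod_def intro!: sum.neutral)
  then show False using B(1) i by simp
qed

text \<open>The phases of \<open>v\<close> are multiplied by \<open>e = l/r\<close> along every arc, so
  \<open>e\<close> is a power \<open>w\<^sup>j\<close>. Dividing by \<open>D\<^sup>j\<close> turns
  \<open>v\<close> into an eigenvector \<open>f\<close> for \<open>r\<close> itself. The combination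
  \<open>g\<close> of \<open>f\<close> and \<open>x\<close> that vanishes at one index vanishes
  altogether, since a nonzero eigenvector for \<open>r\<close> has no zero entry.\<close>

lemma peripheral_eigenvector_form:
  fixes A :: "real mat"
  assumes A: "A \<in> carrier_mat n n" and nn: "entrywise_nonneg A" and irr: "irreducible_mat A"
    and N: "connecting A N" and r: "r = spectral_radius (cmat A)" "r > 0"
    and row: "\<exists>j. (0, j) \<in> arcs (mat_digraph A)"
    and h: "h = cyclic_index A" and cyc: "cyclic_mat h A"
    and w: "w = cis (2 * pi / h)"
    and D: "\<And>i. i < n \<Longrightarrow> D i ^ h = 1" "\<And>i j. (i, j) \<in> arcs (mat_digraph A) \<Longrightarrow> D j = w * D i"
    and x: "\<And>i. i < n \<Longrightarrow> 0 < x i" "\<And>i. i < n \<Longrightarrow> mat_app A x i = r * x i"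
    and v: "\<exists>i<n. v i \<noteq> 0" "\<And>i. i < n \<Longrightarrow> mat_app (cmat A) v i = l * v i" and l: "norm l = r"
  shows "\<exists>c j. c \<noteq> 0 \<and> (\<forall>i<n. v i = c * D i ^ j * of_real (x i))"
proof -
  have n: "n > 0" using irreducible_reachable(1)[OF irr] A by simp
  have h0: "h > 0" using cyc by (auto simp: cyclic_mat_def describes_cyclic_def)
  have D0: "D i \<noteq> 0" if "i < n" for i using D(1)[OF that] h0 by (auto simp: zero_power)
  have mod: "mat_app A (\<lambda>j. norm (v j)) i = r * norm (v i)" "0 < norm (v i)" if "i < n" for i
    using peripheral_modulus_eigen[OF A nn N r(1) v(1) _ l that] v(2) by blast+
  define e where "e = l / of_real r"
  define E where "E i = v i / of_real (norm (v i))" for i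
  have vE: "v i = E i * of_real (norm (v i))" for i by (simp add: E_def)
  have l_eq: "l = of_real r * e" using r by (simp add: e_def)
  have phase: "E j = e * E i" if ij: "(i, j) \<in> arcs (mat_digraph A)" for i j
  proof (rule phase_alignment[OF A nn mod(2,1)])
    show "norm (E i) = 1" if "i < n" for i using mod(2)[OF that] by (simp add: E_def norm_divide)
    show "norm e = 1" using l r(2) by (simp add: e_def norm_divide)
    show "mat_app (cmat A) (\<lambda>j. E j * of_real (norm (v j))) i = of_real r * e * (E i * of_real (norm (v i)))"
      if "i < n" for i
      using v(2)[OF that] unfolding l_eq by (simp only: vE[symmetric])
  qed (use ij A in \<open>auto simp: mat_digraph_arcs\<close>)
  have E0: "E 0 \<noteq> 0" using mod(2)[OF n] by (simp add: E_def)
  have "e ^ h = 1" by (rule cyclic_index_phase[where E = E and e = e, OF A irr row h cyc phase E0])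
  then obtain j where j: "e = w ^ j" using roots_of_unity_powers[OF h0 w] by blast
  define f where "f i = v i / D i ^ j" for i
  have cA: "cmat A \<in> carrier_mat n n" using A by simp
  have f: "mat_app (cmat A) f i = of_real r * f i" if i: "i < n" for i
  proof -
    have entry: "cmat A $$ (i, k) * f k = cmat A $$ (i, k) * v k / (e * D i ^ j)" if k: "k < n" for k
    proof (cases "A $$ (i, k) = 0")
      case False
      then have "D k = w * D i" using D(2)[of i k] i k A by (simp add: mat_digraph_arcs)
      then show ?thesis by (simp add: f_def j power_mult_distrib)
    qed (use i k A in simp)
    have e0: "e \<noteq> 0" using l r(2) by (auto simp: e_def)
    have "mat_app (cmat A) f i = mat_app (cmat A) v i / (e * D i ^ j)"
      unfolding mat_app_def sum_divide_distrib using cA entry by (intro sum.cong) auto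
    then show ?thesis unfolding v(2)[OF i] l_eq f_def using e0 D0[OF i] by (simp add: field_simps)
  qed
  define c where "c = f 0 / of_real (x 0)"
  define g where "g i = f i - c * of_real (x i)" for i
  have g: "mat_app (cmat A) g i = of_real r * g i" if i: "i < n" for i
  proof -
    have "mat_app (cmat A) g i = mat_app (cmat A) f i - c * mat_app (cmat A) (\<lambda>j. of_real (x j)) i"
      by (simp add: mat_app_def g_def sum_subtractf sum_distrib_left algebra_simps)
    also have "mat_app (cmat A) (\<lambda>j. complex_of_real (x j)) i = of_real (r * x i)"
      using mat_app_cmat_of_real[of i A x] i A x(2)[OF i] by simp
    also have "mat_app (cmat A) f i - c * of_real (r * x i) = of_real r * g i"
      unfolding f[OF i] by (simp add: g_def algebra_simps)
    finally show ?thesis .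
  qed
  have g0: "g 0 = 0" using x(1)[OF n] by (simp add: g_def c_def)
  have "g i = 0" if "i < n" for i
  proof (rule ccontr)
    assume "g i \<noteq> 0"
    then have ex: "\<exists>i<n. g i \<noteq> 0" using that by blast
    have "0 < norm (g 0)"
      by (rule peripheral_modulus_eigen(2)[OF A nn N r(1) ex g _ n]) (use r(2) in auto)
    then show False using g0 by simp
  qed
  then have fx: "v i / D i ^ j = c * of_real (x i)" if "i < n" for i
    using that by (simp add: g_def f_def)
  have vform: "v i = c * D i ^ j * of_real (x i)" if "i < n" for i
  proof -
    have "D i ^ j \<noteq> 0" using D0[OF that] by simp
    then have "v i = (v i / D i ^ j) * D i ^ j" by simp
    then show ?thesis unfolding fx[OF that] by (simp add: mult_ac)
  qed
  then have "c \<noteq> 0" using v(1) by auto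
  with vform show ?thesis by blast
qed

text \<open>The left Perron vector is the right one of the transpose; the two eigenvalues agree because both
  are read off from the same bilinear form.\<close>

lemma cyclic_perron_exists:
  fixes A :: "real mat"
  assumes A: "A \<in> carrier_mat n n" and nn: "entrywise_nonneg A" and inv: "invertible_mat A"
    and irr: "irreducible_mat A" and h: "h = cyclic_index A" and cyc: "describes_cyclic h Ps A"
    and w: "w = cis (2 * pi / h)"
  shows "\<exists>D \<rho> x y. cyclic_perron A n h w D \<rho> x y"
proof -
  have n: "n > 0" using irreducible_reachable(1)[OF irr] A by simp
  have h0: "h > 0" using cyc by (auto simp: describes_cyclic_def)
  note roots = roots_of_unity_powers[OF h0 w]
  have wh: "w ^ h = 1" using roots[of w] by (metis power_one_right)
  obtain D where D: "\<forall>i<n. D i ^ h = 1" "\<forall>i j. (i, j) \<in> arcs (mat_digraph A) \<longrightarrow> D j = w * D i"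
    using describes_cyclic_phase[OF A cyc wh] by blast
  obtain N where N: "connecting A N" using irreducible_connecting[OF A nn irr] by blast
  define r where "r = spectral_radius (cmat A)"
  obtain x where x: "\<And>i. i < n \<Longrightarrow> 0 < x i" "\<And>i. i < n \<Longrightarrow> mat_app A x i = r * x i"
    using perron_eigenvector_exists[OF A n nn N r_def] by blast
  let ?T = "transpose_mat A"
  have T: "?T \<in> carrier_mat n n" using A by simp
  have nnT: "entrywise_nonneg ?T" using nn A by (auto simp: entrywise_nonneg_def)
  obtain y where y: "\<And>i. i < n \<Longrightarrow> 0 < y i"
      "\<And>i. i < n \<Longrightarrow> mat_app ?T y i = spectral_radius (cmat ?T) * y i"
    using perron_eigenvector_exists[OF T n nnT connecting_transpose[OF A N] refl] by blast
  have "r * (\<Sum>i<n. y i * x i) = (\<Sum>i<n. y i * mat_app A x i)"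
    using x(2) by (simp add: sum_distrib_left mult_ac)
  also have "\<dots> = (\<Sum>j<n. x j * mat_app ?T y j)"
    using A by (simp add: mat_app_def sum_distrib_left mult_ac) (subst sum.swap, simp add: mult_ac)
  also have "\<dots> = spectral_radius (cmat ?T) * (\<Sum>i<n. y i * x i)"
    using y(2) by (simp add: sum_distrib_left mult_ac)
  finally have eq: "r * (\<Sum>i<n. y i * x i) = spectral_radius (cmat ?T) * (\<Sum>i<n. y i * x i)" .
  have "0 < (\<Sum>i<n. y i * x i)" using n x(1) y(1) by (intro sum_pos) auto
  then have "spectral_radius (cmat ?T) = r" using eq by (metis less_irrefl mult_right_cancel)
  then have y2: "mat_app ?T y i = r * y i" if "i < n" for i using y(2)[OF that] by simp
  obtain k where k: "k < n" "A $$ (0, k) \<noteq> 0" using invertible_row_nonzero[OF A inv n] by blast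
  have "0 < A $$ (0, k) * x k" using k x(1) nn A n by (auto simp: entrywise_nonneg_def less_le)
  also have "\<dots> \<le> mat_app A x 0"
    unfolding mat_app_def using k x(1) nn A n
    by (intro member_le_sum) (auto simp: entrywise_nonneg_def less_imp_le)
  finally have r: "r > 0" using x(2)[OF n] x(1)[OF n] by (simp add: zero_less_mult_iff)
  have row: "\<exists>j. (0, j) \<in> arcs (mat_digraph A)" using k A n by (auto simp: mat_digraph_arcs)
  have cyc': "cyclic_mat h A" using cyc by (auto simp: cyclic_mat_def)
  have cA: "cmat A \<in> carrier_mat n n" using A by simp
  have "cyclic_perron A n h w D r x y"
  proof
    show "\<exists>c j. c \<noteq> 0 \<and> (\<forall>i<n. v i = c * D i ^ j * complex_of_real (x i))"
      if "\<exists>i<n. v i \<noteq> 0" "\<forall>i<n. mat_app (cmat A) v i = l * v i" "norm l = r" for l v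
      using peripheral_eigenvector_form[OF A nn irr N r_def r row h cyc' w _ _ x that(1) _ that(3)] D that(2)
      by blast
    show "norm l \<le> r" if "eigenvalue (cmat A) l" for l
      unfolding r_def by (rule eigenvalue_le_spectral_radius[OF cA n that])
    show "D j = w * D i" if "i < n" "j < n" "A $$ (i, j) \<noteq> 0" for i j
      using D(2) that A by (simp add: mat_digraph_arcs)
  qed (use A nn n h0 roots D r x y y2 in auto)
  then show ?thesis by blast
qed

section \<open>Eventually nonnegative roots as choices of branches\<close>

interpretation cnj_hom: semiring_hom cnj
  by unfold_locales auto

lemma mat_app_vec:
  assumes "B \<in> carrier_mat n n" "i < n"
  shows "mat_app B v i = (B *\<^sub>v vec n v) $ i"
  using assms by (simp add: mat_app_def scalar_prod_def atLeast0LessThan)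

text \<open>On an eigenvector, \<open>q(B)\<close> acts as the number \<open>q(l)\<close>. All information
  about the branch function of a root is extracted this way.\<close>

lemma mat_app_mat_poly:
  fixes B :: "'a::field mat"
  assumes B: "B \<in> carrier_mat n n" and v: "\<And>i. i < n \<Longrightarrow> mat_app B v i = l * v i" and i: "i < n"
  shows "mat_app (mat_poly q B) v i = poly q l * v i"
proof -
  have "B *\<^sub>v vec n v = l \<cdot>\<^sub>v vec n v"
    using B v by (intro eq_vecI) (auto simp: mat_app_vec[OF B, symmetric] simp del: index_mult_mat_vec)
  then have "mat_poly q B *\<^sub>v vec n v = poly q l \<cdot>\<^sub>v vec n v"
    by (intro mat_poly_eigenvector[OF B]) auto
  then show ?thesis using i by (simp add: mat_app_vec[OF mat_poly_carrier[OF B] i] del: index_mult_mat_vec)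
qed

lemma transpose_mat_poly:
  fixes B :: "'a::comm_ring_1 mat"
  assumes B: "B \<in> carrier_mat n n"
  shows "transpose_mat (mat_poly q B) = mat_poly q (transpose_mat B)"
proof (rule eq_matI)
  have T: "transpose_mat B \<in> carrier_mat n n" using B by simp
  fix i j assume "i < dim_row (mat_poly q (transpose_mat B))" "j < dim_col (mat_poly q (transpose_mat B))"
  then have ij: "i < n" "j < n" using B by auto
  have "(transpose_mat B ^\<^sub>m k) $$ (i, j) = (B ^\<^sub>m k) $$ (j, i)" for k
    using transpose_pow_mat[OF B, of k, symmetric] ij carrier_matD[OF pow_carrier_mat[OF B, of k]]
    by (simp del: pow_mat_dim)
  then show "transpose_mat (mat_poly q B) $$ (i, j) = mat_poly q (transpose_mat B) $$ (i, j)"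
    using mat_poly_index[OF T ij order_refl, of q] mat_poly_index[OF B ij(2,1) order_refl, of q] ij B by simp
qed (use B in auto)

lemma cnj_mat_poly:
  assumes A: "A \<in> carrier_mat n n"
  shows "map_mat cnj (mat_poly q (cmat A)) = mat_poly (map_poly cnj q) (cmat A)"
proof (rule eq_matI)
  have B: "cmat A \<in> carrier_mat n n" using A by simp
  fix i j assume "i < dim_row (mat_poly (map_poly cnj q) (cmat A))" "j < dim_col (mat_poly (map_poly cnj q) (cmat A))"
  then have ij: "i < n" "j < n" using A by auto
  have real: "cnj ((cmat A ^\<^sub>m k) $$ (i, j)) = (cmat A ^\<^sub>m k) $$ (i, j)" for k
    unfolding cmat_pow[OF A, symmetric] using ij carrier_matD[OF pow_carrier_mat[OF A, of k]]
    by (simp del: pow_mat_dim)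
  have deg: "degree (map_poly cnj q) \<le> degree q" by (simp add: degree_map_poly_le)
  show "map_mat cnj (mat_poly q (cmat A)) $$ (i, j) = mat_poly (map_poly cnj q) (cmat A) $$ (i, j)"
    using mat_poly_index[OF B ij order_refl, of q] mat_poly_index[OF B ij deg] ij A
    by (simp add: coeff_map_poly real)
qed (use A in auto)

lemma mat_app_cnj:
  assumes "i < dim_row X"
  shows "mat_app (cmat X) (\<lambda>j. cnj (v j)) i = cnj (mat_app (cmat X) v i)"
  using assms by (simp add: mat_app_def)

lemma pcompose_power: "pcompose (p ^ k) q = pcompose p q ^ k"
  by (induction k) (simp_all add: pcompose_mult pcompose_1)

lemma cmat_inj:
  assumes "X \<in> carrier_mat n n" "Y \<in> carrier_mat n n" "cmat X = cmat Y"
  shows "X = Y"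
proof (rule eq_matI)
  fix i j assume "i < dim_row Y" "j < dim_col Y"
  then show "X $$ (i, j) = Y $$ (i, j)"
    using arg_cong[OF assms(3), of "\<lambda>M. M $$ (i, j)"] assms(1,2) by simp
qed (use assms in auto)

text \<open>The coprimality of \<open>h\<close> and \<open>p\<close> enters only through the exponent
  \<open>s\<close>.\<close>

locale cyclic_perron_root = cyclic_perron +
  fixes p s :: nat
  assumes p: "p > 0" and sp: "\<And>u :: complex. u ^ h = 1 \<Longrightarrow> u ^ (s * p) = u"
    and inv: "0 \<notin> spectrum (cmat A)"
begin

lemma cA: "cmat A \<in> carrier_mat n n"
  using A by simp

lemma spectrum_iff: "l \<in> spectrum (cmat A) \<longleftrightarrow> (\<exists>v. (\<exists>i<n. v i \<noteq> 0) \<and> (\<forall>i<n. mat_app (cmat A) v i = l * v i))"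
  unfolding spectrum_def using eigenvalue_iff_mat_app[OF cA] by simp

lemma cnj_eigenvector:
  assumes "\<And>i. i < n \<Longrightarrow> mat_app (cmat A) v i = l * v i" "i < n"
  shows "mat_app (cmat A) (\<lambda>j. cnj (v j)) i = cnj l * cnj (v i)"
  using mat_app_cnj[of i A v] assms A by simp

lemma shift_app:
  assumes Y: "Y \<in> carrier_mat n n"
    and sh: "\<And>a b. a < n \<Longrightarrow> b < n \<Longrightarrow> Y $$ (a, b) \<noteq> 0 \<Longrightarrow> D b = u * D a" and i: "i < n"
  shows "mat_app (cmat Y) (\<lambda>j. D j * v j) i = u * D i * mat_app (cmat Y) v i"
proof -
  have "cmat Y $$ (i, j) * (D j * v j) = u * D i * (cmat Y $$ (i, j) * v j)" if "j < n" for j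
    using sh[OF i that] Y i that by (cases "Y $$ (i, j) = 0") auto
  then show ?thesis unfolding mat_app_def sum_distrib_left using Y by (intro sum.cong) auto
qed

lemma rot_eigenvector:
  assumes "\<And>i. i < n \<Longrightarrow> mat_app (cmat A) v i = l * v i" "i < n"
  shows "mat_app (cmat A) (\<lambda>j. D j * v j) i = w * l * (D i * v i)"
  using shift_app[OF A arc, of i v] assms by simp

lemma x_eigenvector: "i < n \<Longrightarrow> mat_app (cmat A) (\<lambda>j. of_real (x j)) i = of_real \<rho> * of_real (x i)"
  using mat_app_cmat_of_real[of i A x] x(2)[of i] A by simp

lemma spectrum_cnj: "l \<in> spectrum (cmat A) \<Longrightarrow> cnj l \<in> spectrum (cmat A)"
proof -
  assume "l \<in> spectrum (cmat A)"
  then obtain v where v: "\<exists>i<n. v i \<noteq> 0" "\<And>i. i < n \<Longrightarrow> mat_app (cmat A) v i = l * v i"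
    unfolding spectrum_iff by blast
  show ?thesis unfolding spectrum_iff
    using v(1) cnj_eigenvector[OF v(2)] by (intro exI[of _ "\<lambda>j. cnj (v j)"]) auto
qed

lemma spectrum_rot1: "l \<in> spectrum (cmat A) \<Longrightarrow> w * l \<in> spectrum (cmat A)"
proof -
  assume "l \<in> spectrum (cmat A)"
  then obtain v where v: "\<exists>i<n. v i \<noteq> 0" "\<And>i. i < n \<Longrightarrow> mat_app (cmat A) v i = l * v i"
    unfolding spectrum_iff by blast
  show ?thesis unfolding spectrum_iff
    using v(1) rot_eigenvector[OF v(2)] D0 by (intro exI[of _ "\<lambda>j. D j * v j"]) auto
qed

lemma spectrum_rot_power: "l \<in> spectrum (cmat A) \<Longrightarrow> w ^ j * l \<in> spectrum (cmat A)"
  by (induction j) (auto dest: spectrum_rot1 simp: mult.assoc)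

sublocale br: root_branches h s p "spectrum (cmat A)" "of_real \<rho>"
proof
  show "u * l \<in> spectrum (cmat A)" if "l \<in> spectrum (cmat A)" "u ^ h = 1" for l u
  proof -
    obtain j where "u = w ^ j" using roots \<open>u ^ h = 1\<close> by blast
    then show ?thesis using spectrum_rot_power[OF that(1)] by simp
  qed
  show "complex_of_real \<rho> \<in> spectrum (cmat A)"
    unfolding spectrum_iff using x_eigenvector x(1)[OF n] n by (intro exI[of _ "\<lambda>j. of_real (x j)"]) auto
  show "complex_of_real \<rho> \<in> pos_reals" using rho by (simp add: pos_reals_def)
  show "finite (spectrum (cmat A))" using card_finite_spectrum[OF cA] by simp
qed (use h p sp inv spectrum_cnj in auto)

lemma poly_value_unique:
  assumes "mat_poly q (cmat A) = mat_poly q' (cmat A)" "l \<in> spectrum (cmat A)"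
  shows "poly q l = poly q' l"
proof -
  obtain v where v: "\<exists>i<n. v i \<noteq> 0" "\<And>i. i < n \<Longrightarrow> mat_app (cmat A) v i = l * v i"
    using assms(2) unfolding spectrum_iff by blast
  then obtain i where i: "i < n" "v i \<noteq> 0" by blast
  have a: "mat_app (mat_poly q (cmat A)) v i = poly q l * v i"
    by (rule mat_app_mat_poly[OF cA v(2) i(1)])
  have b: "mat_app (mat_poly q (cmat A)) v i = poly q' l * v i"
    unfolding assms(1) by (rule mat_app_mat_poly[OF cA v(2) i(1)])
  show ?thesis using trans[OF a[symmetric] b] i(2) by simp
qed

context
  fixes X :: "real mat" and q :: "complex poly"
  assumes X: "X \<in> carrier_mat n n" and Xp: "X ^\<^sub>m p = A" and Xq: "cmat X = mat_poly q (cmat A)"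
    and en: "eventually_nonneg X"
begin

lemma root_app:
  assumes "\<And>i. i < n \<Longrightarrow> mat_app (cmat A) v i = l * v i" "i < n"
  shows "mat_app (cmat X) v i = poly q l * v i"
  unfolding Xq by (rule mat_app_mat_poly[OF cA assms])

lemma root_pow_app:
  assumes "\<And>i. i < n \<Longrightarrow> mat_app (cmat A) v i = l * v i" "i < n"
  shows "mat_app (cmat (X ^\<^sub>m k)) v i = poly q l ^ k * v i"
  unfolding cmat_pow[OF X] by (rule mat_app_pow_eigen[OF _ root_app[OF assms(1)] assms(2)]) (use X in simp)

lemma root_value_pow:
  assumes "l \<in> spectrum (cmat A)" shows "poly q l ^ p = l"
proof -
  obtain v where v: "\<exists>i<n. v i \<noteq> 0" "\<And>i. i < n \<Longrightarrow> mat_app (cmat A) v i = l * v i"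
    using assms unfolding spectrum_iff by blast
  then obtain i where i: "i < n" "v i \<noteq> 0" by blast
  show ?thesis using root_pow_app[OF v(2) i(1), of p] v(2)[OF i(1)] i(2) Xp by simp
qed

lemma root_value_cnj:
  assumes "l \<in> spectrum (cmat A)" shows "poly q (cnj l) = cnj (poly q l)"
proof -
  obtain v where v: "\<exists>i<n. v i \<noteq> 0" "\<And>i. i < n \<Longrightarrow> mat_app (cmat A) v i = l * v i"
    using assms unfolding spectrum_iff by blast
  then obtain i where i: "i < n" "v i \<noteq> 0" by blast
  have a: "mat_app (cmat X) (\<lambda>j. cnj (v j)) i = poly q (cnj l) * cnj (v i)"
    by (rule root_app[OF cnj_eigenvector[OF v(2)] i(1)])
  have b: "mat_app (cmat X) (\<lambda>j. cnj (v j)) i = cnj (poly q l) * cnj (v i)"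
    using mat_app_cnj[of i X v] root_app[OF v(2) i(1)] X i(1) by simp
  show ?thesis using trans[OF a[symmetric] b] i(2) by simp
qed

text \<open>A power of \<open>X\<close> that is nonnegative maps the positive vector \<open>x\<close> to a
  nonnegative one; an odd exponent then decides the sign of \<open>m\<close>.\<close>

lemma root_value_rho: "\<exists>m>0. poly q (of_real \<rho>) = of_real m \<and> m ^ p = \<rho>"
proof -
  have "cnj (poly q (of_real \<rho>)) = poly q (of_real \<rho>)"
    using root_value_cnj[OF br.rho(1)] by simp
  then obtain m where m: "poly q (of_real \<rho>) = of_real m" by (metis Reals_cases Reals_cnj_iff)
  have "complex_of_real (m ^ p) = of_real \<rho>" using root_value_pow[OF br.rho(1)] m by simp
  then have mp: "m ^ p = \<rho>" using of_real_eq_iff by blast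
  obtain k0 where k0: "\<And>k. k0 \<le> k \<Longrightarrow> entrywise_nonneg (X ^\<^sub>m k)"
    using en by (auto simp: eventually_nonneg_def)
  \<comment> \<open>Any odd exponent from \<open>k0\<close> on will do.\<close>
  define k where "k = 2 * k0 + 1"
  have Y: "X ^\<^sub>m k \<in> carrier_mat n n" using X by simp
  have "complex_of_real (mat_app (X ^\<^sub>m k) x 0) = of_real (m ^ k * x 0)"
    using root_pow_app[OF x_eigenvector n, of k] mat_app_cmat_of_real[of 0 "X ^\<^sub>m k" x] n m carrier_matD[OF Y]
    by simp
  then have "mat_app (X ^\<^sub>m k) x 0 = m ^ k * x 0" using of_real_eq_iff by blast
  moreover have "0 \<le> mat_app (X ^\<^sub>m k) x 0"
  proof -
    have "entrywise_nonneg (X ^\<^sub>m k)" by (rule k0) (simp add: k_def)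
    then show ?thesis unfolding mat_app_def entrywise_nonneg_def carrier_matD[OF Y]
      using x(1) n by (intro sum_nonneg mult_nonneg_nonneg) (auto intro: less_imp_le)
  qed
  ultimately have "0 \<le> m ^ k" using x(1)[OF n] by (simp add: zero_le_mult_iff)
  moreover have "odd k" by (simp add: k_def)
  ultimately have "0 \<le> m" using zero_le_odd_power by blast
  moreover have "m \<noteq> 0" using mp rho p by (auto simp: zero_power)
  ultimately show ?thesis using m mp by auto
qed

text \<open>The eigenvectors \<open>x\<close> and \<open>D x\<close> of a nonnegative power
  \<open>X\<^sup>k\<close> have eigenvalues of equal modulus, so the phases align with a factor
  \<open>e\<^sup>k\<close>. The comparison of the exponents \<open>k\<^sub>0\<close> and
  \<open>k\<^sub>0 + 1\<close> removes the power: first in \<open>e\<^sup>h = 1\<close>, then in the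
  eigenvalue relation for an arbitrary eigenvector.\<close>

lemma root_value_rot:
  assumes u: "u ^ h = 1" and l: "l \<in> spectrum (cmat A)"
  shows "poly q (u * l) = u ^ s * poly q l"
proof -
  obtain m where m: "m > 0" "poly q (of_real \<rho>) = of_real m" "m ^ p = \<rho>" using root_value_rho by blast
  obtain k0 where k0: "\<And>k. k0 \<le> k \<Longrightarrow> entrywise_nonneg (X ^\<^sub>m k)"
    using en by (auto simp: eventually_nonneg_def)
  define t where "t = poly q (w * of_real \<rho>)"
  define e where "e = t / of_real m"
  have tp: "t ^ p = w * of_real \<rho>"
    unfolding t_def by (rule root_value_pow[OF spectrum_rot1[OF br.rho(1)]])
  then have "norm t ^ p = m ^ p" using w_norm rho m(3) by (simp flip: norm_power add: norm_mult)
  then have nt: "norm t = m" using p m(1) by (simp add: power_eq_iff_eq_base)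
  have te: "t = of_real m * e" using m(1) by (simp add: e_def)
  have ne: "norm e = 1" using nt m(1) by (simp add: e_def norm_divide)
  have e0: "e \<noteq> 0" using ne by auto
  have shift: "D j = e ^ k * D i"
    if k: "k0 \<le> k" and ij: "i < n" "j < n" "(X ^\<^sub>m k) $$ (i, j) \<noteq> 0" for i j k
  proof (rule phase_alignment[OF _ k0[OF k], where x = x and m = "m ^ k"])
    show Y: "X ^\<^sub>m k \<in> carrier_mat n n" using X by simp
    show "mat_app (X ^\<^sub>m k) x i = m ^ k * x i" if "i < n" for i
    proof -
      have "complex_of_real (mat_app (X ^\<^sub>m k) x i) = of_real (m ^ k * x i)"
        using root_pow_app[OF x_eigenvector that, of k] mat_app_cmat_of_real[of i "X ^\<^sub>m k" x] that m
          carrier_matD[OF Y] by simp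
      then show ?thesis using of_real_eq_iff by blast
    qed
    show "mat_app (cmat (X ^\<^sub>m k)) (\<lambda>j. D j * of_real (x j)) i
        = of_real (m ^ k) * e ^ k * (D i * of_real (x i))" if "i < n" for i
      using root_pow_app[OF rot_eigenvector[OF x_eigenvector] that, of k]
      by (simp add: t_def[symmetric] te power_mult_distrib)
    show "norm (e ^ k) = 1" using ne by (simp add: norm_power)
  qed (use x(1) D_norm ij in auto)
  have ek: "(e ^ k) ^ h = 1" if k: "k0 \<le> k" for k
  proof -
    have Y: "X ^\<^sub>m k \<in> carrier_mat n n" using X by simp
    have "complex_of_real (mat_app (X ^\<^sub>m k) x 0) = of_real (m ^ k * x 0)"
      using root_pow_app[OF x_eigenvector n, of k] mat_app_cmat_of_real[of 0 "X ^\<^sub>m k" x] n m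
        carrier_matD[OF Y] by simp
    then have "mat_app (X ^\<^sub>m k) x 0 = m ^ k * x 0" using of_real_eq_iff by blast
    moreover have "m ^ k * x 0 > 0" using m(1) x(1)[OF n] by simp
    ultimately have "mat_app (X ^\<^sub>m k) x 0 \<noteq> 0" by linarith
    then have nz: "(\<Sum>j<n. (X ^\<^sub>m k) $$ (0, j) * x j) \<noteq> 0"
      unfolding mat_app_def carrier_matD(2)[OF Y] .
    obtain j where "j \<in> {..<n}" and j0: "(X ^\<^sub>m k) $$ (0, j) * x j \<noteq> 0"
      by (rule sum.not_neutral_contains_not_neutral[OF nz])
    then have j: "j < n" "(X ^\<^sub>m k) $$ (0, j) \<noteq> 0" by auto
    have "D j = e ^ k * D 0" by (intro shift[OF k n j])
    then have "D j ^ h = (e ^ k) ^ h * D 0 ^ h" by (simp add: power_mult_distrib)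
    then show ?thesis using D[OF n] D[OF j(1)] by simp
  qed
  have eh: "e ^ h = 1"
  proof -
    have "(e ^ Suc k0) ^ h = (e ^ k0) ^ h * e ^ h" by (simp add: power_mult_distrib)
    then show ?thesis using ek[of "Suc k0"] ek[of k0] by simp
  qed
  have ep: "e ^ p = w" using tp m rho by (simp add: e_def power_divide flip: of_real_power)
  have es: "e = w ^ s" using sp[OF eh] ep by (metis power_mult mult.commute)
  have step: "poly q (w * l) = w ^ s * poly q l" if l: "l \<in> spectrum (cmat A)" for l
  proof -
    obtain v where v: "\<exists>i<n. v i \<noteq> 0" "\<And>i. i < n \<Longrightarrow> mat_app (cmat A) v i = l * v i"
      using l unfolding spectrum_iff by blast
    then obtain i where i: "i < n" "v i \<noteq> 0" by blast
    define a where "a = poly q (w * l)"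
    define b where "b = e * poly q l"
    have pw: "a ^ k = b ^ k" if k: "k0 \<le> k" for k
    proof -
      have Y: "X ^\<^sub>m k \<in> carrier_mat n n" using X by simp
      have "a ^ k * (D i * v i) = mat_app (cmat (X ^\<^sub>m k)) (\<lambda>j. D j * v j) i"
        unfolding a_def using root_pow_app[OF rot_eigenvector[OF v(2)] i(1), of k] by simp
      also have "\<dots> = e ^ k * D i * mat_app (cmat (X ^\<^sub>m k)) v i"
        by (rule shift_app[OF Y shift[OF k] i(1)])
      also have "\<dots> = b ^ k * (D i * v i)"
        using root_pow_app[OF v(2) i(1), of k] by (simp add: b_def power_mult_distrib)
      finally show ?thesis using i(2) D0[OF i(1)] by simp
    qed
    have "poly q l \<noteq> 0" using root_value_pow[OF l] l inv p by (auto simp: zero_power)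
    then have b0: "b ^ k0 \<noteq> 0" using e0 by (simp add: b_def)
    have "b ^ k0 * a = b ^ k0 * b" using pw[of k0] pw[of "Suc k0"] by (simp add: mult.commute)
    then have "a = b" using b0 by (metis mult_left_cancel)
    then show ?thesis by (simp add: a_def b_def es)
  qed
  obtain j where j: "u = w ^ j" using roots u by blast
  have "poly q (w ^ j * l) = (w ^ s) ^ j * poly q l"
  proof (induction j)
    case (Suc j)
    have "poly q (w ^ Suc j * l) = poly q (w * (w ^ j * l))" by (simp add: mult.assoc)
    also have "\<dots> = w ^ s * poly q (w ^ j * l)" by (rule step[OF spectrum_rot_power[OF l]])
    finally show ?case using Suc by simp
  qed simp
  then show ?thesis unfolding j by (simp only: power_mult[symmetric] mult.commute)
qed

lemma root_values_admissible: "restrict (poly q) (spectrum (cmat A)) \<in> br.admissible"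
proof -
  obtain m where "m > 0" "poly q (of_real \<rho>) = of_real m" using root_value_rho by blast
  then have "poly q (of_real \<rho>) \<in> pos_reals" by (auto simp: pos_reals_def)
  then show ?thesis
    using root_value_pow root_value_cnj root_value_rot br.cnj_closed br.rot_closed br.rho(1)
    by (auto simp: br.admissible_def)
qed

end

text \<open>Both symmetries of \<open>g\<close> become identities between matrices by uniqueness of primary
  roots. The conjugate of \<open>q(A)\<close> is a root of \<open>A\<close> with the same values on
  the spectrum. For the rotation, \<open>q(w A)\<close> and \<open>w\<^sup>s q(A)\<close> are
  polynomials in \<open>A\<close> whose \<open>p\<close>-th powers both equal \<open>w A\<close>,
  and \<open>q(w A)\<close> has the entries \<open>D\<^sub>b/D\<^sub>a\<close> times those of
  \<open>q(A)\<close>.\<close>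

lemma admissible_root_exists:
  assumes g: "g \<in> br.admissible"
  shows "\<exists>X q. X \<in> carrier_mat n n \<and> X ^\<^sub>m p = A \<and> cmat X = mat_poly q (cmat A)
    \<and> eventually_nonneg X \<and> (\<forall>l\<in>spectrum (cmat A). poly q l = g l)"
proof -
  let ?B = "cmat A" and ?\<sigma> = "spectrum (cmat A)"
  have gp: "g l ^ p = l" and gc: "g (cnj l) = cnj (g l)"
    and gr: "u ^ h = 1 \<Longrightarrow> g (u * l) = u ^ s * g l" if "l \<in> ?\<sigma>" for l u
    using g that by (auto simp: br.admissible_def)
  have grho: "g (of_real \<rho>) \<in> pos_reals" using g by (auto simp: br.admissible_def)
  obtain q where q: "\<forall>l\<in>?\<sigma>. poly q l = g l" "mat_poly q ?B ^\<^sub>m p = ?B"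
    using primary_root_exists[OF cA p inv, of g] gp by blast
  define Z where "Z = mat_poly q ?B"
  have Z: "Z \<in> carrier_mat n n" using cA by (simp add: Z_def)
  have g0: "g l \<noteq> 0" if "l \<in> ?\<sigma>" for l using gp[OF that] that inv p by (auto simp: zero_power)
  have "mat_poly (map_poly cnj q) ?B = mat_poly q ?B"
  proof (rule mat_poly_root_unique[OF cA p])
    show "poly (map_poly cnj q) l = poly q l" if "l \<in> ?\<sigma>" for l
      using poly_cnj[of q "cnj l"] gc[OF that] q(1) that spectrum_cnj[OF that] by simp
    show "poly q l \<noteq> 0" if "l \<in> ?\<sigma>" for l using g0 q(1) that by simp
    have "map_mat cnj Z ^\<^sub>m p = map_mat cnj (Z ^\<^sub>m p)" by (rule cnj_hom.mat_hom_pow[OF Z, symmetric])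
    also have "\<dots> = ?B" unfolding Z_def q(2) using A by (intro eq_matI) auto
    finally show "mat_poly (map_poly cnj q) ?B ^\<^sub>m p = mat_poly q ?B ^\<^sub>m p"
      unfolding cnj_mat_poly[OF A, symmetric] q(2) Z_def .
  qed
  then have cnjZ: "map_mat cnj Z = Z" unfolding cnj_mat_poly[OF A, symmetric] Z_def .
  define X where "X = map_mat Re Z"
  have X: "X \<in> carrier_mat n n" using Z by (simp add: X_def)
  have XZ: "cmat X = Z"
  proof (rule eq_matI)
    fix i j assume ij: "i < dim_row Z" "j < dim_col Z"
    have "cnj (Z $$ (i, j)) = Z $$ (i, j)" using arg_cong[OF cnjZ, of "\<lambda>M. M $$ (i, j)"] ij by simp
    then show "cmat X $$ (i, j) = Z $$ (i, j)"
      using ij by (simp add: X_def complex_eq_iff)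
  qed (auto simp: X_def)
  have "cmat (X ^\<^sub>m p) = cmat A" unfolding cmat_pow[OF X] XZ Z_def q(2) ..
  then have Xp: "X ^\<^sub>m p = A" by (rule cmat_inj[OF pow_carrier_mat[OF X] A])
  have rot: "mat_poly (pcompose f [:0, w:]) ?B $$ (a, b) * D a = mat_poly f ?B $$ (a, b) * D b"
    if ab: "a < n" "b < n" for f a b
  proof -
    have Bk: "w ^ k * (?B ^\<^sub>m k) $$ (a, b) * D a = (?B ^\<^sub>m k) $$ (a, b) * D b" for k
    proof (cases "(?B ^\<^sub>m k) $$ (a, b) = 0")
      case False
      have "D b = w ^ k * D a"
        by (rule shift_pow[OF cA _ ab False]) (use arc A in auto)
      then show ?thesis by simp
    qed simp
    have deg: "degree (pcompose f [:0, w:]) \<le> degree f"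
      using degree_pcompose_le[of f "[:0, w:]"] by (simp split: if_splits)
    have "mat_poly (pcompose f [:0, w:]) ?B $$ (a, b) * D a
        = (\<Sum>k\<le>degree f. coeff f k * (w ^ k * (?B ^\<^sub>m k) $$ (a, b) * D a))"
      unfolding mat_poly_index[OF cA ab deg] coeff_pcompose_linear sum_distrib_right
      by (simp add: mult_ac)
    also have "\<dots> = mat_poly f ?B $$ (a, b) * D b"
      unfolding Bk mat_poly_index[OF cA ab order_refl] sum_distrib_right by (simp add: mult_ac)
    finally show ?thesis .
  qed
  have rotZ: "mat_poly (pcompose q [:0, w:]) ?B = mat_poly (Polynomial.smult (w ^ s) q) ?B"
  proof (rule mat_poly_root_unique[OF cA p])
    show "poly (pcompose q [:0, w:]) l = poly (Polynomial.smult (w ^ s) q) l" if "l \<in> ?\<sigma>" for l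
      using gr[OF that wh] q(1) that spectrum_rot1[OF that] by (simp add: poly_pcompose mult.commute)
    show "poly (Polynomial.smult (w ^ s) q) l \<noteq> 0" if "l \<in> ?\<sigma>" for l
      using g0 q(1) that w0 by simp
    have "mat_poly (pcompose q [:0, w:]) ?B ^\<^sub>m p = mat_poly (pcompose (q ^ p) [:0, w:]) ?B"
      by (simp only: pcompose_power mat_poly_power[OF cA])
    also have "\<dots> = w \<cdot>\<^sub>m ?B"
    proof (rule eq_matI)
      fix a b assume "a < dim_row (w \<cdot>\<^sub>m ?B)" "b < dim_col (w \<cdot>\<^sub>m ?B)"
      then have ab: "a < n" "b < n" using A by auto
      have "mat_poly (pcompose (q ^ p) [:0, w:]) ?B $$ (a, b) * D a = ?B $$ (a, b) * D b"
        unfolding rot[OF ab] mat_poly_power[OF cA] q(2) ..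
      also have "\<dots> = w * ?B $$ (a, b) * D a" using arc[OF ab] ab A by (cases "A $$ (a, b) = 0") auto
      finally show "mat_poly (pcompose (q ^ p) [:0, w:]) ?B $$ (a, b) = (w \<cdot>\<^sub>m ?B) $$ (a, b)"
        using D0[OF ab(1)] ab A by simp
    qed (use A in auto)
    also have "\<dots> = mat_poly (Polynomial.smult (w ^ s) q) ?B ^\<^sub>m p"
      unfolding mat_poly_smult[OF cA] smult_pow_mat[OF mat_poly_carrier[OF cA]] q(2)
      using sp[OF wh] by (simp add: power_mult)
    finally show "mat_poly (pcompose q [:0, w:]) ?B ^\<^sub>m p = mat_poly (Polynomial.smult (w ^ s) q) ?B ^\<^sub>m p" .
  qed
  have sh: "D b = w ^ s * D a" if ab: "a < n" "b < n" "X $$ (a, b) \<noteq> 0" for a b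
  proof -
    have "Z $$ (a, b) * (w ^ s * D a) = Z $$ (a, b) * D b"
      using rot[OF ab(1,2), of q] Z ab(1,2) unfolding rotZ mat_poly_smult[OF cA] Z_def[symmetric] by simp
    moreover have "Z $$ (a, b) \<noteq> 0" using ab X unfolding XZ[symmetric] by simp
    ultimately have "w ^ s * D a = D b" by simp
    then show ?thesis ..
  qed
  obtain m where m: "m > 0" "g (of_real \<rho>) = of_real m" using grho by (auto simp: pos_reals_def)
  have qrho: "poly q (of_real \<rho>) = of_real m" using q(1) br.rho(1) m(2) by simp
  have Xx: "mat_app X x i = m * x i" if i: "i < n" for i
  proof -
    have "complex_of_real (mat_app X x i) = of_real (m * x i)"
      using mat_app_mat_poly[OF cA x_eigenvector i, of q] mat_app_cmat_of_real[of i X x] X i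
      by (simp add: Z_def[symmetric] XZ[symmetric] qrho)
    then show ?thesis using of_real_eq_iff by blast
  qed
  have T: "cmat (transpose_mat A) \<in> carrier_mat n n" using A by simp
  have tr: "transpose_mat (cmat M) = cmat (transpose_mat M)" for M by (intro eq_matI) auto
  have yX: "mat_app (transpose_mat X) y i = m * y i" if i: "i < n" for i
  proof -
    have y_ev: "mat_app (cmat (transpose_mat A)) (\<lambda>j. complex_of_real (y j)) i = of_real \<rho> * of_real (y i)"
      if "i < n" for i
      using mat_app_cmat_of_real[of i "transpose_mat A" y] y(2)[OF that] that A by simp
    have "mat_poly q (cmat (transpose_mat A)) = cmat (transpose_mat X)"
      using transpose_mat_poly[OF cA, of q] by (simp add: tr Z_def[symmetric] XZ[symmetric])
    then have "complex_of_real (mat_app (transpose_mat X) y i) = of_real (m * y i)"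
      using mat_app_mat_poly[OF T y_ev i, of q] mat_app_cmat_of_real[of i "transpose_mat X" y] X i
      by (simp add: qrho)
    then show ?thesis using of_real_eq_iff by blast
  qed
  have "(w ^ s) ^ h = 1" using roots by blast
  then have "eventually_nonneg X" by (rule eventually_nonneg_root[OF X _ p sh Xx yX Xp m(1)])
  then show ?thesis using X Xp XZ q(1) unfolding Z_def by blast
qed

text \<open>The choice of the polynomial does not matter on the spectrum.\<close>

definition root_values :: "real mat \<Rightarrow> complex \<Rightarrow> complex" where
  "root_values X = restrict (poly (SOME q. cmat X = mat_poly q (cmat A))) (spectrum (cmat A))"

lemma root_values_eq:
  assumes "cmat X = mat_poly q (cmat A)"
  shows "root_values X = restrict (poly q) (spectrum (cmat A))"
proof -
  have "cmat X = mat_poly (SOME q. cmat X = mat_poly q (cmat A)) (cmat A)"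
    using someI[of "\<lambda>q. cmat X = mat_poly q (cmat A)", OF assms] .
  then show ?thesis using poly_value_unique assms unfolding root_values_def
    by (intro restrict_ext) metis
qed

lemma ev_nonneg_primary_roots_iff:
  "X \<in> ev_nonneg_primary_roots p A \<longleftrightarrow> X \<in> carrier_mat n n \<and> X ^\<^sub>m p = A
     \<and> (\<exists>q. cmat X = mat_poly q (cmat A)) \<and> eventually_nonneg X"
proof -
  have "cmat X ^\<^sub>m p = cmat A \<longleftrightarrow> X ^\<^sub>m p = A" if "X \<in> carrier_mat n n"
    using cmat_inj[OF pow_carrier_mat[OF that] A] unfolding cmat_pow[OF that, symmetric] by auto
  moreover have "cmat X \<in> carrier_mat n n \<longleftrightarrow> X \<in> carrier_mat n n" unfolding carrier_mat_def by simp
  ultimately show ?thesis using A unfolding ev_nonneg_primary_roots_def primary_root_def by auto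
qed

lemma bij_ev_nonneg_primary_roots: "bij_betw root_values (ev_nonneg_primary_roots p A) br.admissible"
proof (rule bij_betw_imageI)
  show "inj_on root_values (ev_nonneg_primary_roots p A)"
  proof (rule inj_onI)
    fix X X' assume X: "X \<in> ev_nonneg_primary_roots p A" and X': "X' \<in> ev_nonneg_primary_roots p A"
      and eq: "root_values X = root_values X'"
    obtain q where q: "cmat X = mat_poly q (cmat A)" using X ev_nonneg_primary_roots_iff by blast
    obtain q' where q': "cmat X' = mat_poly q' (cmat A)" using X' ev_nonneg_primary_roots_iff by blast
    have c: "X \<in> carrier_mat n n" "X' \<in> carrier_mat n n" "X ^\<^sub>m p = A" "X' ^\<^sub>m p = A" "eventually_nonneg X'"
      using X X' ev_nonneg_primary_roots_iff by auto
    have "mat_poly q (cmat A) = mat_poly q' (cmat A)"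
    proof (rule mat_poly_root_unique[OF cA p])
      show "poly q l = poly q' l" if "l \<in> spectrum (cmat A)" for l
        using fun_cong[OF eq, of l] that by (simp add: root_values_eq[OF q] root_values_eq[OF q'])
      show "poly q' l \<noteq> 0" if "l \<in> spectrum (cmat A)" for l
        using root_value_pow[OF c(2,4) q' c(5) that] that inv p by (auto simp: zero_power)
      show "mat_poly q (cmat A) ^\<^sub>m p = mat_poly q' (cmat A) ^\<^sub>m p"
        unfolding q[symmetric] q'[symmetric] cmat_pow[OF c(1), symmetric] cmat_pow[OF c(2), symmetric]
        using c by simp
    qed
    then show "X = X'" using cmat_inj[OF c(1,2)] q q' by simp
  qed
  show "root_values ` ev_nonneg_primary_roots p A = br.admissible"
  proof (intro equalityI subsetI)
    fix g assume "g \<in> root_values ` ev_nonneg_primary_roots p A"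
    then obtain X where X: "X \<in> ev_nonneg_primary_roots p A" "g = root_values X" by blast
    then obtain q where q: "cmat X = mat_poly q (cmat A)" using ev_nonneg_primary_roots_iff by blast
    then show "g \<in> br.admissible"
      using X root_values_eq[OF q] root_values_admissible[OF _ _ q] ev_nonneg_primary_roots_iff by auto
  next
    fix g assume g: "g \<in> br.admissible"
    then obtain X q where X: "X \<in> carrier_mat n n" "X ^\<^sub>m p = A" "cmat X = mat_poly q (cmat A)"
      "eventually_nonneg X" "\<forall>l\<in>spectrum (cmat A). poly q l = g l"
      using admissible_root_exists by blast
    then have "X \<in> ev_nonneg_primary_roots p A" using ev_nonneg_primary_roots_iff by blast
    moreover have "root_values X = g"
      unfolding root_values_eq[OF X(3)] using X(5) g
      by (intro extensionalityI[of _ "spectrum (cmat A)"]) (auto simp: br.admissible_def)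
    ultimately show "g \<in> root_values ` ev_nonneg_primary_roots p A" by blast
  qed
qed

end

section \<open>Cyclic Jordan forms and the count\<close>

lemma invertible_mat_det_nonzero:
  fixes A :: "'a::comm_ring_1 mat"
  assumes A: "A \<in> carrier_mat n n" and inv: "invertible_mat A"
  shows "det A \<noteq> 0"
proof -
  obtain B where B: "A * B = 1\<^sub>m n" "B * A = 1\<^sub>m (dim_row B)"
    using inv A by (auto simp: invertible_mat_def inverts_mat_def)
  have "dim_col B = n" using B(1) by (metis index_mult_mat(3) index_one_mat(3))
  moreover have "dim_row B = n" using B(2) A by (metis index_mult_mat(3) index_one_mat(3) carrier_matD(2))
  ultimately have "B \<in> carrier_mat n n" by auto
  then have "det A * det B = 1" using det_mult[OF A, of B] B(1) by simp
  then show ?thesis by auto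
qed

lemma spectrum_jordan_nf:
  fixes B :: "complex mat"
  assumes B: "B \<in> carrier_mat n n" and jnf: "jordan_nf B js"
  shows "spectrum B = snd ` set js"
proof -
  have nz: "0 \<notin> fst ` set js" using jnf by (simp add: jordan_nf_def)
  have cp: "char_poly B = (\<Prod>(m, a)\<leftarrow>js. [:- a, 1:] ^ m)" by (rule jordan_nf_char_poly[OF jnf])
  have "poly (\<Prod>(m, a)\<leftarrow>js. [:- a, 1:] ^ m) k = 0 \<longleftrightarrow> k \<in> snd ` set js" if "0 \<notin> fst ` set js" for k
    using that by (induction js) (force simp: poly_power)+
  then show ?thesis unfolding spectrum_root_char_poly[OF B] cp using nz by auto
qed

lemma spectrum_cyc_jordan_block:
  assumes r: "fst b \<noteq> 0" and h: "h > 0"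
  shows "spectrum (cyc_jordan_block h b) = {u * snd b | u. u ^ h = 1}"
proof -
  let ?js = "cyc_jordan_list h b"
  have "exp (2 * of_real pi * \<i> / of_nat h) = cis (2 * pi / h)" by (simp add: cis_conv_exp mult_ac)
  note roots = roots_of_unity_powers[OF h this]
  have c: "cyc_jordan_block h b \<in> carrier_mat (sum_list (map fst ?js)) (sum_list (map fst ?js))"
    unfolding cyc_jordan_block_def by simp
  have "0 \<notin> fst ` set ?js" using r by (auto simp: cyc_jordan_list_def)
  then have "jordan_nf (cyc_jordan_block h b) ?js"
    unfolding jordan_nf_def cyc_jordan_block_def using similar_mat_refl[OF c[unfolded cyc_jordan_block_def]] by simp
  then have "spectrum (cyc_jordan_block h b) = snd ` set ?js" by (rule spectrum_jordan_nf[OF c])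
  also have "\<dots> = {u * snd b | u. u ^ h = 1}"
  proof (intro equalityI subsetI)
    fix l assume "l \<in> {u * snd b | u. u ^ h = 1}"
    then obtain u where u: "u ^ h = 1" "l = u * snd b" by blast
    obtain k where k: "k < h" "u = cis (2 * pi * real k / real h)"
      using u(1) bij_betw_roots_unity[OF h] by (auto simp: bij_betw_def)
    have "u = exp (2 * of_real pi * \<i> / of_nat h) ^ k"
      unfolding k(2) \<open>exp _ = cis _\<close> by (simp add: DeMoivre mult_ac)
    then show "l \<in> snd ` set ?js" using k(1) u(2) by (auto simp: cyc_jordan_list_def image_iff mult.commute)
  next
    fix l assume "l \<in> snd ` set ?js"
    then have "l \<in> (\<lambda>k. snd b * exp (2 * of_real pi * \<i> / of_nat h) ^ k) ` {0..<h}"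
      by (simp add: cyc_jordan_list_def image_image)
    then obtain k where "l = snd b * exp (2 * of_real pi * \<i> / of_nat h) ^ k" by blast
    then show "l \<in> {u * snd b | u. u ^ h = 1}" using roots by (auto simp: mult.commute)
  qed
  finally show ?thesis .
qed

lemma block_head_in_cyc_jordan_sum:
  assumes "b \<in> set bs" "h > 0"
  shows "(fst b, snd b) \<in> set (cyc_jordan_sum h bs)"
proof -
  have "(fst b, snd b) = (\<lambda>k. (fst b, snd b * exp (2 * of_real pi * \<i> / of_nat h) ^ k)) 0" by simp
  moreover have "0 \<in> set [0..<h]" using assms(2) by simp
  ultimately have "(fst b, snd b) \<in> set (cyc_jordan_list h b)"
    unfolding cyc_jordan_list_def set_map by (rule image_eqI)
  then show ?thesis using assms(1) unfolding cyc_jordan_sum_def by (simp only: set_concat set_map) blast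
qed

lemma unity_root_power_inverse:
  assumes "gcd h p = (1::nat)" "h > 1"
  shows "\<exists>s. \<forall>u :: complex. u ^ h = 1 \<longrightarrow> u ^ (s * p) = u"
proof -
  have "p \<noteq> 0" using assms by (intro notI) simp
  then obtain s m where "p * s = h * m + gcd p h" using bezout_nat by blast
  then have m: "s * p = h * m + 1" using assms(1) by (simp add: gcd.commute mult.commute)
  have "u ^ (s * p) = u" if "u ^ h = 1" for u :: complex
    unfolding m using that by (simp add: power_add power_mult)
  then show ?thesis by blast
qed

context cyclic_perron_root
begin

lemma no_root_of_negative:
  assumes "even p" "l \<in> spectrum (cmat A)" "l \<in> neg_reals"
  shows "br.admissible = {}"
proof -
  have False if g: "g \<in> br.admissible" for g
  proof -
    obtain t where t: "t < 0" "l = of_real t" using assms(3) by (auto simp: neg_reals_def)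
    have "g l ^ p = l" "g (cnj l) = cnj (g l)" using g assms(2) by (auto simp: br.admissible_def)
    then have "cnj (g l) = g l" using t by simp
    then obtain z where z: "g l = of_real z" by (metis Reals_cases Reals_cnj_iff)
    have "complex_of_real (z ^ p) = of_real t" using \<open>g l ^ p = l\<close> z t by simp
    then have "z ^ p = t" using of_real_eq_iff by blast
    then show False using t assms(1) by (metis not_less zero_le_even_power)
  qed
  then show ?thesis by blast
qed

lemma card_ev_nonneg_primary_roots:
  "finite (ev_nonneg_primary_roots p A)" "card (ev_nonneg_primary_roots p A) = card br.admissible"
  using bij_betw_finite[OF bij_ev_nonneg_primary_roots] bij_betw_same_card[OF bij_ev_nonneg_primary_roots]
    br.finite_admissible by auto

end

text \<open>If \<open>u\<close> rotates the conjugate of \<open>l\<close> to \<open>l\<close>, then \<open>v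
  l\<close> is real for any square root \<open>v\<close> of the conjugate of \<open>u\<close>, and
  for odd \<open>h\<close> this square root can be found among the \<open>h\<close>-th roots of
  unity.\<close>

lemma (in root_branches) self_conj_odd_has_real:
  assumes "odd h" and l: "l \<in> \<sigma>" and sc: "cnj ` orb l = orb l"
  shows "orb l \<inter> \<real> \<noteq> {}"
proof -
  obtain u where u: "u ^ h = 1" "u * cnj l = l" using sc self_conj_iff unfolding self_conj_def by blast
  obtain k where k: "h = 2 * k + 1" using assms(1) by (auto elim: oddE)
  \<comment> \<open>Since \<open>2 (k + 1) = h + 1\<close>, this is a square root of \<open>cnj u\<close>.\<close>
  define v where "v = cnj u ^ (k + 1)"
  have vh: "v ^ h = 1" unfolding v_def using rot_cnj[OF u(1)] by (metis power_mult mult.commute power_one)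
  have uu: "u * cnj u = 1" using rot_norm[OF u(1)] by (simp flip: complex_norm_square)
  have v2: "v * v = cnj u"
  proof -
    have "v * v = cnj u ^ h * cnj u" unfolding v_def k by (simp add: power_add[symmetric] mult_2 flip: power_Suc2)
    then show ?thesis using rot_cnj[OF u(1)] by simp
  qed
  have "cnj v * v = 1" using rot_norm[OF vh] by (simp add: mult.commute[of "cnj v"] flip: complex_norm_square)
  have "cnj (v * l) = cnj v * cnj l" by simp
  also have "\<dots> = cnj v * (cnj u * (u * cnj l))" using uu by (simp add: mult.assoc[symmetric] mult.commute[of "cnj u"])
  also have "\<dots> = cnj v * (v * v * l)" unfolding u(2) v2 ..
  also have "\<dots> = v * l" using \<open>cnj v * v = 1\<close> by (simp add: mult.assoc[symmetric])
  finally have "v * l \<in> \<real>" by (simp add: Reals_cnj_iff)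
  moreover have "v * l \<in> orb l" using vh by (auto simp: orb_def)
  ultimately show ?thesis by blast
qed

text \<open>The blocks of the Jordan form match the rotation orbits on the spectrum; blocks that differ only
  in size give the same orbit. A block with a real eigenvalue is self-conjugate, so conjugate pairs
  occur among the nonreal blocks only. For even \<open>p\<close> the number \<open>h\<close> is odd
  and a nonreal block is never self-conjugate, so without negative eigenvalues the self-conjugate
  orbits are the spectra of the positive blocks.\<close>

theorem theorem3p2:
  fixes A :: "real mat" and n h p r\<^sub>1 r\<^sub>2 c :: nat
    and Ps :: "nat set list"
    and bp bm bc :: "(nat \<times> complex) list"
  assumes "A \<in> carrier_mat n n"
    and "entrywise_nonneg A"
    and "invertible_mat A"
    and "irreducible_mat A"
    and "imprimitive_mat A"
    and "h = cyclic_index A" and "h > 1"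
    and "describes_cyclic h Ps A"
    and "p > 1" and "gcd h p = 1"
    and "jordan_nf (cmat A) (cyc_jordan_sum h bp @ cyc_jordan_sum h bm @ cyc_jordan_sum h bc)"
    and "sorted_blocks h bp bm bc"
    and "r\<^sub>1 = num_real_blocks h bp"
    and "r\<^sub>2 = num_real_blocks h bm"
    and "c = num_conjugate_pairs h bc"
  shows "(even p \<longrightarrow>
            (r\<^sub>2 = 0 \<longrightarrow> finite (ev_nonneg_primary_roots p A) \<and>
                        card (ev_nonneg_primary_roots p A) = 2 ^ (r\<^sub>1 - 1) * p ^ c) \<and>
            (r\<^sub>2 > 0 \<longrightarrow> ev_nonneg_primary_roots p A = {})) \<and>
         (odd p \<longrightarrow> finite (ev_nonneg_primary_roots p A) \<and>
                    card (ev_nonneg_primary_roots p A) = p ^ c)"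
proof -
  have h0: "h > 0" using assms(7) by simp
  have cA: "cmat A \<in> carrier_mat n n" using assms(1) by simp
  obtain D \<rho> x y where "cyclic_perron A n h (cis (2 * pi / h)) D \<rho> x y"
    using cyclic_perron_exists[OF assms(1-4,6,8) refl] by blast
  then interpret cyclic_perron A n h "cis (2 * pi / h)" D \<rho> x y .
  obtain s where s: "\<forall>u :: complex. u ^ h = 1 \<longrightarrow> u ^ (s * p) = u"
    using unity_root_power_inverse[OF assms(10,7)] by blast
  have nz: "0 \<notin> spectrum (cmat A)"
  proof
    assume "0 \<in> spectrum (cmat A)"
    then have "eigenvalue (cmat A) 0" by (simp add: spectrum_def)
    moreover have "char_matrix (cmat A) 0 = cmat A"
      using assms(1) by (intro eq_matI) (auto simp: char_matrix_def)
    ultimately have "det (cmat A) = 0" using eigenvalue_det[OF cA, of 0] by simp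
    then have "complex_of_real (det A) = 0" by (simp add: of_real_hom.hom_det)
    then show False using assms(1,3) invertible_mat_det_nonzero by auto
  qed
  interpret cyclic_perron_root A n h "cis (2 * pi / h)" D \<rho> x y p s
    by unfold_locales (use assms(9) s nz in auto)
  let ?\<sigma> = "spectrum (cmat A)" and ?bs = "bp @ bm @ bc"
  have sum_js: "cyc_jordan_sum h bp @ cyc_jordan_sum h bm @ cyc_jordan_sum h bc = cyc_jordan_sum h ?bs"
    by (simp add: cyc_jordan_sum_def)
  have jnf: "jordan_nf (cmat A) (cyc_jordan_sum h ?bs)" using assms(11) sum_js by simp
  have size: "fst b \<noteq> 0" if "b \<in> set ?bs" for b
  proof -
    have "fst b \<in> fst ` set (cyc_jordan_sum h ?bs)"
      using imageI[OF block_head_in_cyc_jordan_sum[OF that h0], of fst] by (simp only: fst_conv)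
    then show ?thesis using jnf unfolding jordan_nf_def by metis
  qed
  have block: "spectrum (cyc_jordan_block h b) = br.orb (snd b)" if "b \<in> set ?bs" for b
    unfolding br.orb_def by (rule spectrum_cyc_jordan_block[OF size[OF that] h0])
  have in_spec: "snd b \<in> ?\<sigma>" if "b \<in> set ?bs" for b
    unfolding spectrum_jordan_nf[OF cA jnf]
    using imageI[OF block_head_in_cyc_jordan_sum[OF that h0], of snd] by (simp only: snd_conv)
  have cover: "\<exists>b\<in>set ?bs. l \<in> br.orb (snd b)" if l: "l \<in> ?\<sigma>" for l
  proof -
    obtain b where b: "b \<in> set ?bs" "l \<in> snd ` set (cyc_jordan_list h b)"
    proof -
      have "l \<in> snd ` set (cyc_jordan_sum h ?bs)" using l unfolding spectrum_jordan_nf[OF cA jnf] .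
      then show thesis using that unfolding cyc_jordan_sum_def set_concat set_map by blast
    qed
    have "l \<in> (\<lambda>k. snd b * exp (2 * of_real pi * \<i> / of_nat h) ^ k) ` {0..<h}"
      using b(2) by (simp add: cyc_jordan_list_def image_image)
    then obtain k where "l = snd b * exp (2 * of_real pi * \<i> / of_nat h) ^ k" by blast
    moreover have "exp (2 * of_real pi * \<i> / of_nat h) = cis (2 * pi / h)" by (simp add: cis_conv_exp mult_ac)
    ultimately have "l \<in> br.orb (snd b)" using roots unfolding br.orb_def by (auto simp: mult.commute)
    then show ?thesis using b(1) by blast
  qed
  have all_orbs: "br.orb ` ?\<sigma> = block_spectra h ?bs"
  proof (intro equalityI subsetI)
    fix S assume "S \<in> br.orb ` ?\<sigma>"
    then obtain l where l: "l \<in> ?\<sigma>" "S = br.orb l" by blast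
    obtain b where b: "b \<in> set ?bs" "l \<in> br.orb (snd b)" using cover[OF l(1)] by blast
    then have "S = spectrum (cyc_jordan_block h b)" using block[OF b(1)] br.orb_eq_iff l(2) by metis
    then show "S \<in> block_spectra h ?bs" using b(1) by (auto simp: block_spectra_def)
  next
    fix S assume "S \<in> block_spectra h ?bs"
    then obtain b where "b \<in> set ?bs" "S = spectrum (cyc_jordan_block h b)" unfolding block_spectra_def by blast
    then show "S \<in> br.orb ` ?\<sigma>" using block in_spec by blast
  qed
  note sorted = assms(12)[unfolded sorted_blocks_def, rule_format]
  have pos_iff: "b \<in> set bp \<longleftrightarrow> spectrum (cyc_jordan_block h b) \<inter> pos_reals \<noteq> {} \<and>
      spectrum (cyc_jordan_block h b) \<inter> neg_reals = {}" if "b \<in> set ?bs" for b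
    using sorted[OF that] by blast
  have neg_iff: "b \<in> set bm \<longleftrightarrow> spectrum (cyc_jordan_block h b) \<inter> neg_reals \<noteq> {}" if "b \<in> set ?bs" for b
    using sorted[OF that] by blast
  have nonreal_iff: "b \<in> set bc \<longleftrightarrow> spectrum (cyc_jordan_block h b) \<inter> \<real> = {}" if "b \<in> set ?bs" for b
    using sorted[OF that] by blast
  have reals: "pos_reals \<subseteq> \<real>" "neg_reals \<subseteq> \<real>" by (auto simp: pos_reals_def neg_reals_def)
  have pairs: "{{S, cnj ` S} | S. S \<in> br.orb ` ?\<sigma> \<and> cnj ` S \<noteq> S}
      = {{S, cnj ` S} | S. S \<in> block_spectra h bc \<and> cnj ` S \<noteq> S}"
  proof -
    have "S \<in> block_spectra h ?bs \<longleftrightarrow> S \<in> block_spectra h bc" if ns: "cnj ` S \<noteq> S" for S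
    proof
      assume "S \<in> block_spectra h ?bs"
      then obtain b where b: "b \<in> set ?bs" "S = spectrum (cyc_jordan_block h b)" unfolding block_spectra_def by blast
      have "S \<inter> \<real> = {}"
        using br.real_self_conj[of _ "snd b"] ns unfolding br.self_conj_def b(2) block[OF b(1)] by blast
      then have "b \<in> set bc" using nonreal_iff[OF b(1)] b(2) by simp
      then show "S \<in> block_spectra h bc" using b(2) by (auto simp: block_spectra_def)
    qed (auto simp: block_spectra_def)
    then show ?thesis unfolding all_orbs by blast
  qed
  have c: "c = card {{S, cnj ` S} | S. S \<in> br.orb ` ?\<sigma> \<and> cnj ` S \<noteq> S}"
    unfolding pairs assms(15) num_conjugate_pairs_def ..
  note fin = card_ev_nonneg_primary_roots
  have odd_case: "card (ev_nonneg_primary_roots p A) = p ^ c" if "odd p"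
    unfolding fin(2) c by (rule br.card_admissible_odd[OF that])
  have neg_case: "ev_nonneg_primary_roots p A = {}" if ev: "even p" and r: "r\<^sub>2 > 0"
  proof -
    have "set bm \<noteq> {}" using r unfolding assms(14) num_real_blocks_def block_spectra_def by auto
    then have "\<exists>b. b \<in> set bm" unfolding ex_in_conv .
    then obtain b where b: "b \<in> set bm" ..
    then have b': "b \<in> set ?bs" by simp
    obtain l where l: "l \<in> spectrum (cyc_jordan_block h b)" "l \<in> neg_reals" using neg_iff[OF b'] b by blast
    then have "l \<in> ?\<sigma>" unfolding block[OF b'] using br.orb_subset[OF in_spec[OF b']] by blast
    then have "br.admissible = {}" by (rule no_root_of_negative[OF ev _ l(2)])
    then show ?thesis using fin by (metis card.empty card_0_eq)
  qed
  have even_case: "card (ev_nonneg_primary_roots p A) = 2 ^ (r\<^sub>1 - 1) * p ^ c" if ev: "even p" and r: "r\<^sub>2 = 0"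
  proof -
    have bm: "set bm = {}" using r unfolding assms(14) num_real_blocks_def block_spectra_def by simp
    have oh: "odd h"
    proof
      assume "even h"
      then have "2 dvd gcd h p" using ev by simp
      then show False using assms(10) by simp
    qed
    have self_iff: "cnj ` br.orb (snd b) = br.orb (snd b) \<longleftrightarrow> b \<in> set bp" if b: "b \<in> set ?bs" for b
    proof
      assume "b \<in> set bp"
      then obtain t where "t \<in> br.orb (snd b)" "t \<in> \<real>" using pos_iff[OF b] reals block[OF b] by blast
      then show "cnj ` br.orb (snd b) = br.orb (snd b)" using br.real_self_conj unfolding br.self_conj_def by blast
    next
      assume "cnj ` br.orb (snd b) = br.orb (snd b)"
      then have "b \<notin> set bc"
        using br.self_conj_odd_has_real[OF oh in_spec[OF b]] nonreal_iff[OF b] block[OF b] by blast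
      then show "b \<in> set bp" using b bm by auto
    qed
    have orbs: "{S \<in> br.orb ` ?\<sigma>. cnj ` S = S} = block_spectra h bp"
    proof (intro equalityI subsetI)
      fix S assume "S \<in> {S \<in> br.orb ` ?\<sigma>. cnj ` S = S}"
      then have S: "S \<in> block_spectra h ?bs" "cnj ` S = S" unfolding all_orbs by auto
      then obtain b where b: "b \<in> set ?bs" "S = spectrum (cyc_jordan_block h b)" unfolding block_spectra_def by blast
      then have "b \<in> set bp" using self_iff[OF b(1)] S(2) block[OF b(1)] by simp
      then show "S \<in> block_spectra h bp" using b(2) by (auto simp: block_spectra_def)
    next
      fix S assume "S \<in> block_spectra h bp"
      then obtain b where b: "b \<in> set bp" "S = spectrum (cyc_jordan_block h b)" unfolding block_spectra_def by blast
      then have b': "b \<in> set ?bs" by simp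
      have "cnj ` S = S" using self_iff[OF b'] b block[OF b'] by simp
      moreover have "S \<in> block_spectra h ?bs" using b b' unfolding block_spectra_def by blast
      ultimately show "S \<in> {S \<in> br.orb ` ?\<sigma>. cnj ` S = S}" unfolding all_orbs by blast
    qed
    have "card br.admissible = 2 ^ (card {S \<in> br.orb ` ?\<sigma>. cnj ` S = S} - 1)
        * p ^ card {{S, cnj ` S} | S. S \<in> br.orb ` ?\<sigma> \<and> cnj ` S \<noteq> S}"
    proof (rule br.card_admissible_even[OF ev])
      fix S assume "S \<in> br.orb ` ?\<sigma>" "cnj ` S = S"
      then have "S \<in> block_spectra h bp" using orbs by blast
      then obtain b where b: "b \<in> set bp" "S = spectrum (cyc_jordan_block h b)" unfolding block_spectra_def by blast
      then have "b \<in> set ?bs" by simp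
      then show "S \<inter> pos_reals \<noteq> {}" using pos_iff b by blast
    qed
    then show ?thesis unfolding fin(2) c orbs assms(13) num_real_blocks_def .
  qed
  show ?thesis using fin(1) odd_case neg_case even_case by blast
qed

end
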